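(* Let $k\in\mathbb{N}$ be fixed, let $p\in[1,\infty)$, and for each integer $n\ge k$ let $X_p^{(n)}$ be a random vector in $\mathbb{R}^n$ such that either $X_p^{(n)}\sim P^{(n)}_{p,R^{(n)}}$ for some random variable $R^{(n)}$ with values almost surely in $(0,\infty)$, or $X_p^{(n)}\sim\sigma_p^{(n)}$. Then the Maclaurin ratio $\mathscr{R}^{(n)}_{k,n,p}=\mathscr{R}^{(n)}_{k,n,p}(X_p^{(n)})$ satisfies $$\sqrt{n}\,\bigl(\mathrm{e}^{-m_p}\,\mathscr{R}^{(n)}_{k,n,p}-1\bigr)\xrightarrow[n\to\infty]{\mathrm{d}} Z,$$ where $Z\sim\mathcal{N}(0,s_p^2)$.
   Context: For $x\in\mathbb{R}^n$ and $p\in[1,\infty)$ let $\|x\|_p=(\sum_{i=1}^n|x_i|^p)^{1/p}$, $\mathbb{B}_p^n=\{x\in\mathbb{R}^n:\|x\|_p\le1\}$, $\mathbb{S}_p^{n-1}=\{x\in\mathbb{R}^n:\|x\|_p=1\}$. Cone measure: $\mu_p^{(n)}(A)=\lambda^{(n)}(\{ra:r\in[0,1],a\in A\})/\lambda^{(n)}(\mathbb{B}_p^n)$ for Borel $A\subset\mathbb{S}_p^{n-1}$, with $\lambda^{(n)}$ Lebesgue measure. Surface measure $\sigma_p^{(n)}$: the normalized (to total mass 1) $(n-1)$-dimensional Hausdorff measure on $\mathbb{S}_p^{n-1}$. For a random variable $R^{(n)}$ taking values a.s. in $(0,\infty)$, $P^{(n)}_{p,R^{(n)}}$ is the distribution of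 $R^{(n)}\Theta$, where $\Theta\sim\mu_p^{(n)}$ is independent of $R^{(n)}$. For $x\in\mathbb{R}^n$ and $1\le k\le n$ let $$S^{(n)}_{k,p}(x)=\Bigl(\tbinom{n}{k}^{-1}\sum_{1\le i_1<\dots<i_k\le n}|x_{i_1}|^p\cdots|x_{i_k}|^p\Bigr)^{1/(kp)},$$ and for $1\le k_1\le k_2\le n$ let $\mathscr{R}^{(n)}_{k_1,k_2,p}(x)=S^{(n)}_{k_2,p}(x)/S^{(n)}_{k_1,p}(x)$. The $p$-Gaussian distribution has Lebesgue density $x\mapsto \frac{1}{2p^{1/p}\Gamma(1+1/p)}\mathrm{e}^{-|x|^p/p}$ on $\mathbb{R}$. For $X$ a $p$-Gaussian random variable, $m_p=\mathbb{E}[\log|X|]$ and $s_p^2=\operatorname{Var}\bigl[\log|X|-\tfrac1p|X|^p\bigr]$. $\xrightarrow{\mathrm{d}}$ denotes convergence in distribution. *)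

theory Defs
  imports "HOL-Probability.Probability"
begin

text \<open>
  Since the dimension \<open>n\<close> varies, a point of \<open>\<real>\<^sup>n\<close> is an extensional function on the index set
  \<open>{..<n}\<close>, so that coordinates are numbered \<open>0, \<dots>, n - 1\<close>. The space \<open>\<real>\<^sup>n\<close> itself is
  \<open>{..<n} \<rightarrow>\<^sub>E UNIV\<close>, the underlying space of the finite product measures.
\<close>

abbreviation borel_vec :: "nat \<Rightarrow> (nat \<Rightarrow> real) measure" where
  "borel_vec n \<equiv> \<Pi>\<^sub>M i\<in>{..<n}. borel"

abbreviation lborel_vec :: "nat \<Rightarrow> (nat \<Rightarrow> real) measure" where
  "lborel_vec n \<equiv> \<Pi>\<^sub>M i\<in>{..<n}. lborel"

definition scale_vec :: "nat \<Rightarrow> real \<Rightarrow> (nat \<Rightarrow> real) \<Rightarrow> nat \<Rightarrow> real" where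
  "scale_vec n r x = (\<lambda>i\<in>{..<n}. r * x i)"

definition lp_norm :: "nat \<Rightarrow> real \<Rightarrow> (nat \<Rightarrow> real) \<Rightarrow> real" where
  "lp_norm n p x = (\<Sum>i<n. \<bar>x i\<bar> powr p) powr (1 / p)"

definition lp_ball :: "nat \<Rightarrow> real \<Rightarrow> (nat \<Rightarrow> real) set" where
  "lp_ball n p = {x \<in> {..<n} \<rightarrow>\<^sub>E UNIV. lp_norm n p x \<le> 1}"

definition lp_sphere :: "nat \<Rightarrow> real \<Rightarrow> (nat \<Rightarrow> real) set" where
  "lp_sphere n p = {x \<in> {..<n} \<rightarrow>\<^sub>E UNIV. lp_norm n p x = 1}"


text \<open>
  The cone measure and the surface measure are regarded as Borel measures on \<open>\<real>\<^sup>n\<close> carried by the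
  sphere, whence the intersections with \<^const>\<open>lp_sphere\<close>. The set functions passed to
  \<^const>\<open>measure_of\<close> are countably additive on the Borel sets for \<open>n \<ge> 1\<close> and \<open>p \<ge> 1\<close> (otherwise
  \<^const>\<open>measure_of\<close> would return the zero measure).
\<close>

definition cone_over :: "nat \<Rightarrow> (nat \<Rightarrow> real) set \<Rightarrow> (nat \<Rightarrow> real) set" where
  "cone_over n A = {scale_vec n r a | r a. r \<in> {0..1} \<and> a \<in> A}"

definition cone_measure :: "nat \<Rightarrow> real \<Rightarrow> (nat \<Rightarrow> real) measure" where
  "cone_measure n p = measure_of (space (borel_vec n)) (sets (borel_vec n))
     (\<lambda>A. emeasure (lborel_vec n) (cone_over n (A \<inter> lp_sphere n p))
           / emeasure (lborel_vec n) (lp_ball n p))"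

text \<open>
  Hausdorff measure of integer dimension \<open>d\<close> for the Euclidean distance on \<open>\<real>\<^sup>n\<close>. The empty set
  contributes \<open>0\<close> to a cover also for \<open>d = 0\<close>, where every nonempty set contributes \<open>1\<close>, so that
  the case \<open>d = 0\<close> is counting measure. No dimensional constant is included, as it cancels in
  the normalized surface measure.
\<close>

definition euclid_diam :: "nat \<Rightarrow> (nat \<Rightarrow> real) set \<Rightarrow> ennreal" where
  "euclid_diam n U = (SUP x\<in>U. SUP y\<in>U. ennreal (L2_set (\<lambda>i. x i - y i) {..<n}))"

definition hausdorff_premeasure ::
    "nat \<Rightarrow> nat \<Rightarrow> ennreal \<Rightarrow> (nat \<Rightarrow> real) set \<Rightarrow> ennreal" where
  "hausdorff_premeasure n d \<delta> A =
     (INF U \<in> {U :: nat \<Rightarrow> (nat \<Rightarrow> real) set.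
                 (\<forall>j. U j \<subseteq> ({..<n} \<rightarrow>\<^sub>E UNIV) \<and> euclid_diam n (U j) \<le> \<delta>) \<and> A \<subseteq> (\<Union>j. U j)}.
        \<Sum>j. if U j = {} then 0 else euclid_diam n (U j) ^ d)"

definition hausdorff_measure :: "nat \<Rightarrow> nat \<Rightarrow> (nat \<Rightarrow> real) set \<Rightarrow> ennreal" where
  "hausdorff_measure n d A = (SUP \<delta>\<in>{0<..}. hausdorff_premeasure n d \<delta> A)"

definition surface_measure :: "nat \<Rightarrow> real \<Rightarrow> (nat \<Rightarrow> real) measure" where
  "surface_measure n p = measure_of (space (borel_vec n)) (sets (borel_vec n))
     (\<lambda>A. hausdorff_measure n (n - 1) (A \<inter> lp_sphere n p)
           / hausdorff_measure n (n - 1) (lp_sphere n p))"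

text \<open>
  The distribution of \<open>R \<Theta>\<close>, where \<open>R\<close> has distribution \<open>\<rho>\<close> and \<open>\<Theta>\<close> is distributed according to
  the cone measure and independent of \<open>R\<close>, i.e. the pair \<open>(R, \<Theta>)\<close> has the product distribution.
\<close>

definition radial_distribution :: "nat \<Rightarrow> real \<Rightarrow> real measure \<Rightarrow> (nat \<Rightarrow> real) measure" where
  "radial_distribution n p \<rho> =
     distr (\<rho> \<Otimes>\<^sub>M cone_measure n p) (borel_vec n) (\<lambda>(r, \<theta>). scale_vec n r \<theta>)"


definition maclaurin_mean :: "nat \<Rightarrow> nat \<Rightarrow> real \<Rightarrow> (nat \<Rightarrow> real) \<Rightarrow> real" where
  "maclaurin_mean n k p x =
     ((\<Sum>I\<in>{I. I \<subseteq> {..<n} \<and> card I = k}. \<Prod>i\<in>I. \<bar>x i\<bar> powr p) / real (n choose k))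
       powr (1 / (real k * p))"

definition maclaurin_ratio :: "nat \<Rightarrow> nat \<Rightarrow> nat \<Rightarrow> real \<Rightarrow> (nat \<Rightarrow> real) \<Rightarrow> real" where
  "maclaurin_ratio n k1 k2 p x = maclaurin_mean n k2 p x / maclaurin_mean n k1 p x"


definition p_gaussian :: "real \<Rightarrow> real measure" where
  "p_gaussian p = density lborel
     (\<lambda>x. ennreal (1 / (2 * p powr (1 / p) * Gamma (1 + 1 / p)) * exp (- (\<bar>x\<bar> powr p) / p)))"

definition log_mean :: "real \<Rightarrow> real" where
  "log_mean p = prob_space.expectation (p_gaussian p) (\<lambda>x. ln \<bar>x\<bar>)"

definition limit_variance :: "real \<Rightarrow> real" where
  "limit_variance p =
     prob_space.variance (p_gaussian p) (\<lambda>x. ln \<bar>x\<bar> - 1 / p * \<bar>x\<bar> powr p)"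

end

(*
  Let N be the p-norm and Y a vector of n independent p-Gaussians. The Maclaurin ratio is
  homogeneous of degree 0, so only the law of the direction of the random vector matters.

  The p-Gaussian density is a function of N. Hence, for a scale-invariant set G, the probability
  that Y lies in G is the proportion of the unit ball lying in G, which is the cone measure of G;
  this settles the radial case once the limit theorem is known for Y.

  The Hausdorff measure on the sphere has density proportional to |grad N| with respect to the cone
  measure: near a point with nonzero coordinates the radial projection to the tangent hyperplane is
  almost isometric, a Householder reflection moves that hyperplane to a coordinate hyperplane, and on
  R^d the d-dimensional Hausdorff measure is a multiple of Lebesgue measure by uniqueness of Haar
  measure. On the sphere |grad N| equals W(x) = (sum |x_i|^(2p-2))^(1/2), which is homogeneous of
  degree p-1, so that the surface measure of G is E[W(Y); Y in G] / E[W(Y)]. As W(Y) / sqrt n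
  converges to a constant in L^1, the surface and cone measures of G differ by O(1 / sqrt n),
  uniformly in G.

  For Y itself, k! e_k / p_1^k = 1 + O(p_2 / p_1^2) for elementary symmetric polynomials and power
  sums of the |Y_i|^p. Hence the logarithm of the ratio is the mean of ln |Y_i| minus (1/p) times the
  logarithm of the mean of |Y_i|^p up to O_P(1/n), and E|Y_i|^p = 1 reduces the claim to the central
  limit theorem for ln |Y_i| - |Y_i|^p / p.
*)

theory Submission
  imports Defs "HOL-Real_Asymp.Real_Asymp"
begin

section \<open>Lebesgue integrals on \<open>\<real>\<^sup>n\<close>\<close>

text \<open>Both laws in the statement rest on \<open>measure_of\<close>, which falls back on the
  zero measure when its set function is not countably additive. The normalized set functions are
  never shown to be countably additive: the law of \<open>X n\<close> has mass 1, and this excludes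
  the zero measure.

  The Hausdorff density is found without an area formula. On a small piece of the sphere both
  measures are compared with the Lebesgue measure of one chart domain, up to a factor \<Lambda> > 1;
  countably many pieces suffice, and \<Lambda> > 1 is arbitrary. Since the comparison is made
  coordinatewise and up to factors, points with a vanishing coordinate are set aside as null sets;
  for p = 1 the norm even has kinks there.

  Radial projection is the convenient chart because parallel hyperplanes cut the cone over a piece
  into multiples of a single set, whose volume is then explicit.

  The p-Gaussian vectors of all dimensions are restrictions of one infinite sequence, to which the
  central limit theorem applies. As the event under study changes with the dimension, the passage to
  the other laws needs a bound uniform over all scale-invariant sets.\<close>

lemma sets_lborel_vec: "sets (PiM I (\<lambda>_. lborel :: real measure)) = sets (PiM I (\<lambda>_. borel))"
  by (intro sets_PiM_cong) auto

lemma measurable_lborel_vec [simp]: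
  "measurable (PiM I (\<lambda>_. lborel :: real measure)) N = measurable (PiM I (\<lambda>_. borel)) N"
  by (intro measurable_cong_sets sets_lborel_vec refl)

lemma space_lborel_vec [simp]:
  "space (PiM I (\<lambda>_. lborel :: real measure)) = space (PiM I (\<lambda>_. borel :: real measure))"
  by (simp add: space_PiM)

interpretation lborel_PiM: product_sigma_finite "\<lambda>_ :: nat. lborel :: real measure"
  by standard

lemma sigma_finite_lborel_vec: "finite I \<Longrightarrow> sigma_finite_measure (PiM (I :: nat set) (\<lambda>_. lborel :: real measure))"
  by (intro lborel_PiM.sigma_finite)

text \<open>Fubini isolates coordinate \<open>j\<close>. As \<open>h\<close> ignores that coordinate
  (\<open>hj\<close>), the inner integral undergoes a one-dimensional affine substitution with fixed
  offset. Scalings, translations, shears and reflections are all composed of such maps.\<close>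

lemma nn_integral_PiM_affine_coordinate:
  fixes F :: "(nat \<Rightarrow> real) \<Rightarrow> ennreal" and h :: "(nat \<Rightarrow> real) \<Rightarrow> real"
  assumes I: "finite I" "j \<in> I" and a: "a \<noteq> 0"
    and F [measurable]: "F \<in> borel_measurable (PiM I (\<lambda>_. borel))"
    and h [measurable]: "h \<in> borel_measurable (PiM I (\<lambda>_. borel))"
    and hj: "\<And>x y. h (x(j := y)) = h x"
  shows "(\<integral>\<^sup>+x. F (x(j := a * x j + h x)) \<partial>PiM I (\<lambda>_. lborel)) = ennreal (1 / \<bar>a\<bar>) * (\<integral>\<^sup>+x. F x \<partial>PiM I (\<lambda>_. lborel))"
proof -
  define J where "J = I - {j}"
  have J: "finite J" "j \<notin> J" "I = insert j J" using I by (auto simp: J_def)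
  have m [measurable]: "(\<lambda>x. x(j := a * x j + h x)) \<in> measurable (PiM I (\<lambda>_. borel)) (PiM I (\<lambda>_. borel))"
    by (rule measurable_fun_upd[where J=I]) (use I in auto)
  have FF: "(\<integral>\<^sup>+x. F x \<partial>PiM I (\<lambda>_. lborel)) = (\<integral>\<^sup>+x. (\<integral>\<^sup>+y. F (x(j := y)) \<partial>lborel) \<partial>PiM J (\<lambda>_. lborel))"
    using F unfolding J(3) by (intro lborel_PiM.product_nn_integral_insert) (use J in auto)
  have mc: "(\<lambda>y. F (x(j := y))) \<in> borel_measurable borel" if "x \<in> space (PiM J (\<lambda>_. borel))" for x
  proof -
    have [measurable]: "(\<lambda>y. x(j := y)) \<in> measurable borel (PiM I (\<lambda>_. borel))"
      by (rule measurable_fun_upd[where J=J]) (use J that in auto)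
    show ?thesis by measurable
  qed
  have "(\<integral>\<^sup>+x. F (x(j := a * x j + h x)) \<partial>PiM I (\<lambda>_. lborel)) =
     (\<integral>\<^sup>+x. (\<integral>\<^sup>+y. F (x(j := h x + a * y)) \<partial>lborel) \<partial>PiM J (\<lambda>_. lborel))"
    using measurable_compose[OF m F] unfolding J(3)
    by (subst lborel_PiM.product_nn_integral_insert) (use J in \<open>auto simp: hj add.commute\<close>)
  also have "\<dots> = (\<integral>\<^sup>+x. ennreal (1 / \<bar>a\<bar>) * (\<integral>\<^sup>+y. F (x(j := y)) \<partial>lborel) \<partial>PiM J (\<lambda>_. lborel))"
  proof (rule nn_integral_cong)
    fix x assume "x \<in> space (PiM J (\<lambda>_. lborel :: real measure))"
    then have "(\<integral>\<^sup>+y. F (x(j := y)) \<partial>lborel) = ennreal \<bar>a\<bar> * (\<integral>\<^sup>+y. F (x(j := h x + a * y)) \<partial>lborel)"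
      using nn_integral_real_affine[OF mc[of x] a, of "h x"] by simp
    then have "ennreal (1 / \<bar>a\<bar>) * (\<integral>\<^sup>+y. F (x(j := y)) \<partial>lborel) = ennreal (1 / \<bar>a\<bar> * \<bar>a\<bar>) * (\<integral>\<^sup>+y. F (x(j := h x + a * y)) \<partial>lborel)"
      by (simp only: ennreal_mult'' abs_ge_zero mult.assoc)
    then show "(\<integral>\<^sup>+y. F (x(j := h x + a * y)) \<partial>lborel) = ennreal (1 / \<bar>a\<bar>) * (\<integral>\<^sup>+y. F (x(j := y)) \<partial>lborel)"
      using a by simp
  qed
  also have "\<dots> = ennreal (1 / \<bar>a\<bar>) * (\<integral>\<^sup>+x. F x \<partial>PiM I (\<lambda>_. lborel))"
    unfolding FF
  proof (rule nn_integral_cmult)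
    show "(\<lambda>x. \<integral>\<^sup>+ y. F (x(j := y)) \<partial>lborel) \<in> borel_measurable (Pi\<^sub>M J (\<lambda>_. lborel))"
    proof (rule sigma_finite_measure.borel_measurable_nn_integral[OF sigma_finite_lborel])
      have "(\<lambda>(x, y). x(j := y)) \<in> measurable (PiM J (\<lambda>_. lborel) \<Otimes>\<^sub>M lborel) (PiM I (\<lambda>_. lborel))"
        using measurable_add_dim[of j J "\<lambda>_. lborel :: real measure"] unfolding J(3) by (simp add: split_beta')
      then have "(\<lambda>z. F ((\<lambda>(x, y). x(j := y)) z)) \<in> borel_measurable (PiM J (\<lambda>_. lborel) \<Otimes>\<^sub>M lborel)"
        by (rule measurable_compose) (use F in simp)
      then show "(\<lambda>(x, y). F (x(j := y))) \<in> borel_measurable (Pi\<^sub>M J (\<lambda>_. lborel) \<Otimes>\<^sub>M lborel)"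
        by (simp add: split_beta')
    qed
  qed
  finally show ?thesis .
qed

definition affine_vec :: "nat \<Rightarrow> real \<Rightarrow> (nat \<Rightarrow> real) \<Rightarrow> (nat \<Rightarrow> real) \<Rightarrow> nat \<Rightarrow> real" where
  "affine_vec n s v x = (\<lambda>i\<in>{..<n}. s * x i + v i)"

lemma affine_vec_measurable [measurable]:
  assumes [measurable]: "f \<in> measurable N (borel_vec n)" "g \<in> measurable N (borel_vec n)"
  shows "(\<lambda>x. affine_vec n s (f x) (g x)) \<in> measurable N (borel_vec n)"
  unfolding affine_vec_def by measurable

lemma affine_vec_measurable' [measurable]:
  assumes [measurable]: "g \<in> measurable N (borel_vec n)"
  shows "(\<lambda>x. affine_vec n s v (g x)) \<in> measurable N (borel_vec n)"
  unfolding affine_vec_def by measurable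

lemma affine_vec_space [simp]: "affine_vec n s v x \<in> space (borel_vec n)"
  by (simp add: affine_vec_def space_PiM)

lemma affine_vec_PiE [simp]: "affine_vec n s v x \<in> {..<n} \<rightarrow>\<^sub>E UNIV"
  by (simp add: affine_vec_def)

lemma affine_vec_inverse: "x \<in> space (borel_vec n) \<Longrightarrow> affine_vec n 1 (\<lambda>i. - v i) (affine_vec n 1 v x) = x"
  by (auto simp: affine_vec_def space_PiM PiE_def extensional_def)

lemma affine_vec_inverse': "x \<in> space (borel_vec n) \<Longrightarrow> affine_vec n 1 v (affine_vec n 1 (\<lambda>i. - v i) x) = x"
  by (auto simp: affine_vec_def space_PiM PiE_def extensional_def)

lemma nn_integral_affine_vec:
  fixes F :: "(nat \<Rightarrow> real) \<Rightarrow> ennreal"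
  assumes s: "s \<noteq> 0" and F [measurable]: "F \<in> borel_measurable (borel_vec n)"
  shows "(\<integral>\<^sup>+x. F (affine_vec n s v x) \<partial>lborel_vec n) = ennreal ((1 / \<bar>s\<bar>) ^ n) * (\<integral>\<^sup>+x. F x \<partial>lborel_vec n)"
proof -
  \<comment> \<open>Induction on the number \<open>m\<close> of coordinates already transformed,
    each contributing one factor \<open>1 / \<bar>s\<bar>\<close>.\<close>
  have "m \<le> n \<Longrightarrow> (\<integral>\<^sup>+x. F (\<lambda>i\<in>{..<n}. if i < m then s * x i + v i else x i) \<partial>lborel_vec n) = ennreal ((1 / \<bar>s\<bar>) ^ m) * (\<integral>\<^sup>+x. F x \<partial>lborel_vec n)" for m
  proof (induction m)
    case 0
    have "(\<lambda>i\<in>{..<n}. x i) = x" if "x \<in> space (lborel_vec n)" for x :: "nat \<Rightarrow> real"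
      using that by (auto simp: space_PiM PiE_def extensional_def)
    then show ?case by (simp cong: nn_integral_cong_simp)
  next
    case (Suc m)
    define G where "G x = F (\<lambda>i\<in>{..<n}. if i < m then s * x i + v i else x i)" for x
    have [measurable]: "G \<in> borel_measurable (borel_vec n)"
      unfolding G_def by measurable
    have "(\<integral>\<^sup>+x. F (\<lambda>i\<in>{..<n}. if i < Suc m then s * x i + v i else x i) \<partial>lborel_vec n) =
        (\<integral>\<^sup>+x. G (x(m := s * x m + v m)) \<partial>lborel_vec n)"
      unfolding G_def by (intro nn_integral_cong arg_cong[where f=F]) (auto simp: restrict_def)
    also have "\<dots> = ennreal (1 / \<bar>s\<bar>) * (\<integral>\<^sup>+x. G x \<partial>lborel_vec n)"
      by (rule nn_integral_PiM_affine_coordinate[where h="\<lambda>_. v m"]) (use s Suc in auto)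
    also have "\<dots> = ennreal (1 / \<bar>s\<bar>) * (ennreal ((1 / \<bar>s\<bar>) ^ m) * (\<integral>\<^sup>+x. F x \<partial>lborel_vec n))"
      using Suc.prems s unfolding G_def by (subst Suc.IH) auto
    also have "\<dots> = ennreal ((1 / \<bar>s\<bar>) ^ Suc m) * (\<integral>\<^sup>+x. F x \<partial>lborel_vec n)"
      using s by (simp only: mult.assoc[symmetric] power_Suc) (subst ennreal_mult, auto)
    finally show ?case .
  qed
  from this[of n] show ?thesis
    by (simp add: affine_vec_def cong: restrict_cong)
qed

section \<open>Scalings, norms, balls and spheres\<close>

lemma scale_vec_measurable [measurable]:
  assumes [measurable]: "f \<in> borel_measurable N" "g \<in> measurable N (borel_vec n)"
  shows "(\<lambda>x. scale_vec n (f x) (g x)) \<in> measurable N (borel_vec n)"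
  unfolding scale_vec_def by measurable

lemma scale_vec_space [simp]: "scale_vec n r x \<in> space (borel_vec n)"
  by (simp add: scale_vec_def space_PiM)

lemma scale_vec_apply: "i < n \<Longrightarrow> scale_vec n r x i = r * x i"
  by (simp add: scale_vec_def)

lemma scale_vec_scale_vec [simp]: "scale_vec n r (scale_vec n s x) = scale_vec n (r * s) x"
  by (auto simp: scale_vec_def)

lemma scale_vec_1 [simp]: "x \<in> space (borel_vec n) \<Longrightarrow> scale_vec n 1 x = x"
  by (auto simp: scale_vec_def space_PiM PiE_def extensional_def)

lemma nn_integral_scale_vec:
  fixes F :: "(nat \<Rightarrow> real) \<Rightarrow> ennreal"
  assumes "s > 0" and "F \<in> borel_measurable (borel_vec n)"
  shows "(\<integral>\<^sup>+x. F (scale_vec n s x) \<partial>lborel_vec n) = ennreal ((1 / s) ^ n) * (\<integral>\<^sup>+x. F x \<partial>lborel_vec n)"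
  using nn_integral_affine_vec[of s F n "\<lambda>_. 0"] assms by (simp add: affine_vec_def scale_vec_def)

lemma lp_norm_measurable [measurable]: "lp_norm n p \<in> borel_measurable (borel_vec n)"
  unfolding lp_norm_def[abs_def] by measurable

lemma lp_norm_nonneg [simp]: "lp_norm n p x \<ge> 0"
  by (simp add: lp_norm_def)

lemma lp_norm_scale_vec:
  assumes "s \<ge> 0" "p > 0"
  shows "lp_norm n p (scale_vec n s x) = s * lp_norm n p x"
proof -
  have "(\<Sum>i<n. \<bar>scale_vec n s x i\<bar> powr p) = s powr p * (\<Sum>i<n. \<bar>x i\<bar> powr p)"
    using assms by (simp add: scale_vec_apply abs_mult powr_mult sum_distrib_left)
  then show ?thesis
    using assms by (simp add: lp_norm_def powr_mult powr_powr sum_nonneg)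
qed

lemma lp_norm_powr: "p > 0 \<Longrightarrow> lp_norm n p x powr p = (\<Sum>i<n. \<bar>x i\<bar> powr p)"
  by (simp add: lp_norm_def powr_powr sum_nonneg)

lemma lp_ball_sets [measurable]: "lp_ball n p \<in> sets (borel_vec n)"
proof -
  have "lp_ball n p = {x \<in> space (borel_vec n). lp_norm n p x \<le> 1}"
    by (simp add: lp_ball_def space_PiM)
  then show ?thesis by simp
qed

lemma lp_sphere_sets [measurable]: "lp_sphere n p \<in> sets (borel_vec n)"
proof -
  have "lp_sphere n p = {x \<in> space (borel_vec n). lp_norm n p x = 1}"
    by (simp add: lp_sphere_def space_PiM)
  then show ?thesis by simp
qed

lemma nn_integral_exp_atLeast: "(\<integral>\<^sup>+t. ennreal (exp (- t)) * indicator {a..} t \<partial>lborel) = ennreal (exp (- a))"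
proof -
  have "(\<integral>\<^sup>+t. ennreal (exp (- t)) * indicator {a..} t \<partial>lborel) = ennreal (0 - (- exp (- a)))"
  proof (rule nn_integral_FTC_atLeast)
    show "((\<lambda>t::real. - exp (- t)) \<longlongrightarrow> 0) at_top"
      by real_asymp
  qed (auto intro!: derivative_eq_intros)
  then show ?thesis by simp
qed

text \<open>Layer-cake: the weight \<open>exp (- \<parallel>x\<parallel>\<^sup>p / p)\<close> is an average of indicators of balls, and the
  integral of a homogeneous function over a ball is determined by its integral over the unit ball.\<close>

lemma nn_integral_homogeneous_exp:
  fixes F :: "(nat \<Rightarrow> real) \<Rightarrow> ennreal"
  assumes p: "p > 0" and F [measurable]: "F \<in> borel_measurable (borel_vec n)"
    and hom: "\<And>s x. s > 0 \<Longrightarrow> x \<in> space (borel_vec n) \<Longrightarrow> F (scale_vec n s x) = ennreal (s powr \<alpha>) * F x"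
  shows "(\<integral>\<^sup>+x. F x * ennreal (exp (- (\<Sum>i<n. \<bar>x i\<bar> powr p) / p)) \<partial>lborel_vec n) =
     (\<integral>\<^sup>+t. ennreal (exp (- t)) * ennreal ((p * t) powr ((real n + \<alpha>) / p)) * indicator {0<..} t \<partial>lborel)
     * (\<integral>\<^sup>+x. F x * indicator (lp_ball n p) x \<partial>lborel_vec n)"
proof -
  interpret L: sigma_finite_measure "lborel_vec n" by (rule sigma_finite_lborel_vec) simp
  interpret P: pair_sigma_finite lborel "lborel_vec n" by standard
  define A where "A x = (\<Sum>i<n. \<bar>x i\<bar> powr p) / p" for x :: "nat \<Rightarrow> real"
  have A_meas [measurable]: "A \<in> borel_measurable (borel_vec n)"
    unfolding A_def[abs_def] by measurable
  have A_nonneg: "A x \<ge> 0" for x using p by (simp add: A_def sum_nonneg)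
  have "(\<integral>\<^sup>+x. F x * ennreal (exp (- A x)) \<partial>lborel_vec n) =
     (\<integral>\<^sup>+x. (\<integral>\<^sup>+t. F x * (ennreal (exp (- t)) * indicator {A x..} t) \<partial>lborel) \<partial>lborel_vec n)"
    by (subst nn_integral_cmult) (auto simp: nn_integral_exp_atLeast)
  also have "\<dots> = (\<integral>\<^sup>+t. (\<integral>\<^sup>+x. F x * (ennreal (exp (- t)) * indicator {A x..} t) \<partial>lborel_vec n) \<partial>lborel)"
  proof (rule P.Fubini')
    \<comment> \<open>The indicator of a moving half-line becomes a comparison, whose joint
      measurability in \<open>t\<close> and \<open>x\<close> is automatic.\<close>
    have [simp]: "indicator {A x..} t = (if A x \<le> t then 1 else 0 :: ennreal)" for x and t :: real by (simp add: indicator_def)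
    have [measurable_cong]: "sets (lborel \<Otimes>\<^sub>M lborel_vec n) = sets (borel \<Otimes>\<^sub>M borel_vec n)"
      by (intro sets_pair_measure_cong sets_lborel_vec sets_lborel)
    show "(\<lambda>(t, x). F x * (ennreal (exp (- t)) * indicator {A x..} t)) \<in> borel_measurable (lborel \<Otimes>\<^sub>M lborel_vec n)"
      unfolding split_beta' by simp
  qed
  also have "\<dots> = (\<integral>\<^sup>+t. ennreal (exp (- t)) * ennreal ((p * t) powr ((real n + \<alpha>) / p)) * indicator {0<..} t
       * (\<integral>\<^sup>+x. F x * indicator (lp_ball n p) x \<partial>lborel_vec n) \<partial>lborel)"
  proof (rule nn_integral_cong_AE)
    \<comment> \<open>At \<open>t = 0\<close> the sublevel set of \<open>A\<close> is a single
      point, which has positive measure when \<open>n = 0\<close>; this value of \<open>t\<close> is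
      discarded.\<close>
    have "AE t in lborel. t \<noteq> (0 :: real)" by (rule AE_lborel_singleton)
    then show "AE t in lborel. (\<integral>\<^sup>+x. F x * (ennreal (exp (- t)) * indicator {A x..} t) \<partial>lborel_vec n) =
       ennreal (exp (- t)) * ennreal ((p * t) powr ((real n + \<alpha>) / p)) * indicator {0<..} t
       * (\<integral>\<^sup>+x. F x * indicator (lp_ball n p) x \<partial>lborel_vec n)"
    proof eventually_elim
      fix t :: real assume t: "t \<noteq> 0"
      show "(\<integral>\<^sup>+x. F x * (ennreal (exp (- t)) * indicator {A x..} t) \<partial>lborel_vec n) =
       ennreal (exp (- t)) * ennreal ((p * t) powr ((real n + \<alpha>) / p)) * indicator {0<..} t
       * (\<integral>\<^sup>+x. F x * indicator (lp_ball n p) x \<partial>lborel_vec n)"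
      proof (cases "t > 0")
        case False
        then have "t < A x" for x using A_nonneg[of x] t by linarith
        then have "indicator {A x..} t = (0::ennreal)" for x using not_le by (auto simp: indicator_def)
        with False t show ?thesis by simp
      next
        case True
        \<comment> \<open>Scaling by \<open>s\<close> carries the unit ball onto the sublevel set of
          \<open>A\<close> at level \<open>t\<close>, since \<open>s powr p = p * t\<close>.\<close>
        define s where "s = (p * t) powr (1 / p)"
        have s: "s > 0" using True p by (simp add: s_def)
        have sp: "s powr p = p * t" using True p by (simp add: s_def powr_powr)
        define G where "G x = F x * (ennreal (exp (- t)) * indicator {A x..} t)" for x
        have [simp]: "indicator {A x..} t = (if A x \<le> t then 1 else 0 :: ennreal)" for x by (simp add: indicator_def)
        have [measurable]: "G \<in> borel_measurable (borel_vec n)" unfolding G_def by simp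
        have A_scale: "A (scale_vec n s x) \<le> t \<longleftrightarrow> x \<in> lp_ball n p" if "x \<in> space (borel_vec n)" for x
        proof -
          have "A (scale_vec n s x) = (lp_norm n p (scale_vec n s x)) powr p / p"
            using p by (simp add: A_def lp_norm_powr)
          also have "\<dots> = t * lp_norm n p x powr p"
            using p s by (simp add: lp_norm_scale_vec powr_mult sp)
          finally have "A (scale_vec n s x) \<le> t \<longleftrightarrow> lp_norm n p x powr p \<le> 1" using True by simp
          also have "\<dots> \<longleftrightarrow> lp_norm n p x \<le> 1"
            using p powr_less_mono2[of p 1 "lp_norm n p x"] powr_mono2[of p "lp_norm n p x" 1]
            by (auto simp: not_le[symmetric])
          finally show ?thesis using that by (simp add: lp_ball_def space_PiM)
        qed
        have "ennreal (s powr \<alpha> * exp (- t)) * (\<integral>\<^sup>+x. F x * indicator (lp_ball n p) x \<partial>lborel_vec n) =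
           (\<integral>\<^sup>+x. G (scale_vec n s x) \<partial>lborel_vec n)"
          by (subst nn_integral_cmult[symmetric])
             (auto simp: G_def A_scale hom s indicator_def ennreal_mult mult_ac intro!: nn_integral_cong)
        also have "\<dots> = ennreal ((1 / s) ^ n) * (\<integral>\<^sup>+x. G x \<partial>lborel_vec n)"
          by (rule nn_integral_scale_vec) (use s in auto)
        finally have "ennreal (s ^ n) * (ennreal (s powr \<alpha> * exp (- t)) * (\<integral>\<^sup>+x. F x * indicator (lp_ball n p) x \<partial>lborel_vec n)) =
            ennreal (s ^ n * (1 / s) ^ n) * (\<integral>\<^sup>+x. G x \<partial>lborel_vec n)"
          using s by (simp add: ennreal_mult mult.assoc)
        also have "s ^ n * (1 / s) ^ n = 1" using s by (simp add: power_mult_distrib[symmetric])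
        finally have *: "(\<integral>\<^sup>+x. G x \<partial>lborel_vec n) = ennreal (s ^ n * (s powr \<alpha> * exp (- t))) * (\<integral>\<^sup>+x. F x * indicator (lp_ball n p) x \<partial>lborel_vec n)"
          using s by (simp add: ennreal_mult mult.assoc)
        \<comment> \<open>The Jacobian contributes \<open>s ^ n\<close> and the homogeneity of
          \<open>F\<close> the factor \<open>s powr \<alpha>\<close>.\<close>
        have "s ^ n * s powr \<alpha> = s powr (real n + \<alpha>)"
          using s by (simp add: powr_add powr_realpow)
        also have "\<dots> = (p * t) powr ((real n + \<alpha>) / p)"
          by (simp add: s_def powr_powr)
        finally have "s ^ n * (s powr \<alpha> * exp (- t)) = exp (- t) * (p * t) powr ((real n + \<alpha>) / p)"
          by (simp add: mult_ac)
        with * True show ?thesis by (simp add: G_def ennreal_mult)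
      qed
    qed
  qed
  also have "\<dots> = (\<integral>\<^sup>+t. ennreal (exp (- t)) * ennreal ((p * t) powr ((real n + \<alpha>) / p)) * indicator {0<..} t \<partial>lborel)
     * (\<integral>\<^sup>+x. F x * indicator (lp_ball n p) x \<partial>lborel_vec n)"
    by (rule nn_integral_multc) simp
  finally show ?thesis by (simp add: A_def)
qed

section \<open>Absolute moments of the p-Gaussian weight in one variable\<close>

lemma nn_integral_lborel_even:
  fixes f :: "real \<Rightarrow> ennreal"
  assumes [measurable]: "f \<in> borel_measurable borel" and even: "\<And>x. f (- x) = f x"
  shows "(\<integral>\<^sup>+x. f x \<partial>lborel) = 2 * (\<integral>\<^sup>+x. f x * indicator {0..} x \<partial>lborel)"
proof -
  have "(\<integral>\<^sup>+x. f x \<partial>lborel) = (\<integral>\<^sup>+x. f x * indicator {0..} x + f x * indicator {..0} x \<partial>lborel)"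
  proof (rule nn_integral_cong_AE)
    have "AE t in lborel. t \<noteq> (0 :: real)" by (rule AE_lborel_singleton)
    then show "AE x in lborel. f x = f x * indicator {0..} x + f x * indicator {..0} x"
      by eventually_elim (auto simp: indicator_def)
  qed
  also have "\<dots> = (\<integral>\<^sup>+x. f x * indicator {0..} x \<partial>lborel) + (\<integral>\<^sup>+x. f x * indicator {..0} x \<partial>lborel)"
    by (rule nn_integral_add) auto
  also have "(\<integral>\<^sup>+x. f x * indicator {..0} x \<partial>lborel) = (\<integral>\<^sup>+x. f x * indicator {0..} x \<partial>lborel)"
    by (subst nn_integral_real_affine[where c="-1" and t=0]) (auto simp: even indicator_def intro!: nn_integral_cong)
  finally show ?thesis by (simp add: mult_2)
qed

lemma nn_integral_abs_powr_interval:
  assumes a: "a > -1" and r: "r \<ge> (0::real)"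
  shows "(\<integral>\<^sup>+x. ennreal (\<bar>x\<bar> powr a) * indicator {-r..r} x \<partial>lborel) = ennreal (2 * r powr (a + 1) / (a + 1))"
proof -
  have "(\<integral>\<^sup>+x. ennreal (\<bar>x\<bar> powr a) * indicator {-r..r} x \<partial>lborel) =
      2 * (\<integral>\<^sup>+x. ennreal (\<bar>x\<bar> powr a) * indicator {-r..r} x * indicator {0..} x \<partial>lborel)"
    by (rule nn_integral_lborel_even) (auto simp: indicator_def)
  also have "(\<integral>\<^sup>+x. ennreal (\<bar>x\<bar> powr a) * indicator {-r..r} x * indicator {0..} x \<partial>lborel) =
     (\<integral>\<^sup>+x. ennreal (indicator {0..r} x * x powr a) \<partial>lborel)"
    using r by (intro nn_integral_cong) (auto simp: indicator_def)
  also have "\<dots> = ennreal (r powr (a + 1) / (a + 1))"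
    by (rule nn_integral_has_integral_lebesgue) (use a r in \<open>auto intro!: has_integral_powr_from_0\<close>)
  also have "2 * \<dots> = ennreal (2 * (r powr (a + 1) / (a + 1)))"
    by (simp only: ennreal_mult' ennreal_numeral[symmetric] zero_le_numeral)
  finally show ?thesis by simp
qed

lemma nn_integral_exp_powr:
  assumes "b > 0" "p > 0"
  shows "(\<integral>\<^sup>+t. ennreal (exp (- t)) * ennreal ((p * t) powr (b - 1)) * indicator {0<..} t \<partial>lborel) = ennreal (p powr (b - 1) * Gamma b)"
proof -
  have "(\<integral>\<^sup>+t. ennreal (exp (- t)) * ennreal ((p * t) powr (b - 1)) * indicator {0<..} t \<partial>lborel) =
     (\<integral>\<^sup>+t. ennreal (indicator {0..} t * (p powr (b - 1) * (t powr (b - 1) / exp t))) \<partial>lborel)"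
  proof (rule nn_integral_cong_AE)
    have "AE t in lborel. t \<noteq> (0 :: real)" by (rule AE_lborel_singleton)
    then show "AE t in lborel. ennreal (exp (- t)) * ennreal ((p * t) powr (b - 1)) * indicator {0<..} t = ennreal (indicator {0..} t * (p powr (b - 1) * (t powr (b - 1) / exp t)))"
      by (rule AE_mp)
        (use assms in \<open>auto intro!: AE_I2 simp: indicator_def ennreal_mult[symmetric] powr_mult exp_minus field_simps\<close>)
  qed
  also have "\<dots> = ennreal (p powr (b - 1) * Gamma b)"
    by (rule nn_integral_has_integral_lebesgue[OF _ has_integral_mult_right[OF Gamma_integral_real]]) (use assms in auto)
  finally show ?thesis .
qed

lemma nn_integral_abs_powr_exp:
  fixes a p :: real
  assumes p: "p > 0" and a: "a > -1"
  shows "(\<integral>\<^sup>+x. ennreal (\<bar>x\<bar> powr a * exp (- (\<bar>x\<bar> powr p) / p)) \<partial>lborel) =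
     ennreal (2 / (a + 1) * p powr ((a + 1) / p) * Gamma (1 + (a + 1) / p))"
proof -
  have P: "pair_sigma_finite lborel (lborel :: real measure)" by standard
  have "(\<integral>\<^sup>+x. ennreal (\<bar>x\<bar> powr a * exp (- (\<bar>x\<bar> powr p) / p)) \<partial>lborel) =
     (\<integral>\<^sup>+x. (\<integral>\<^sup>+t. ennreal (\<bar>x\<bar> powr a) * (ennreal (exp (- t)) * indicator {\<bar>x\<bar> powr p / p..} t) \<partial>lborel) \<partial>lborel)"
    by (subst nn_integral_cmult) (auto simp: nn_integral_exp_atLeast ennreal_mult)
  also have "\<dots> = (\<integral>\<^sup>+t. (\<integral>\<^sup>+x. ennreal (\<bar>x\<bar> powr a) * (ennreal (exp (- t)) * indicator {\<bar>x\<bar> powr p / p..} t) \<partial>lborel) \<partial>lborel)"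
  proof (rule pair_sigma_finite.Fubini'[OF P])
    have [simp]: "indicator {\<bar>x\<bar> powr p / p..} t = (if \<bar>x\<bar> powr p / p \<le> t then 1 else 0 :: ennreal)" for x and t :: real by (simp add: indicator_def)
    show "(\<lambda>(t, x). ennreal (\<bar>x\<bar> powr a) * (ennreal (exp (- t)) * indicator {\<bar>x\<bar> powr p / p..} t)) \<in> borel_measurable (lborel \<Otimes>\<^sub>M lborel)"
      unfolding split_beta' by simp
  qed
  also have "\<dots> = (\<integral>\<^sup>+t. ennreal (exp (- t)) * ennreal ((p * t) powr ((1 + (a + 1) / p) - 1)) * indicator {0<..} t * ennreal (2 / (a + 1)) \<partial>lborel)"
  proof (rule nn_integral_cong_AE)
    have "AE t in lborel. t \<noteq> (0 :: real)" by (rule AE_lborel_singleton)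
    then show "AE t in lborel. (\<integral>\<^sup>+x. ennreal (\<bar>x\<bar> powr a) * (ennreal (exp (- t)) * indicator {\<bar>x\<bar> powr p / p..} t) \<partial>lborel) =
        ennreal (exp (- t)) * ennreal ((p * t) powr ((1 + (a + 1) / p) - 1)) * indicator {0<..} t * ennreal (2 / (a + 1))"
    proof eventually_elim
      fix t :: real assume t: "t \<noteq> 0"
      show "(\<integral>\<^sup>+x. ennreal (\<bar>x\<bar> powr a) * (ennreal (exp (- t)) * indicator {\<bar>x\<bar> powr p / p..} t) \<partial>lborel) =
        ennreal (exp (- t)) * ennreal ((p * t) powr ((1 + (a + 1) / p) - 1)) * indicator {0<..} t * ennreal (2 / (a + 1))"
      proof (cases "t > 0")
        case False
        then have "\<not> \<bar>x\<bar> powr p / p \<le> t" for x using t p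
          by (metis divide_nonneg_pos not_le order.strict_trans1 order_le_less powr_ge_zero)
        then have "indicator {\<bar>x\<bar> powr p / p..} t = (0::ennreal)" for x by (auto simp: indicator_def)
        with False show ?thesis by simp
      next
        case True
        define s where "s = (p * t) powr (1 / p)"
        have s: "s > 0" using True p by (simp add: s_def)
        have sp: "s powr p = p * t" using True p by (simp add: s_def powr_powr)
        have "\<bar>x\<bar> powr p / p \<le> t \<longleftrightarrow> x \<in> {-s..s}" for x
        proof -
          have "\<bar>x\<bar> powr p / p \<le> t \<longleftrightarrow> \<bar>x\<bar> powr p \<le> s powr p"
            using p by (simp add: sp field_simps)
          also have "\<dots> \<longleftrightarrow> \<bar>x\<bar> \<le> s"
            using p s by (metis abs_ge_zero not_le powr_less_mono2 powr_mono2 less_imp_le)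
          finally show ?thesis by auto
        qed
        then have "(\<integral>\<^sup>+x. ennreal (\<bar>x\<bar> powr a) * (ennreal (exp (- t)) * indicator {\<bar>x\<bar> powr p / p..} t) \<partial>lborel) =
           (\<integral>\<^sup>+x. ennreal (exp (- t)) * (ennreal (\<bar>x\<bar> powr a) * indicator {-s..s} x) \<partial>lborel)"
          by (intro nn_integral_cong) (auto simp: indicator_def mult_ac)
        also have "\<dots> = ennreal (exp (- t)) * ennreal (2 * s powr (a + 1) / (a + 1))"
          using s a by (subst nn_integral_cmult) (auto simp: nn_integral_abs_powr_interval)
        also have "s powr (a + 1) = (p * t) powr ((1 + (a + 1) / p) - 1)"
          by (simp add: s_def powr_powr)
        finally show ?thesis using True a by (simp add: ennreal_mult[symmetric] mult_ac)
      qed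
    qed
  qed
  also have "\<dots> = ennreal (p powr ((1 + (a + 1) / p) - 1) * Gamma (1 + (a + 1) / p)) * ennreal (2 / (a + 1))"
    by (subst nn_integral_multc, simp, subst nn_integral_exp_powr) (use a p in \<open>auto intro!: add_pos_pos\<close>)
  finally have *: "(\<integral>\<^sup>+x. ennreal (\<bar>x\<bar> powr a * exp (- (\<bar>x\<bar> powr p) / p)) \<partial>lborel) =
     ennreal (p powr ((1 + (a + 1) / p) - 1) * Gamma (1 + (a + 1) / p)) * ennreal (2 / (a + 1))" .
  have "(a + 1) / p > 0" using a p by simp
  then have "Gamma (1 + (a + 1) / p) > 0"
    by (intro Gamma_real_pos) linarith
  then show ?thesis
    unfolding * using a p by (subst ennreal_mult[symmetric]) (auto simp: mult_ac)
qed

section \<open>The cone measure and the \<open>p\<close>-Gaussian distribution\<close>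

definition p_gaussian_const :: "real \<Rightarrow> real" where
  "p_gaussian_const p = 1 / (2 * p powr (1 / p) * Gamma (1 + 1 / p))"

lemma Gamma_1_plus_inverse_pos: "p > 0 \<Longrightarrow> Gamma (1 + 1 / p :: real) > 0"
  by (intro Gamma_real_pos add_pos_pos) auto

lemma p_gaussian_const_pos: "p > 0 \<Longrightarrow> p_gaussian_const p > 0"
  by (auto simp: p_gaussian_const_def intro!: divide_pos_pos mult_pos_pos Gamma_real_pos add_pos_pos)

lemma p_gaussian_eq:
  "p_gaussian p = density lborel (\<lambda>x. ennreal (p_gaussian_const p * exp (- (\<bar>x\<bar> powr p) / p)))"
  by (simp add: p_gaussian_def p_gaussian_const_def)

lemma sets_p_gaussian [simp, measurable_cong]: "sets (p_gaussian p) = sets borel"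
  by (simp add: p_gaussian_def)

lemma space_p_gaussian [simp]: "space (p_gaussian p) = UNIV"
  by (simp add: p_gaussian_def)

lemma AE_p_gaussian_nonzero: "AE x in p_gaussian p. x \<noteq> 0"
proof -
  have "AE x in lborel. x \<noteq> (0 :: real)" by (rule AE_lborel_singleton)
  then show ?thesis unfolding p_gaussian_eq by (subst AE_density) auto
qed

lemma ennreal_times_times: "0 \<le> a \<Longrightarrow> ennreal a * (ennreal b * X) = ennreal (a * b) * X"
  by (simp add: ennreal_mult' mult.assoc)

lemma nn_integral_p_gaussian_abs_powr:
  assumes p: "p > 0" and a: "a > -1"
  shows "(\<integral>\<^sup>+x. ennreal (\<bar>x\<bar> powr a) \<partial>p_gaussian p) =
    ennreal (p_gaussian_const p * (2 / (a + 1) * p powr ((a + 1) / p) * Gamma (1 + (a + 1) / p)))"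
proof -
  have "(\<integral>\<^sup>+x. ennreal (\<bar>x\<bar> powr a) \<partial>p_gaussian p) =
     (\<integral>\<^sup>+x. ennreal (p_gaussian_const p) * ennreal (\<bar>x\<bar> powr a * exp (- (\<bar>x\<bar> powr p) / p)) \<partial>lborel)"
    unfolding p_gaussian_eq using p_gaussian_const_pos[OF p]
    by (subst nn_integral_density) (auto simp: ennreal_mult[symmetric] mult_ac intro!: nn_integral_cong)
  also have "\<dots> = ennreal (p_gaussian_const p) * (\<integral>\<^sup>+x. ennreal (\<bar>x\<bar> powr a * exp (- (\<bar>x\<bar> powr p) / p)) \<partial>lborel)"
    by (rule nn_integral_cmult) simp
  finally show ?thesis
    unfolding nn_integral_abs_powr_exp[OF assms]
    using p_gaussian_const_pos[OF p] by (simp only: ennreal_mult' less_imp_le)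
qed

lemma prob_space_p_gaussian: assumes p: "p > 0" shows "prob_space (p_gaussian p)"
proof
  have "emeasure (p_gaussian p) (space (p_gaussian p)) = (\<integral>\<^sup>+x. 1 \<partial>p_gaussian p)"
    by (simp only: nn_integral_const mult_1)
  also have "\<dots> = (\<integral>\<^sup>+x. ennreal (\<bar>x\<bar> powr 0) \<partial>p_gaussian p)"
    by (rule nn_integral_cong_AE, use AE_p_gaussian_nonzero[of p] in eventually_elim) simp
  also have "\<dots> = 1"
    using p Gamma_1_plus_inverse_pos[OF p]
    by (subst nn_integral_p_gaussian_abs_powr) (auto simp: p_gaussian_const_def)
  finally show "emeasure (p_gaussian p) (space (p_gaussian p)) = 1" .
qed

lemma integrable_p_gaussian_abs_powr:
  assumes p: "p > 0" and a: "a > -1"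
  shows "integrable (p_gaussian p) (\<lambda>x. \<bar>x\<bar> powr a)"
  by (rule integrableI_nonneg) (auto simp: nn_integral_p_gaussian_abs_powr[OF assms])

text \<open>The functional equation of Gamma reduces the moment to the normalizing constant. The
  divisor \<open>p\<close> in the exponent of the density is what makes the value exactly 1.\<close>

lemma expectation_p_gaussian_abs_powr_p:
  assumes p: "p > 0"
  shows "(\<integral>x. \<bar>x\<bar> powr p \<partial>p_gaussian p) = 1"
proof -
  have "1 + 1 / p > 0" using p by (simp add: add_pos_pos)
  then have "1 + 1 / p \<notin> \<int>\<^sub>\<le>\<^sub>0" by (meson nonpos_Ints_nonpos not_le)
  moreover have "(p + 1) / p = 1 + 1 / p" using p by (simp add: field_simps)
  ultimately have "Gamma (1 + (p + 1) / p) = (1 + 1 / p) * Gamma (1 + 1 / p)"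
    using Gamma_plus1[of "1 + 1 / p"] by (simp add: add.commute)
  then have "p_gaussian_const p * (2 / (p + 1) * p powr ((p + 1) / p) * Gamma (1 + (p + 1) / p)) =
     p_gaussian_const p * (2 / (p + 1) * (p powr (1 + 1 / p)) * ((1 + 1 / p) * Gamma (1 + 1 / p)))"
    using p by (simp add: add_divide_distrib)
  also have "\<dots> = 1"
  proof -
    have "1 / (2 * q * g) * (2 / (p + 1) * (p * q) * ((1 + 1 / p) * g)) = 1" if "q > 0" "g > 0" for q g
      using p that by (simp add: divide_simps)
    from this[of "p powr (1 / p)", OF _ Gamma_1_plus_inverse_pos[OF p]] show ?thesis
      using p by (simp add: p_gaussian_const_def powr_add)
  qed
  finally show ?thesis
    using p by (subst integral_eq_nn_integral) (auto simp: nn_integral_p_gaussian_abs_powr)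
qed

text \<open>Squaring \<open>ln y \<le> 4 * y powr (1/4)\<close> for \<open>y \<ge> 1\<close> gives
  the constant 16; for small arguments it is applied to \<open>1 / \<bar>x\<bar>\<close>. Both
  exponents exceed -1, so the bound is integrable.\<close>

lemma ln_abs_squared_bound: "(ln \<bar>x\<bar>)\<^sup>2 \<le> 16 * (\<bar>x\<bar> powr (1/2) + \<bar>x\<bar> powr (-1/2))" for x :: real
proof (cases "x = 0")
  case False
  have *: "(ln y)\<^sup>2 \<le> 16 * y powr (1/2)" if "y \<ge> 1" for y :: real
  proof -
    have "(ln y)\<^sup>2 \<le> (y powr (1/4) / (1/4))\<^sup>2"
      using that ln_powr_bound[of y "1/4"] by (intro power_mono) auto
    also have "\<dots> = 16 * y powr (1/2)"
      by (simp add: power_mult_distrib power2_eq_square powr_add[symmetric])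
    finally show ?thesis .
  qed
  show ?thesis
  proof (cases "\<bar>x\<bar> \<ge> 1")
    case True
    then show ?thesis using *[OF True] powr_ge_zero[of "\<bar>x\<bar>" "-1/2"] unfolding distrib_left by linarith
  next
    case False': False
    have "1 / \<bar>x\<bar> \<ge> 1" using False False' by (simp add: field_simps)
    from *[OF this] have "(ln \<bar>x\<bar>)\<^sup>2 \<le> 16 * \<bar>x\<bar> powr (-1/2)"
      using False by (simp add: ln_div powr_divide powr_minus_divide)
    then show ?thesis using powr_ge_zero[of "\<bar>x\<bar>" "1/2"] unfolding distrib_left by linarith
  qed
qed simp

lemma integrable_p_gaussian_ln_squared:
  assumes p: "p > 0"
  shows "integrable (p_gaussian p) (\<lambda>x. (ln \<bar>x\<bar>)\<^sup>2)"
proof (rule Bochner_Integration.integrable_bound)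
  show "integrable (p_gaussian p) (\<lambda>x. 16 * (\<bar>x\<bar> powr (1/2) + \<bar>x\<bar> powr (-1/2)))"
    using p by (intro integrable_mult_right Bochner_Integration.integrable_add integrable_p_gaussian_abs_powr) auto
qed (auto intro!: order_trans[OF ln_abs_squared_bound])

section \<open>p-Gaussian vectors and homogeneous functions\<close>

abbreviation p_gaussian_vec :: "nat \<Rightarrow> real \<Rightarrow> (nat \<Rightarrow> real) measure" where
  "p_gaussian_vec n p \<equiv> PiM {..<n} (\<lambda>_. p_gaussian p)"

lemma sets_p_gaussian_vec [measurable_cong, simp]: "sets (PiM I (\<lambda>_. p_gaussian p)) = sets (PiM I (\<lambda>_. borel))"
  by (intro sets_PiM_cong) auto

lemma space_p_gaussian_vec [simp]: "space (PiM I (\<lambda>_. p_gaussian p)) = space (PiM I (\<lambda>_. borel :: real measure))"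
  by (simp add: space_PiM)

lemma p_gaussian_vec_eq_density:
  assumes p: "p > 0"
  shows "p_gaussian_vec n p =
    density (lborel_vec n) (\<lambda>x. ennreal (p_gaussian_const p ^ n * exp (- (\<Sum>i<n. \<bar>x i\<bar> powr p) / p)))"
    (is "_ = ?D")
proof -
  interpret product_sigma_finite "\<lambda>_::nat. p_gaussian p"
    using prob_space_p_gaussian[OF p] by (simp add: product_sigma_finite_def prob_space_imp_sigma_finite)
  define g where "g x = ennreal (p_gaussian_const p * exp (- (\<bar>x\<bar> powr p) / p))" for x
  have [measurable]: "g \<in> borel_measurable borel" unfolding g_def by measurable
  have "?D = p_gaussian_vec n p"
  proof (rule PiM_eqI)
    fix A :: "nat \<Rightarrow> real set" assume "\<And>i. i \<in> {..<n} \<Longrightarrow> A i \<in> sets (p_gaussian p)"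
    then have A [measurable]: "\<And>i. i \<in> {..<n} \<Longrightarrow> A i \<in> sets borel" by simp
    define h where "h i y = g y * indicator (A i) y" for i y
    have [measurable]: "Pi\<^sub>E {..<n} A \<in> sets (borel_vec n)"
      by (rule sets_PiM_I_finite) (auto simp: A)
    have dens: "ennreal (p_gaussian_const p ^ n * exp (- (\<Sum>i<n. \<bar>x i\<bar> powr p) / p)) = (\<Prod>i<n. g (x i))" for x :: "nat \<Rightarrow> real"
    proof -
      have "exp (- (\<Sum>i<n. \<bar>x i\<bar> powr p) / p) = (\<Prod>i<n. exp (- (\<bar>x i\<bar> powr p) / p))"
        by (simp add: exp_sum[symmetric] sum_negf sum_divide_distrib)
      then show ?thesis
        using p_gaussian_const_pos[OF p]
        by (simp add: g_def prod_ennreal less_imp_le prod.distrib)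
    qed
    have "emeasure ?D (Pi\<^sub>E {..<n} A) = (\<integral>\<^sup>+x. (\<Prod>i<n. g (x i)) * indicator (Pi\<^sub>E {..<n} A) x \<partial>lborel_vec n)"
      unfolding dens by (subst emeasure_density) (auto simp: sets_lborel_vec)
    also have "\<dots> = (\<integral>\<^sup>+x. (\<Prod>i<n. h i (x i)) \<partial>lborel_vec n)"
    proof (rule nn_integral_cong)
      fix x assume x: "x \<in> space (lborel_vec n)"
      show "(\<Prod>i<n. g (x i)) * indicator (Pi\<^sub>E {..<n} A) x = (\<Prod>i<n. h i (x i))"
      proof (cases "x \<in> Pi\<^sub>E {..<n} A")
        case True
        then have "indicator (A i) (x i) = (1::ennreal)" if "i < n" for i
          using PiE_mem[OF True, of i] that by simp
        with True show ?thesis by (simp add: h_def)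
      next
        case False
        then obtain i where "i < n" "x i \<notin> A i" using x unfolding space_PiM PiE_def by auto
        then have "(\<Prod>i<n. h i (x i)) = 0"
          by (intro prod_zero) (auto intro!: bexI[of _ i] simp: h_def)
        with False show ?thesis by simp
      qed
    qed
    also have "\<dots> = (\<Prod>i<n. \<integral>\<^sup>+x. h i x \<partial>lborel)"
      by (rule lborel_PiM.product_nn_integral_prod) (auto simp: h_def)
    also have "\<dots> = (\<Prod>i<n. emeasure (p_gaussian p) (A i))"
      unfolding p_gaussian_eq g_def h_def by (intro prod.cong refl) (auto simp: emeasure_density A)
    finally show "emeasure ?D (Pi\<^sub>E {..<n} A) = (\<Prod>i<n. emeasure (p_gaussian p) (A i))" .
  qed (auto simp: sets_lborel_vec)
  then show ?thesis ..
qed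

lemma prob_space_p_gaussian_vec: "p > 0 \<Longrightarrow> prob_space (PiM I (\<lambda>_. p_gaussian p))"
  by (intro prob_space_PiM prob_space_p_gaussian)

text \<open>One constant serves every \<open>F\<close> of degree \<open>\<alpha>\<close>. It is
  obtained before \<open>F\<close>, so that it cancels from quotients of integrals of the same
  degree.\<close>

lemma nn_integral_p_gaussian_vec_homogeneous:
  assumes p: "p > 0" and \<alpha>: "\<alpha> \<ge> 0"
  obtains K where "K > 0" and
    "\<And>F :: (nat \<Rightarrow> real) \<Rightarrow> ennreal. F \<in> borel_measurable (borel_vec n) \<Longrightarrow>
      (\<And>s x. s > 0 \<Longrightarrow> x \<in> space (borel_vec n) \<Longrightarrow> F (scale_vec n s x) = ennreal (s powr \<alpha>) * F x) \<Longrightarrow>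
      (\<integral>\<^sup>+x. F x \<partial>p_gaussian_vec n p) = ennreal K * (\<integral>\<^sup>+x. F x * indicator (lp_ball n p) x \<partial>lborel_vec n)"
proof -
  \<comment> \<open>Chosen so that \<open>b - 1\<close> is the exponent left by the layer-cake
    formula and the radial integral becomes a value of Gamma at \<open>b\<close>.\<close>
  define b where "b = 1 + (real n + \<alpha>) / p"
  have b: "b > 0" using p \<alpha> by (simp add: b_def add_pos_nonneg)
  define K where "K = p_gaussian_const p ^ n * (p powr (b - 1) * Gamma b)"
  have Kt: "(\<integral>\<^sup>+t. ennreal (exp (- t)) * ennreal ((p * t) powr ((real n + \<alpha>) / p)) * indicator {0<..} t \<partial>lborel)
      = ennreal (p powr (b - 1) * Gamma b)"
    using nn_integral_exp_powr[OF b p] by (simp add: b_def)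
  have K: "K > 0" using b p p_gaussian_const_pos[OF p] by (auto simp: K_def intro!: mult_pos_pos Gamma_real_pos)
  have "(\<integral>\<^sup>+x. F x \<partial>p_gaussian_vec n p) = ennreal K * (\<integral>\<^sup>+x. F x * indicator (lp_ball n p) x \<partial>lborel_vec n)"
    if F [measurable]: "F \<in> borel_measurable (borel_vec n)"
      and hom: "\<And>s x. s > 0 \<Longrightarrow> x \<in> space (borel_vec n) \<Longrightarrow> F (scale_vec n s x) = ennreal (s powr \<alpha>) * F x"
    for F
  proof -
    have "(\<integral>\<^sup>+x. F x \<partial>p_gaussian_vec n p) =
       (\<integral>\<^sup>+x. ennreal (p_gaussian_const p ^ n) * (F x * ennreal (exp (- (\<Sum>i<n. \<bar>x i\<bar> powr p) / p))) \<partial>lborel_vec n)"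
      unfolding p_gaussian_vec_eq_density[OF p] using p_gaussian_const_pos[OF p]
      by (subst nn_integral_density) (auto simp: ennreal_mult mult_ac intro!: nn_integral_cong)
    also have "\<dots> = ennreal (p_gaussian_const p ^ n) * (\<integral>\<^sup>+x. F x * ennreal (exp (- (\<Sum>i<n. \<bar>x i\<bar> powr p) / p)) \<partial>lborel_vec n)"
      by (rule nn_integral_cmult) simp
    also have "(\<integral>\<^sup>+x. F x * ennreal (exp (- (\<Sum>i<n. \<bar>x i\<bar> powr p) / p)) \<partial>lborel_vec n) =
        ennreal (p powr (b - 1) * Gamma b) * (\<integral>\<^sup>+x. F x * indicator (lp_ball n p) x \<partial>lborel_vec n)"
      unfolding Kt[symmetric] by (rule nn_integral_homogeneous_exp[OF p F hom])
    also have "ennreal (p_gaussian_const p ^ n) * \<dots> = ennreal K * (\<integral>\<^sup>+x. F x * indicator (lp_ball n p) x \<partial>lborel_vec n)"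
      unfolding K_def using p_gaussian_const_pos[OF p]
      by (intro ennreal_times_times) simp
    finally show ?thesis .
  qed
  with K show ?thesis using that by blast
qed

text \<open>Borel events that depend on the direction only. The factors are positive, so the origin
  may belong to such a set or not.\<close>

definition scale_invariant :: "nat \<Rightarrow> (nat \<Rightarrow> real) set \<Rightarrow> bool" where
  "scale_invariant n G \<longleftrightarrow> G \<in> sets (borel_vec n) \<and>
     (\<forall>s x. s > 0 \<longrightarrow> x \<in> space (borel_vec n) \<longrightarrow> (scale_vec n s x \<in> G \<longleftrightarrow> x \<in> G))"

lemma scale_invariantD:
  "scale_invariant n G \<Longrightarrow> s > 0 \<Longrightarrow> x \<in> space (borel_vec n) \<Longrightarrow> scale_vec n s x \<in> G \<longleftrightarrow> x \<in> G"
  by (simp add: scale_invariant_def)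

lemma scale_invariant_space: "scale_invariant n (space (borel_vec n))"
  by (auto simp: scale_invariant_def)

lemma emeasure_p_gaussian_vec_cone:
  assumes p: "p > 0"
  obtains K where "K > 0" and
    "\<And>G. scale_invariant n G \<Longrightarrow> emeasure (p_gaussian_vec n p) G = ennreal K * emeasure (lborel_vec n) (G \<inter> lp_ball n p)"
proof -
  obtain K where K: "K > 0" and
    H: "\<And>F :: (nat \<Rightarrow> real) \<Rightarrow> ennreal. F \<in> borel_measurable (borel_vec n) \<Longrightarrow>
      (\<And>s x. s > 0 \<Longrightarrow> x \<in> space (borel_vec n) \<Longrightarrow> F (scale_vec n s x) = ennreal (s powr 0) * F x) \<Longrightarrow>
      (\<integral>\<^sup>+x. F x \<partial>p_gaussian_vec n p) = ennreal K * (\<integral>\<^sup>+x. F x * indicator (lp_ball n p) x \<partial>lborel_vec n)"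
    by (rule nn_integral_p_gaussian_vec_homogeneous[OF p order.refl, of n]) blast
  show ?thesis
  proof (rule that[OF K])
    fix G assume G: "scale_invariant n G"
    then have [measurable]: "G \<in> sets (borel_vec n)" by (simp add: scale_invariant_def)
    have "emeasure (p_gaussian_vec n p) G = (\<integral>\<^sup>+x. indicator G x \<partial>p_gaussian_vec n p)"
      by (simp add: nn_integral_indicator)
    also have "\<dots> = ennreal K * (\<integral>\<^sup>+x. indicator G x * indicator (lp_ball n p) x \<partial>lborel_vec n)"
      by (rule H) (use scale_invariantD[OF G] in \<open>auto simp: indicator_def\<close>)
    also have "(\<integral>\<^sup>+x. indicator G x * indicator (lp_ball n p) x \<partial>lborel_vec n) = (\<integral>\<^sup>+x. indicator (G \<inter> lp_ball n p) x \<partial>lborel_vec n)"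
      by (intro nn_integral_cong) (auto simp: indicator_def)
    also have "\<dots> = emeasure (lborel_vec n) (G \<inter> lp_ball n p)"
      by (simp add: nn_integral_indicator sets_lborel_vec)
    finally show "emeasure (p_gaussian_vec n p) G = ennreal K * emeasure (lborel_vec n) (G \<inter> lp_ball n p)" .
  qed
qed

text \<open>The total p-Gaussian mass 1 is a positive constant times the volume, so positivity and
  finiteness come without computing the volume.\<close>

lemma emeasure_lp_ball_pos_finite:
  assumes p: "p > 0"
  shows "emeasure (lborel_vec n) (lp_ball n p) \<noteq> 0" "emeasure (lborel_vec n) (lp_ball n p) \<noteq> \<infinity>"
proof -
  obtain K where K: "K > 0" and
    "\<And>G. scale_invariant n G \<Longrightarrow> emeasure (p_gaussian_vec n p) G = ennreal K * emeasure (lborel_vec n) (G \<inter> lp_ball n p)"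
    by (rule emeasure_p_gaussian_vec_cone[OF p, of n]) blast
  from this(2)[OF scale_invariant_space] have *: "ennreal K * emeasure (lborel_vec n) (lp_ball n p) = 1"
    using prob_space.emeasure_space_1[OF prob_space_p_gaussian_vec[OF p], of "{..<n}"]
    by (simp add: sets.Int_space_eq1)
  then show "emeasure (lborel_vec n) (lp_ball n p) \<noteq> 0" by (metis mult_zero_right zero_neq_one)
  from * K show "emeasure (lborel_vec n) (lp_ball n p) \<noteq> \<infinity>"
    by (auto simp: ennreal_mult_top)
qed

lemma emeasure_p_gaussian_vec_eq_ratio:
  assumes p: "p > 0" and G: "scale_invariant n G"
  shows "emeasure (p_gaussian_vec n p) G = emeasure (lborel_vec n) (G \<inter> lp_ball n p) / emeasure (lborel_vec n) (lp_ball n p)"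
proof -
  obtain K where K: "K > 0" and
    H: "\<And>G. scale_invariant n G \<Longrightarrow> emeasure (p_gaussian_vec n p) G = ennreal K * emeasure (lborel_vec n) (G \<inter> lp_ball n p)"
    by (rule emeasure_p_gaussian_vec_cone[OF p, of n]) blast
  from H[OF scale_invariant_space] have *: "ennreal K * emeasure (lborel_vec n) (lp_ball n p) = 1"
    using prob_space.emeasure_space_1[OF prob_space_p_gaussian_vec[OF p], of "{..<n}"]
    by (simp add: sets.Int_space_eq1)
  have "ennreal K = 1 / emeasure (lborel_vec n) (lp_ball n p)"
    using emeasure_lp_ball_pos_finite[OF p, of n]
    by (subst *[symmetric]) (simp add: ennreal_mult_divide_eq)
  then show ?thesis by (simp add: H[OF G] divide_ennreal_def mult.commute)
qed

section \<open>The cone measure of scale-invariant sets\<close>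

lemma scale_vec_PiE [simp]: "scale_vec n r x \<in> {..<n} \<rightarrow>\<^sub>E UNIV"
  by (simp add: scale_vec_def)

lemma zero_vec_null:
  assumes "n \<ge> 1"
  shows "{\<lambda>i\<in>{..<n}. 0} \<in> null_sets (lborel_vec n)"
proof -
  have "{\<lambda>i\<in>{..<n}. 0 :: real} = Pi\<^sub>E {..<n} (\<lambda>_. {0})"
    by (auto simp: PiE_singleton restrict_def PiE_def extensional_def)
  moreover have "emeasure (lborel_vec n) (Pi\<^sub>E {..<n} (\<lambda>_. {0})) = 0"
    using assms by (subst lborel_PiM.emeasure_PiM) auto
  moreover have "Pi\<^sub>E {..<n} (\<lambda>_. {0 :: real}) \<in> sets (lborel_vec n)"
    by (rule sets_PiM_I_finite) auto
  ultimately show ?thesis by (simp add: null_sets_def)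
qed

lemma lp_norm_eq_0:
  assumes "lp_norm n p x = 0" "x \<in> space (borel_vec n)"
  shows "x = (\<lambda>i\<in>{..<n}. 0)"
proof -
  have "(\<Sum>i<n. \<bar>x i\<bar> powr p) = 0" using assms by (simp add: lp_norm_def)
  then have "\<forall>i<n. \<bar>x i\<bar> powr p = 0" by (subst (asm) sum_nonneg_eq_0_iff) auto
  then show ?thesis using assms(2) by (auto simp: space_PiM PiE_def extensional_def)
qed

text \<open>Away from the origin the two sets coincide, by polar coordinates. The origin lies in
  every cone over a nonempty set (\<open>r = 0\<close>) but possibly not in \<open>G\<close>; for
  \<open>n \<ge> 1\<close> it is a null set.\<close>

lemma emeasure_cone_over:
  assumes n: "n \<ge> 1" and p: "p > 0" and G: "scale_invariant n G"
  shows "emeasure (lborel_vec n) (cone_over n (G \<inter> lp_sphere n p)) = emeasure (lborel_vec n) (G \<inter> lp_ball n p)"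
proof -
  let ?z = "\<lambda>i\<in>{..<n}. 0 :: real"
  let ?C = "cone_over n (G \<inter> lp_sphere n p)"
  have GB: "G \<inter> lp_ball n p \<in> sets (lborel_vec n)"
    using G by (auto simp: scale_invariant_def sets_lborel_vec)
  have zs: "{?z} \<in> sets (lborel_vec n)" using zero_vec_null[OF n] by (simp add: null_sets_def)
  have eq: "?C - {?z} = G \<inter> lp_ball n p - {?z}"
  proof (intro equalityI subsetI)
    fix x assume "x \<in> ?C - {?z}"
    then obtain r a where x: "x = scale_vec n r a" "0 \<le> r" "r \<le> 1" "a \<in> G" "a \<in> lp_sphere n p" "x \<noteq> ?z"
      by (auto simp: cone_over_def)
    have "r \<noteq> 0" using x by (auto simp: scale_vec_def)
    moreover have "a \<in> space (borel_vec n)" "lp_norm n p a = 1" using x(5) by (auto simp: lp_sphere_def space_PiM)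
    ultimately show "x \<in> G \<inter> lp_ball n p - {?z}"
      using x p scale_invariantD[OF G, of r a] by (auto simp: lp_ball_def lp_norm_scale_vec)
  next
    fix x assume x: "x \<in> G \<inter> lp_ball n p - {?z}"
    then have sp: "x \<in> space (borel_vec n)" by (auto simp: lp_ball_def space_PiM)
    define r where "r = lp_norm n p x"
    have "r \<noteq> 0" using lp_norm_eq_0[OF _ sp, of p] x by (auto simp: r_def)
    then have r: "r > 0" using lp_norm_nonneg[of n p x] unfolding r_def by linarith
    have "scale_vec n (1 / r) x \<in> G \<inter> lp_sphere n p"
      using x p r scale_invariantD[OF G _ sp, of "1 / r"] by (simp add: lp_sphere_def lp_norm_scale_vec r_def[symmetric])
    moreover have "x = scale_vec n r (scale_vec n (1 / r) x)" using r sp by simp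
    moreover have "r \<in> {0..1}" using x r by (auto simp: lp_ball_def r_def)
    ultimately have "x \<in> ?C" unfolding cone_over_def by blast
    then show "x \<in> ?C - {?z}" using x by blast
  qed
  \<comment> \<open>Measurability of the cone: it differs from a Borel set in at most one
    point.\<close>
  have "?C = (G \<inter> lp_ball n p - {?z}) \<union> (?C \<inter> {?z})" using eq by blast
  moreover have "?C \<inter> {?z} = {} \<or> ?C \<inter> {?z} = {?z}" by auto
  then have "?C \<inter> {?z} \<in> sets (lborel_vec n)" using zs by (elim disjE) simp_all
  ultimately have C: "?C \<in> sets (lborel_vec n)" using GB zs sets.Un sets.Diff by metis
  have "emeasure (lborel_vec n) ?C = emeasure (lborel_vec n) (?C - {?z})"
    by (rule emeasure_Diff_null_set[symmetric, OF zero_vec_null[OF n] C])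
  also have "\<dots> = emeasure (lborel_vec n) (G \<inter> lp_ball n p)"
    unfolding eq by (rule emeasure_Diff_null_set[OF zero_vec_null[OF n] GB])
  finally show ?thesis .
qed

text \<open>The zero default of \<open>measure_of\<close> stays explicit, because whether the set
  function is a measure is decided only later, from the total mass.\<close>

lemma emeasure_measure_of_borel_vec:
  "emeasure (measure_of (space (borel_vec n)) (sets (borel_vec n)) f) A =
     (if A \<in> sets (borel_vec n) \<and> measure_space (space (borel_vec n)) (sets (borel_vec n)) f then f A else 0)"
  by (subst emeasure_measure_of_conv) (simp add: sets.sigma_sets_eq)

lemma sets_cone_measure [simp, measurable_cong]: "sets (cone_measure n p) = sets (borel_vec n)"
  by (simp add: cone_measure_def)

lemma space_cone_measure [simp]: "space (cone_measure n p) = space (borel_vec n)"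
  by (simp add: cone_measure_def space_measure_of_conv)

text \<open>The radius drops out: for \<open>r > 0\<close> the section of the preimage of
  \<open>G\<close> at \<open>r\<close> is \<open>G\<close> itself. The hypothesis \<open>pr\<close>
  excludes that the cone measure is the zero default.\<close>

lemma emeasure_radial_distribution_cone:
  assumes n: "n \<ge> 1" and p: "p > 0" and G: "scale_invariant n G"
    and \<rho>: "real_distribution \<rho>" and pos: "AE r in \<rho>. r > 0"
    and pr: "prob_space (radial_distribution n p \<rho>)"
  shows "emeasure (radial_distribution n p \<rho>) G = emeasure (p_gaussian_vec n p) G"
proof -
  interpret R: real_distribution \<rho> by fact
  define f where "f A = emeasure (lborel_vec n) (cone_over n (A \<inter> lp_sphere n p)) / emeasure (lborel_vec n) (lp_ball n p)" for A
  let ?ok = "measure_space (space (borel_vec n)) (sets (borel_vec n)) f"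
  have em: "emeasure (cone_measure n p) A = (if A \<in> sets (borel_vec n) \<and> ?ok then f A else 0)" for A
    unfolding cone_measure_def f_def by (rule emeasure_measure_of_borel_vec)
  have f_eq: "f G = emeasure (p_gaussian_vec n p) G" if "scale_invariant n G" for G
    unfolding f_def emeasure_cone_over[OF n p that] emeasure_p_gaussian_vec_eq_ratio[OF p that] ..
  \<comment> \<open>Finite in both cases of \<open>em\<close>: the total mass is 1 or, by default,
    0.\<close>
  interpret C: finite_measure "cone_measure n p"
  proof
    show "emeasure (cone_measure n p) (space (cone_measure n p)) \<noteq> \<infinity>"
      using f_eq[OF scale_invariant_space] prob_space.emeasure_space_1[OF prob_space_p_gaussian_vec[OF p], of "{..<n}"]
      by (simp add: em)
  qed
  have [measurable_cong]: "sets (\<rho> \<Otimes>\<^sub>M cone_measure n p) = sets (borel \<Otimes>\<^sub>M borel_vec n)"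
    by (intro sets_pair_measure_cong) auto
  have *: "emeasure (radial_distribution n p \<rho>) G = emeasure (cone_measure n p) G" if G: "scale_invariant n G" for G
  proof -
    have [measurable]: "G \<in> sets (borel_vec n)" using G by (simp add: scale_invariant_def)
    have m: "(\<lambda>(r, \<theta>). scale_vec n r \<theta>) \<in> measurable (\<rho> \<Otimes>\<^sub>M cone_measure n p) (borel_vec n)" by measurable
    have "emeasure (radial_distribution n p \<rho>) G =
       emeasure (\<rho> \<Otimes>\<^sub>M cone_measure n p) ((\<lambda>(r, \<theta>). scale_vec n r \<theta>) -` G \<inter> space (\<rho> \<Otimes>\<^sub>M cone_measure n p))"
      unfolding radial_distribution_def by (rule emeasure_distr[OF m]) simp
    also have "\<dots> = (\<integral>\<^sup>+r. emeasure (cone_measure n p) (Pair r -` ((\<lambda>(r, \<theta>). scale_vec n r \<theta>) -` G \<inter> space (\<rho> \<Otimes>\<^sub>M cone_measure n p))) \<partial>\<rho>)"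
      by (rule C.emeasure_pair_measure_alt) (use measurable_sets[OF m, of G] in simp)
    also have "\<dots> = (\<integral>\<^sup>+r. emeasure (cone_measure n p) G \<partial>\<rho>)"
    proof (rule nn_integral_cong_AE, use pos in eventually_elim)
      fix r :: real assume r: "r > 0"
      have "Pair r -` ((\<lambda>(r, \<theta>). scale_vec n r \<theta>) -` G \<inter> space (\<rho> \<Otimes>\<^sub>M cone_measure n p)) = G"
        using scale_invariantD[OF G r] sets.sets_into_space[of G "borel_vec n"] by (auto simp: space_pair_measure)
      then show "emeasure (cone_measure n p) (Pair r -` ((\<lambda>(r, \<theta>). scale_vec n r \<theta>) -` G \<inter> space (\<rho> \<Otimes>\<^sub>M cone_measure n p))) = emeasure (cone_measure n p) G"
        by simp
    qed
    also have "\<dots> = emeasure (cone_measure n p) G" using R.emeasure_space_1 by simp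
    finally show ?thesis .
  qed
  \<comment> \<open>Mass 1 is incompatible with the zero default, so \<open>?ok\<close>
    holds.\<close>
  have "emeasure (radial_distribution n p \<rho>) (space (borel_vec n)) = 1"
    using prob_space.emeasure_space_1[OF pr] by (simp add: radial_distribution_def)
  with *[OF scale_invariant_space] have ?ok by (auto simp: em split: if_splits)
  with *[OF G] G show ?thesis by (simp add: em f_eq scale_invariant_def)
qed

section \<open>Elementary symmetric polynomials\<close>

text \<open>The elementary symmetric polynomial e_k. The index set is an argument because the
  recursions delete single indices.\<close>

definition esym :: "('i \<Rightarrow> real) \<Rightarrow> 'i set \<Rightarrow> nat \<Rightarrow> real" where
  "esym z S k = (\<Sum>I\<in>{I. I \<subseteq> S \<and> card I = k}. \<Prod>i\<in>I. z i)"

lemma esym_0 [simp]: "finite S \<Longrightarrow> esym z S 0 = 1"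
proof -
  assume "finite S"
  then have "{I. I \<subseteq> S \<and> card I = 0} = {{}}" by (auto simp: card_eq_0_iff dest: finite_subset)
  then show ?thesis by (simp add: esym_def)
qed

lemma esym_nonneg: "(\<And>i. i \<in> S \<Longrightarrow> z i \<ge> 0) \<Longrightarrow> esym z S k \<ge> 0"
  unfolding esym_def by (intro sum_nonneg prod_nonneg) auto

lemma esym_remove:
  assumes S: "finite S" and i: "i \<in> S"
  shows "esym z S (Suc k) = esym z (S - {i}) (Suc k) + z i * esym z (S - {i}) k"
proof -
  have fin: "finite {I. I \<subseteq> S - {i} \<and> card I = m}" for m
    by (rule finite_subset[OF _ iffD2[OF finite_Pow_iff S]]) auto
  have "{I. I \<subseteq> S \<and> card I = Suc k} = {I. I \<subseteq> S - {i} \<and> card I = Suc k} \<union> insert i ` {I. I \<subseteq> S - {i} \<and> card I = k}"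
    (is "?L = ?A \<union> ?B")
  proof (intro equalityI subsetI)
    fix I assume I: "I \<in> ?L"
    then have "finite I" using S finite_subset by auto
    show "I \<in> ?A \<union> ?B"
    proof (cases "i \<in> I")
      case True
      then have "I = insert i (I - {i})" "card (I - {i}) = k" using I \<open>finite I\<close> by auto
      then show ?thesis using I by blast
    qed (use I in auto)
  next
    fix I assume "I \<in> ?A \<union> ?B"
    then show "I \<in> ?L"
    proof
      assume "I \<in> ?B"
      then obtain J where J: "I = insert i J" "J \<subseteq> S - {i}" "card J = k" by auto
      then have "finite J" "i \<notin> J" using S finite_subset[of J "S - {i}"] by auto
      then show ?thesis using J i by auto
    qed auto
  qed
  moreover have "?A \<inter> ?B = {}" by auto
  moreover have "inj_on (insert i) {I. I \<subseteq> S - {i} \<and> card I = k}"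
    by (auto simp: inj_on_def)
  moreover have "prod z (insert i J) = z i * prod z J" if "J \<subseteq> S - {i}" for J
    using that S finite_subset[of J "S - {i}"] by (subst prod.insert) auto
  ultimately show ?thesis
    by (simp add: esym_def sum.union_disjoint fin sum.reindex sum_distrib_left)
qed

text \<open>A set \<open>J\<close> of size \<open>k + 1\<close> is counted once for each of its
  elements: the pair of \<open>i\<close> and \<open>J - {i}\<close> corresponds to the pair of
  \<open>J\<close> and \<open>i\<close>.\<close>

lemma esym_double_count:
  assumes S: "finite S"
  shows "real (Suc k) * esym z S (Suc k) = (\<Sum>i\<in>S. z i * esym z (S - {i}) k)"
proof -
  have fin: "finite {I. I \<subseteq> S - T \<and> card I = m}" for m T
    by (rule finite_subset[OF _ iffD2[OF finite_Pow_iff S]]) auto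
  have fin': "finite {I. I \<subseteq> S \<and> card I = m}" for m
    by (rule finite_subset[OF _ iffD2[OF finite_Pow_iff S]]) auto
  have "(\<Sum>i\<in>S. z i * esym z (S - {i}) k) = (\<Sum>i\<in>S. \<Sum>I\<in>{I. I \<subseteq> S - {i} \<and> card I = k}. z i * prod z I)"
    by (simp add: esym_def sum_distrib_left)
  also have "\<dots> = (\<Sum>(i, I)\<in>(SIGMA i:S. {I. I \<subseteq> S - {i} \<and> card I = k}). z i * prod z I)"
    by (rule sum.Sigma) (use S fin in auto)
  also have "\<dots> = (\<Sum>(J, i)\<in>(SIGMA J:{J. J \<subseteq> S \<and> card J = Suc k}. J). prod z J)"
  proof (rule sum.reindex_bij_witness[where i="\<lambda>(J, i). (i, J - {i})" and j="\<lambda>(i, I). (insert i I, i)"])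
    fix a assume "a \<in> (SIGMA i:S. {I. I \<subseteq> S - {i} \<and> card I = k})"
    then obtain i I where a: "a = (i, I)" "i \<in> S" "I \<subseteq> S - {i}" "card I = k" by auto
    then have f: "finite I" "i \<notin> I" using S finite_subset[of I "S - {i}"] by auto
    then show "(\<lambda>(J, i). (i, J - {i})) ((\<lambda>(i, I). (insert i I, i)) a) = a" using a by auto
    show "(\<lambda>(i, I). (insert i I, i)) a \<in> (SIGMA J:{J. J \<subseteq> S \<and> card J = Suc k}. J)" using a f by auto
    show "(case (\<lambda>(i, I). (insert i I, i)) a of (J, i) \<Rightarrow> prod z J) = (case a of (i, I) \<Rightarrow> z i * prod z I)" using a f by auto
  next
    fix b assume "b \<in> (SIGMA J:{J. J \<subseteq> S \<and> card J = Suc k}. J)"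
    then obtain J i where b: "b = (J, i)" "J \<subseteq> S" "card J = Suc k" "i \<in> J" by auto
    then have "finite J" using S finite_subset by auto
    with b show "(\<lambda>(i, I). (insert i I, i)) ((\<lambda>(J, i). (i, J - {i})) b) = b"
      "(\<lambda>(J, i). (i, J - {i})) b \<in> (SIGMA i:S. {I. I \<subseteq> S - {i} \<and> card I = k})" by auto
  qed
  also have "\<dots> = (\<Sum>J\<in>{J. J \<subseteq> S \<and> card J = Suc k}. \<Sum>i\<in>J. prod z J)"
    by (rule sum.Sigma[symmetric]) (use S fin' finite_subset in auto)
  also have "\<dots> = real (Suc k) * esym z S (Suc k)"
    unfolding esym_def sum_distrib_left by (intro sum.cong) auto
  finally show ?thesis by simp
qed

lemma esym_minus_le:
  assumes "finite S" "\<And>i. i \<in> S \<Longrightarrow> z i \<ge> 0"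
  shows "esym z (S - {i}) k \<le> esym z S k"
proof -
  have fin: "finite {I. I \<subseteq> S \<and> card I = k}"
    by (rule finite_subset[OF _ iffD2[OF finite_Pow_iff assms(1)]]) auto
  show ?thesis
  unfolding esym_def by (rule sum_mono2) (use assms fin in \<open>auto intro!: prod_nonneg\<close>)
qed

text \<open>Replacing \<open>S - {i}\<close> by \<open>S\<close> in \<open>esym_double_count\<close>
  gives \<open>r (Suc k) \<le> r k\<close>. By \<open>esym_remove\<close> this replacement costs at
  most \<open>z i\<close> times the preceding polynomial, so the step from \<open>r k\<close> to
  \<open>r (Suc k)\<close> loses at most \<open>k\<close> times \<open>q\<close>, the quotient of
  the second power sum by the squared first one. The losses 1 + ... + (k - 1) stay below
  \<open>k ^ 2\<close>.\<close>

lemma esym_bounds: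
  assumes S: "finite S" and z: "\<And>i. i \<in> S \<Longrightarrow> z i \<ge> 0" and p1: "(\<Sum>i\<in>S. z i) > 0"
  defines "r \<equiv> (\<lambda>k. fact k * esym z S k / (\<Sum>i\<in>S. z i) ^ k)"
  shows "r k \<le> 1" "1 - real k ^ 2 * ((\<Sum>i\<in>S. (z i)\<^sup>2) / (\<Sum>i\<in>S. z i)\<^sup>2) \<le> r k"
proof -
  let ?s = "\<Sum>i\<in>S. z i"
  define q where "q = (\<Sum>i\<in>S. (z i)\<^sup>2) / ?s\<^sup>2"
  have q: "q \<ge> 0" by (auto simp: q_def intro!: divide_nonneg_nonneg sum_nonneg)
  have r_nonneg: "r k \<ge> 0" for k
    using p1 unfolding r_def by (intro divide_nonneg_nonneg mult_nonneg_nonneg esym_nonneg z) auto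
  have step_up: "r (Suc k) \<le> r k" for k
  proof -
    have "real (Suc k) * esym z S (Suc k) \<le> (\<Sum>i\<in>S. z i * esym z S k)"
      unfolding esym_double_count[OF S] by (intro sum_mono mult_left_mono esym_minus_le S z)
    also have "\<dots> = ?s * esym z S k" by (simp add: sum_distrib_right)
    finally have "fact k * (real (Suc k) * esym z S (Suc k)) \<le> fact k * (?s * esym z S k)"
      by (intro mult_left_mono) auto
    then have "fact (Suc k) * esym z S (Suc k) / ?s ^ Suc k \<le> fact k * (?s * esym z S k) / ?s ^ Suc k"
      using p1 by (intro divide_right_mono) (auto simp: mult_ac)
    then show ?thesis using p1 by (simp add: r_def)
  qed
  have r0: "r 0 = 1" using S by (simp add: r_def)
  have le1: "r k \<le> 1" for k
    by (induction k) (use r0 step_up order_trans in auto)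
  then show "r k \<le> 1" .
  have r1: "r (Suc 0) = 1"
  proof -
    have "esym z S (Suc 0) = ?s" using esym_double_count[OF S, of 0] S by simp
    then show ?thesis using p1 by (simp add: r_def)
  qed
  have step_down: "r (Suc (Suc k)) \<ge> r (Suc k) - real (Suc k) * q" for k
  proof -
    have "(\<Sum>i\<in>S. z i * (esym z S (Suc k) - z i * esym z S k)) \<le> real (Suc (Suc k)) * esym z S (Suc (Suc k))"
      unfolding esym_double_count[OF S]
    proof (intro sum_mono mult_left_mono z)
      fix i assume i: "i \<in> S"
      have "z i * esym z (S - {i}) k \<le> z i * esym z S k"
        using i by (intro mult_left_mono esym_minus_le S z) auto
      then show "esym z S (Suc k) - z i * esym z S k \<le> esym z (S - {i}) (Suc k)"
        using esym_remove[OF S i, of z k] by linarith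
    qed
    also have "(\<Sum>i\<in>S. z i * (esym z S (Suc k) - z i * esym z S k)) = ?s * esym z S (Suc k) - (\<Sum>i\<in>S. (z i)\<^sup>2) * esym z S k"
      by (simp add: right_diff_distrib sum_subtractf sum_distrib_right power2_eq_square mult.assoc)
    finally have "fact (Suc k) * (?s * esym z S (Suc k) - (\<Sum>i\<in>S. (z i)\<^sup>2) * esym z S k) \<le>
        fact (Suc k) * (real (Suc (Suc k)) * esym z S (Suc (Suc k)))"
      by (intro mult_left_mono) auto
    then have "fact (Suc k) * (?s * esym z S (Suc k) - (\<Sum>i\<in>S. (z i)\<^sup>2) * esym z S k) / ?s ^ Suc (Suc k) \<le>
        fact (Suc (Suc k)) * esym z S (Suc (Suc k)) / ?s ^ Suc (Suc k)"
      using p1 by (intro divide_right_mono) (auto simp: mult_ac)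
    also have "fact (Suc k) * (?s * esym z S (Suc k) - (\<Sum>i\<in>S. (z i)\<^sup>2) * esym z S k) / ?s ^ Suc (Suc k) =
        r (Suc k) - real (Suc k) * q * r k"
      using p1 by (simp add: r_def q_def diff_divide_distrib right_diff_distrib power2_eq_square mult_ac)
    finally have "r (Suc k) - real (Suc k) * q * r k \<le> r (Suc (Suc k))" by (simp add: r_def)
    moreover have "real (Suc k) * q * r k \<le> real (Suc k) * q * 1"
      using q le1 by (intro mult_left_mono) auto
    ultimately show ?thesis unfolding mult_1_right by linarith
  qed
  \<comment> \<open>Two base cases: \<open>r\<close> equals 1 both at 0 and at 1, and the loss
    recursion only links \<open>k + 2\<close> to \<open>k + 1\<close>.\<close>
  have "1 - real k ^ 2 * q \<le> r k" for k
  proof (induction k rule: less_induct)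
    case (less k)
    consider "k = 0" | "k = Suc 0" | m where "k = Suc (Suc m)" by (metis not0_implies_Suc)
    then show ?case
    proof cases
      case 3
      have "1 - real (Suc m) ^ 2 * q \<le> r (Suc m)" using less[of "Suc m"] 3 by simp
      then have "1 - real (Suc m) ^ 2 * q - real (Suc m) * q \<le> r k" using step_down[of m] 3 by simp
      moreover have "real (Suc m) ^ 2 * q + real (Suc m) * q \<le> real k ^ 2 * q"
        using 3 q unfolding distrib_right[symmetric] by (intro mult_right_mono) (auto simp: power2_eq_square algebra_simps)
      ultimately show ?thesis by linarith
    qed (use r0 r1 q in auto)
  qed
  then show "1 - real k ^ 2 * ((\<Sum>i\<in>S. (z i)\<^sup>2) / ?s\<^sup>2) \<le> r k" unfolding q_def .
qed

text \<open>\<open>\<beta>\<close> is the ratio \<open>r\<close> of \<open>esym_bounds\<close> when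
  all \<open>z i\<close> are 1. It equals the product of the factors \<open>1 - i / n\<close>, to
  which the Weierstrass product inequality applies.\<close>

lemma binomial_power_bounds:
  assumes "k \<le> n" "n \<ge> 1"
  defines "\<beta> \<equiv> fact k * real (n choose k) / real n ^ k"
  shows "\<beta> \<le> 1" "1 - real k ^ 2 / real n \<le> \<beta>" "\<beta> > 0"
proof -
  have "fact k * real (n choose k) = (\<Prod>i<k. real n - real i)"
    using gbinomial_mult_fact[of k "real n"] by (simp add: binomial_gbinomial atLeast0LessThan)
  then have \<beta>: "\<beta> = (\<Prod>i<k. 1 - real i / real n)"
  proof -
    assume *: "fact k * real (n choose k) = (\<Prod>i<k. real n - real i)"
    have "(\<Prod>i<k. 1 - real i / real n) = (\<Prod>i<k. (real n - real i) / real n)"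
      using assms(2) by (intro prod.cong) (auto simp: diff_divide_distrib)
    then show ?thesis by (simp add: \<beta>_def * prod_dividef)
  qed
  show "\<beta> \<le> 1" unfolding \<beta> using assms by (intro prod_le_1) (auto simp: field_simps)
  have "1 - (\<Sum>i<k. real i / real n) \<le> \<beta>"
    unfolding \<beta> by (rule Weierstrass_prod_ineq) (use assms in auto)
  moreover have "(\<Sum>i<k. real i / real n) \<le> (\<Sum>i<k. real k / real n)"
    by (intro sum_mono divide_right_mono) auto
  ultimately show "1 - real k ^ 2 / real n \<le> \<beta>" by (simp add: power2_eq_square)
  show "\<beta> > 0" using assms by (simp add: \<beta>_def)
qed

section \<open>Linearization of the logarithm of the Maclaurin ratio\<close>

lemma abs_ln_le: "0 \<le> d \<Longrightarrow> d \<le> 1/2 \<Longrightarrow> 1 - d \<le> r \<Longrightarrow> r \<le> 1 \<Longrightarrow> \<bar>ln r\<bar> \<le> 2 * d" for d r :: real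
proof -
  assume d: "0 \<le> d" "d \<le> 1/2" "1 - d \<le> r" "r \<le> 1"
  have "r > 0" using d by linarith
  then have "- ln r \<le> 1 / r - 1" using ln_le_minus_one[of "1/r"] by (simp add: ln_div)
  also have "1 / r - 1 \<le> 2 * d"
  proof -
    \<comment> \<open>The claim amounts to \<open>1 \<le> (1 + 2 * d) * r\<close>; here
      \<open>d \<le> 1/2\<close> enters.\<close>
    have "(1 + 2 * d) * (1 - d) \<le> (1 + 2 * d) * r" using d by (intro mult_left_mono) auto
    moreover have "(1 + 2 * d) * (1 - d) = 1 + d * (1 - 2 * d)" by algebra
    moreover have "0 \<le> d * (1 - 2 * d)" using d by (intro mult_nonneg_nonneg) auto
    ultimately show ?thesis using \<open>r > 0\<close> by (simp add: field_simps)
  qed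
  finally show ?thesis using \<open>r > 0\<close> d by (simp add: abs_if)
qed

lemma abs_exp_minus_1_minus_le: "\<bar>x\<bar> \<le> 1 \<Longrightarrow> \<bar>exp x - 1 - x\<bar> \<le> x\<^sup>2" for x :: real
proof (cases "x \<ge> 0")
  case True
  assume "\<bar>x\<bar> \<le> 1"
  with True show ?thesis using exp_bound[of x]
    by (intro abs_leI) (use exp_ge_add_one_self[of x] zero_le_power2[of x] in linarith)+
next
  case False
  define y where "y = - x"
  have y: "y > 0" using False by (simp add: y_def)
  \<comment> \<open>For negative arguments the constant 1 in the Taylor bound comes from inverting
    \<open>1 + y \<le> exp y\<close>.\<close>
  have "exp (- y) \<le> 1 / (1 + y)"
    using exp_ge_add_one_self[of y] y by (simp add: exp_minus field_simps)
  also have "\<dots> \<le> 1 - y + y\<^sup>2"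
  proof -
    have "(1 - y + y\<^sup>2) * (1 + y) = 1 + y ^ 3" by algebra
    then show ?thesis using y by (simp add: field_simps)
  qed
  finally have "exp x \<le> 1 + x + x\<^sup>2" by (simp add: y_def)
  then show ?thesis
    by (intro abs_leI) (use exp_ge_add_one_self[of x] zero_le_power2[of x] in linarith)+
qed

text \<open>With \<open>Z\<close> the mean of the \<open>\<bar>x i\<bar> powr p\<close>, the
  normalized e_k is \<open>Z ^ k * (r / \<beta>)\<close>, so the mean of order \<open>k\<close> has
  logarithm \<open>ln Z / p\<close> plus \<open>ln r - ln \<beta>\<close> over \<open>k * p\<close>.
  The statement is deterministic: \<open>K\<close> bounds quantities that are bounded in probability
  for p-Gaussian coordinates. The three terms of the error stem from \<open>ln Z\<close>,
  \<open>ln r\<close> and \<open>ln \<beta>\<close>, in this order.\<close>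

lemma ln_maclaurin_ratio_approx:
  fixes K :: real
  assumes k: "1 \<le> k" "k \<le> n" and p: "p \<ge> 1"
    and x: "\<And>i. i < n \<Longrightarrow> x i \<noteq> 0"
    and K: "K \<ge> 0"
    and w: "\<bar>sqrt n * ((\<Sum>i<n. \<bar>x i\<bar> powr p) / n - 1)\<bar> \<le> K"
    and s: "(\<Sum>i<n. (\<bar>x i\<bar> powr p)\<^sup>2) \<le> K * n"
    and n: "K / sqrt n \<le> 1/2" "real k ^ 2 * (4 * K) / n \<le> 1/2" "real k ^ 2 / n \<le> 1/2"
  shows "maclaurin_ratio n k n p x > 0"
    "\<bar>ln (maclaurin_ratio n k n p x) - ((\<Sum>i<n. ln \<bar>x i\<bar>) / n - 1 / p * ((\<Sum>i<n. \<bar>x i\<bar> powr p) / n - 1))\<bar>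
      \<le> (2 * K\<^sup>2 + 8 * real k ^ 2 * K + 2 * real k ^ 2) / n"
proof -
  have n0: "n \<ge> 1" "real n > 0" using k by auto
  define z where "z i = \<bar>x i\<bar> powr p" for i
  define Z where "Z = (\<Sum>i<n. z i) / n"
  have zpos: "z i > 0" if "i < n" for i using x[OF that] by (simp add: z_def)
  have s1: "(\<Sum>i<n. z i) > 0" using n0 zpos by (intro sum_pos) auto
  then have Zpos: "Z > 0" using n0 by (simp add: Z_def)
  have Zabs: "\<bar>Z - 1\<bar> \<le> K / sqrt n"
    using w n0 unfolding z_def[symmetric] Z_def[symmetric] by (simp add: abs_mult pos_le_divide_eq mult.commute)
  then have Zabs': "\<bar>Z - 1\<bar> \<le> 1/2" using n(1) by linarith
  define r where "r = fact k * esym z {..<n} k / (\<Sum>i<n. z i) ^ k"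
  define \<beta> where "\<beta> = fact k * real (n choose k) / real n ^ k"
  define q where "q = (\<Sum>i<n. (z i)\<^sup>2) / (\<Sum>i<n. z i)\<^sup>2"
  have r: "r \<le> 1" "1 - real k ^ 2 * q \<le> r"
    using esym_bounds[of "{..<n}" z k] s1 zpos unfolding r_def q_def by (auto simp: less_imp_le)
  have \<beta>: "\<beta> \<le> 1" "1 - real k ^ 2 / real n \<le> \<beta>" "\<beta> > 0"
    unfolding \<beta>_def by (rule binomial_power_bounds; use k n0 in simp)+
  have "q \<le> K * n / (\<Sum>i<n. z i)\<^sup>2"
    unfolding q_def using s by (intro divide_right_mono) (auto simp: z_def)
  \<comment> \<open>The first power sum is at least \<open>n / 2\<close> because
    \<open>Z \<ge> 1/2\<close>; hence the factor 4.\<close>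
  also have "\<dots> \<le> K * n / (n / 2)\<^sup>2"
  proof (intro divide_left_mono power_mono)
    have "Z \<ge> 1/2" using Zabs' by linarith
    then show "n / 2 \<le> (\<Sum>i<n. z i)" using n0 by (simp add: Z_def field_simps)
  qed (use K n0 s1 in \<open>auto simp: power2_eq_square\<close>)
  also have "\<dots> = 4 * K / n" using n0 by (simp add: power2_eq_square field_simps)
  finally have q: "q \<le> 4 * K / n" .
  have q0: "q \<ge> 0" by (auto simp: q_def intro!: divide_nonneg_nonneg sum_nonneg)
  have kq: "real k ^ 2 * q \<le> real k ^ 2 * (4 * K) / n"
    using mult_left_mono[OF q, of "real k ^ 2"] by (simp add: field_simps)
  have lnr: "\<bar>ln r\<bar> \<le> 2 * (real k ^ 2 * (4 * K) / n)"
    using abs_ln_le[of "real k ^ 2 * q" r] r kq n(2) q0 by auto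
  have "r > 0" using r kq n(2) by linarith
  have ln\<beta>: "\<bar>ln \<beta>\<bar> \<le> 2 * (real k ^ 2 / n)"
    by (rule abs_ln_le) (use \<beta> n(3) in auto)
  have lnZ: "\<bar>ln Z - (Z - 1)\<bar> \<le> 2 * K\<^sup>2 / n"
  proof -
    have "\<bar>ln (1 + (Z - 1)) - (Z - 1)\<bar> \<le> 2 * (Z - 1)\<^sup>2"
      by (rule abs_ln_one_plus_x_minus_x_bound[OF Zabs'])
    also have "(Z - 1)\<^sup>2 \<le> (K / sqrt n)\<^sup>2"
      using Zabs by (metis abs_ge_zero power2_abs power_mono)
    also have "\<dots> = K\<^sup>2 / n" using n0 by (simp add: power_divide)
    finally show ?thesis by simp
  qed
  have Ueq: "esym z {..<n} k / real (n choose k) = Z ^ k * (r / \<beta>)"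
    using n0 s1 k by (simp add: Z_def r_def \<beta>_def power_divide field_simps)
  have k_mean: "maclaurin_mean n k p x = (Z ^ k * (r / \<beta>)) powr (1 / (real k * p))"
    unfolding maclaurin_mean_def Ueq[symmetric] by (simp add: esym_def z_def)
  have Upos: "Z ^ k * (r / \<beta>) > 0" using Zpos \<open>r > 0\<close> \<beta>(3) by simp
  have ln_k: "ln (maclaurin_mean n k p x) = 1 / p * ln Z + 1 / (real k * p) * (ln r - ln \<beta>)"
    unfolding k_mean ln_powr using Zpos \<open>r > 0\<close> \<beta>(3) k p
    by (simp add: ln_mult ln_div ln_realpow distrib_left add_divide_distrib diff_divide_distrib)
  \<comment> \<open>Only one index set has \<open>n\<close> elements, so the mean of order
    \<open>n\<close> is the geometric mean.\<close>
  have sets_n: "{I. I \<subseteq> {..<n} \<and> card I = n} = {{..<n}}"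
    using card_subset_eq[of "{..<n}"] by auto
  have n_mean: "maclaurin_mean n n p x = (\<Prod>i<n. z i) powr (1 / (real n * p))"
    unfolding maclaurin_mean_def sets_n by (simp add: z_def)
  have prodpos: "(\<Prod>i<n. z i) > 0" using zpos by (intro prod_pos) auto
  have ln_n: "ln (maclaurin_mean n n p x) = (\<Sum>i<n. ln \<bar>x i\<bar>) / n"
  proof -
    have "ln (\<Prod>i<n. z i) = (\<Sum>i<n. ln (z i))"
      by (rule ln_prod) (use zpos in \<open>force+\<close>)
    also have "\<dots> = (\<Sum>i<n. p * ln \<bar>x i\<bar>)"
      by (intro sum.cong) (auto simp: z_def ln_powr x)
    also have "\<dots> = p * (\<Sum>i<n. ln \<bar>x i\<bar>)" by (simp add: sum_distrib_left)
    finally show ?thesis unfolding n_mean ln_powr using p by simp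
  qed
  show pos: "maclaurin_ratio n k n p x > 0"
    unfolding maclaurin_ratio_def n_mean k_mean
    by (intro divide_pos_pos iffD2[OF powr_gt_zero] less_imp_neq[THEN not_sym] prodpos Upos)
  have ln_ratio: "ln (maclaurin_ratio n k n p x) = (\<Sum>i<n. ln \<bar>x i\<bar>) / n - (1 / p * ln Z + 1 / (real k * p) * (ln r - ln \<beta>))"
    unfolding maclaurin_ratio_def ln_n[symmetric] ln_k[symmetric]
    unfolding n_mean k_mean
    by (intro ln_divide_pos iffD2[OF powr_gt_zero] less_imp_neq[THEN not_sym] prodpos Upos)
  \<comment> \<open>Both prefactors are at most 1, which keeps the error bound free of
    \<open>p\<close>.\<close>
  have p1: "1 / p \<le> 1" "1 / (real k * p) \<le> 1" "1 / p \<ge> 0" "1 / (real k * p) \<ge> 0"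
    using p k mult_mono[of 1 "real k" 1 p] by auto
  have "\<bar>ln (maclaurin_ratio n k n p x) - ((\<Sum>i<n. ln \<bar>x i\<bar>) / n - 1 / p * (Z - 1))\<bar> =
      \<bar>1 / p * (ln Z - (Z - 1)) + 1 / (real k * p) * (ln r - ln \<beta>)\<bar>"
    unfolding ln_ratio by (subst abs_minus_cancel[symmetric]) (simp add: algebra_simps diff_divide_distrib)
  also have "\<dots> \<le> \<bar>1 / p * (ln Z - (Z - 1))\<bar> + \<bar>1 / (real k * p) * (ln r - ln \<beta>)\<bar>"
    by (rule abs_triangle_ineq)
  also have "\<dots> \<le> 1 * \<bar>ln Z - (Z - 1)\<bar> + 1 * \<bar>ln r - ln \<beta>\<bar>"
    unfolding abs_mult using p1 by (intro add_mono mult_right_mono) auto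
  also have "\<dots> \<le> 2 * K\<^sup>2 / n + (2 * (real k ^ 2 * (4 * K) / n) + 2 * (real k ^ 2 / n))"
    unfolding mult_1_left by (rule add_mono[OF lnZ order_trans[OF abs_triangle_ineq4 add_mono[OF lnr ln\<beta>]]])
  also have "\<dots> = (2 * K\<^sup>2 + 8 * real k ^ 2 * K + 2 * real k ^ 2) / n"
    by (simp add: add_divide_distrib)
  finally show "\<bar>ln (maclaurin_ratio n k n p x) - ((\<Sum>i<n. ln \<bar>x i\<bar>) / n - 1 / p * ((\<Sum>i<n. \<bar>x i\<bar> powr p) / n - 1))\<bar>
      \<le> (2 * K\<^sup>2 + 8 * real k ^ 2 * K + 2 * real k ^ 2) / n"
    by (simp add: Z_def z_def)
qed

definition ratio_fluctuation :: "nat \<Rightarrow> real \<Rightarrow> nat \<Rightarrow> (nat \<Rightarrow> real) \<Rightarrow> real" where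
  "ratio_fluctuation k p n x = sqrt (real n) * (exp (- log_mean p) * maclaurin_ratio n k n p x - 1)"

text \<open>With \<open>L\<close> the centred logarithm of the ratio, the fluctuation is
  \<open>sqrt n * (exp L - 1)\<close> and \<open>L = A / sqrt n + \<delta>\<close>. Both
  \<open>\<delta>\<close> and the quadratic remainder of \<open>exp\<close> are of order
  \<open>1 / n\<close>, so an error of order \<open>1 / sqrt n\<close> is left. The centring in
  \<open>A\<close> is the mean of one summand, since \<open>\<bar>x\<bar> powr p\<close> has
  p-Gaussian mean 1.\<close>

lemma ratio_fluctuation_approx:
  fixes K :: real
  assumes k: "1 \<le> k" "k \<le> n" and p: "p \<ge> 1"
    and x: "\<And>i. i < n \<Longrightarrow> x i \<noteq> 0"
    and K: "K \<ge> 0"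
    and w: "\<bar>sqrt n * ((\<Sum>i<n. \<bar>x i\<bar> powr p) / n - 1)\<bar> \<le> K"
    and s: "(\<Sum>i<n. (\<bar>x i\<bar> powr p)\<^sup>2) \<le> K * n"
    and n: "K / sqrt n \<le> 1/2" "real k ^ 2 * (4 * K) / n \<le> 1/2" "real k ^ 2 / n \<le> 1/2"
  defines "A \<equiv> (\<Sum>i<n. ln \<bar>x i\<bar> - 1 / p * \<bar>x i\<bar> powr p - (log_mean p - 1 / p)) / sqrt n"
    and "C \<equiv> 2 * K\<^sup>2 + 8 * real k ^ 2 * K + 2 * real k ^ 2"
  assumes A: "\<bar>A\<bar> \<le> K" and KC: "(K + C) / sqrt n \<le> 1"
  shows "\<bar>ratio_fluctuation k p n x - A\<bar> \<le> (C + (K + C)\<^sup>2) / sqrt n"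
proof -
  have n0: "n \<ge> 1" "real n > 0" using k by auto
  define \<rho> where "\<rho> = maclaurin_ratio n k n p x"
  note approx = ln_maclaurin_ratio_approx[OF k p x K w s n]
  have \<rho>: "\<rho> > 0" using approx(1) by (simp add: \<rho>_def)
  define \<delta> where "\<delta> = ln \<rho> - ((\<Sum>i<n. ln \<bar>x i\<bar>) / n - 1 / p * ((\<Sum>i<n. \<bar>x i\<bar> powr p) / n - 1))"
  have \<delta>: "\<bar>\<delta>\<bar> \<le> C / n" using approx(2) by (simp add: \<delta>_def \<rho>_def C_def)
  have C: "C \<ge> 0" using K by (simp add: C_def)
  define L where "L = ln \<rho> - log_mean p"
  have L: "L = A / sqrt n + \<delta>"
  proof -
    have "A / sqrt n = (\<Sum>i<n. ln \<bar>x i\<bar> - 1 / p * \<bar>x i\<bar> powr p - (log_mean p - 1 / p)) / n"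
      unfolding A_def using n0 by simp
    also have "\<dots> = (\<Sum>i<n. ln \<bar>x i\<bar>) / n - 1 / p * ((\<Sum>i<n. \<bar>x i\<bar> powr p) / n) - (log_mean p - 1 / p)"
      using n0 by (simp add: sum_subtractf diff_divide_distrib sum_distrib_left sum_divide_distrib)
    finally show ?thesis by (simp add: L_def \<delta>_def algebra_simps)
  qed
  have sn: "sqrt n \<ge> 1" using n0 by simp
  have Cn: "C / n \<le> C / sqrt n"
    using C n0 sn by (intro divide_left_mono) (auto simp: real_sqrt_le_iff real_le_lsqrt power2_eq_square)
  have "\<bar>L\<bar> \<le> \<bar>A\<bar> / sqrt n + C / n"
    unfolding L using \<delta> n0 abs_triangle_ineq[of "A / sqrt n" \<delta>] by simp
  also have "\<dots> \<le> K / sqrt n + C / sqrt n"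
    using A Cn n0 by (intro add_mono divide_right_mono) auto
  also have "\<dots> = (K + C) / sqrt n" by (simp add: add_divide_distrib)
  finally have L1: "\<bar>L\<bar> \<le> (K + C) / sqrt n" .
  then have "\<bar>exp L - 1 - L\<bar> \<le> L\<^sup>2" using KC by (intro abs_exp_minus_1_minus_le) linarith
  also have "\<dots> \<le> ((K + C) / sqrt n)\<^sup>2" using L1 by (metis abs_ge_zero power2_abs power_mono)
  also have "\<dots> = (K + C)\<^sup>2 / n" using n0 by (simp add: power_divide)
  finally have e: "\<bar>exp L - 1 - L\<bar> \<le> (K + C)\<^sup>2 / n" .
  have "ratio_fluctuation k p n x = sqrt n * (exp L - 1)"
    using \<rho> by (simp add: ratio_fluctuation_def L_def \<rho>_def exp_diff exp_minus divide_inverse mult.commute)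
  then have "ratio_fluctuation k p n x - A = sqrt n * ((exp L - 1 - L) + \<delta>)"
    using n0 unfolding L by (simp add: algebra_simps)
  then have "\<bar>ratio_fluctuation k p n x - A\<bar> \<le> sqrt n * (\<bar>exp L - 1 - L\<bar> + \<bar>\<delta>\<bar>)"
    by (simp add: abs_mult mult_left_mono)
  also have "\<dots> \<le> sqrt n * ((K + C)\<^sup>2 / n + C / n)"
    using e \<delta> by (intro mult_left_mono add_mono) auto
  also have "\<dots> = (C + (K + C)\<^sup>2) * (sqrt n / n)" by (simp add: algebra_simps add_divide_distrib)
  also have "sqrt n / n = 1 / sqrt n" using n0 by (simp add: field_simps)
  finally show ?thesis by simp
qed

section \<open>The central limit theorem for \<open>p\<close>-Gaussian vectors\<close>

text \<open>Outside the event \<open>\<bar>T n \<omega> - A n \<omega>\<bar> > \<epsilon>\<close>,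
  the condition \<open>T n \<omega> \<le> t\<close> follows from
  \<open>A n \<omega> \<le> t - \<epsilon>\<close> and implies
  \<open>A n \<omega> \<le> t + \<epsilon>\<close>. Continuity of the limit everywhere gives
  convergence at both shifted points, with no need to steer \<open>\<epsilon>\<close> around
  atoms.\<close>

lemma weak_conv_m_Slutsky:
  fixes A T :: "nat \<Rightarrow> 'a \<Rightarrow> real"
  assumes "prob_space P"
    and A [measurable]: "\<And>n. A n \<in> borel_measurable P" and T [measurable]: "\<And>n. T n \<in> borel_measurable P"
    and conv: "weak_conv_m (\<lambda>n. distr P borel (A n)) \<mu>"
    and cont: "\<And>x. isCont (cdf \<mu>) x"
    and diff: "\<And>\<epsilon>. \<epsilon> > 0 \<Longrightarrow> (\<lambda>n. measure P {\<omega> \<in> space P. \<bar>T n \<omega> - A n \<omega>\<bar> > \<epsilon>}) \<longlonglongrightarrow> 0"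
  shows "weak_conv_m (\<lambda>n. distr P borel (T n)) \<mu>"
proof -
  interpret prob_space P by fact
  have cdf: "cdf (distr P borel (X n)) t = prob {\<omega> \<in> space P. X n \<omega> \<le> t}"
    if [measurable]: "X n \<in> borel_measurable P" for X :: "nat \<Rightarrow> 'a \<Rightarrow> real" and n t
    unfolding cdf_def2 by (subst measure_distr) (auto intro!: arg_cong[where f="measure P"])
  have convA: "(\<lambda>n. prob {\<omega> \<in> space P. A n \<omega> \<le> t}) \<longlonglongrightarrow> cdf \<mu> t" for t
    using conv cont[of t] unfolding weak_conv_m_def weak_conv_def by (simp add: cdf)
  have "(\<lambda>n. prob {\<omega> \<in> space P. T n \<omega> \<le> t}) \<longlonglongrightarrow> cdf \<mu> t" for t
  proof (rule LIMSEQ_I)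
    fix \<delta> :: real assume \<delta>: "\<delta> > 0"
    obtain \<epsilon> where \<epsilon>: "\<epsilon> > 0" and e: "\<And>y. \<bar>y - t\<bar> < 2 * \<epsilon> \<Longrightarrow> \<bar>cdf \<mu> y - cdf \<mu> t\<bar> < \<delta> / 3"
    proof -
      have "\<delta> / 3 > 0" using \<delta> by simp
      with cont[of t, unfolded continuous_at_eps_delta] have "\<exists>d>0. \<forall>y. dist y t < d \<longrightarrow> dist (cdf \<mu> y) (cdf \<mu> t) < \<delta> / 3"
        by blast
      then obtain d where "d > 0" "\<And>y. \<bar>y - t\<bar> < d \<Longrightarrow> \<bar>cdf \<mu> y - cdf \<mu> t\<bar> < \<delta> / 3"
        by (auto simp: dist_real_def)
      then show ?thesis using that[of "d / 2"] by simp
    qed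
    define B where "B n = {\<omega> \<in> space P. \<bar>T n \<omega> - A n \<omega>\<bar> > \<epsilon>}" for n
    have [measurable]: "B n \<in> sets P" for n unfolding B_def by measurable
    have "\<forall>\<^sub>F n in sequentially. dist (prob (B n)) 0 < \<delta> / 3"
      using diff[OF \<epsilon>] \<delta> unfolding B_def by (intro tendstoD) auto
    moreover have "\<forall>\<^sub>F n in sequentially. dist (prob {\<omega> \<in> space P. A n \<omega> \<le> t + \<epsilon>}) (cdf \<mu> (t + \<epsilon>)) < \<delta> / 3"
      using convA \<delta> by (intro tendstoD) auto
    moreover have "\<forall>\<^sub>F n in sequentially. dist (prob {\<omega> \<in> space P. A n \<omega> \<le> t - \<epsilon>}) (cdf \<mu> (t - \<epsilon>)) < \<delta> / 3"
      using convA \<delta> by (intro tendstoD) auto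
    ultimately have "\<forall>\<^sub>F n in sequentially. norm (prob {\<omega> \<in> space P. T n \<omega> \<le> t} - cdf \<mu> t) < \<delta>"
    proof eventually_elim
      fix n
      assume 1: "dist (prob (B n)) 0 < \<delta> / 3"
        "dist (prob {\<omega> \<in> space P. A n \<omega> \<le> t + \<epsilon>}) (cdf \<mu> (t + \<epsilon>)) < \<delta> / 3"
        "dist (prob {\<omega> \<in> space P. A n \<omega> \<le> t - \<epsilon>}) (cdf \<mu> (t - \<epsilon>)) < \<delta> / 3"
      have "prob {\<omega> \<in> space P. T n \<omega> \<le> t} \<le> prob ({\<omega> \<in> space P. A n \<omega> \<le> t + \<epsilon>} \<union> B n)"
        by (intro finite_measure_mono) (auto simp: B_def)
      also have "\<dots> \<le> prob {\<omega> \<in> space P. A n \<omega> \<le> t + \<epsilon>} + prob (B n)"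
        by (intro measure_Un_le) auto
      finally have up: "prob {\<omega> \<in> space P. T n \<omega> \<le> t} \<le> prob {\<omega> \<in> space P. A n \<omega> \<le> t + \<epsilon>} + prob (B n)" .
      have "prob {\<omega> \<in> space P. A n \<omega> \<le> t - \<epsilon>} \<le> prob ({\<omega> \<in> space P. T n \<omega> \<le> t} \<union> B n)"
        by (intro finite_measure_mono) (auto simp: B_def)
      also have "\<dots> \<le> prob {\<omega> \<in> space P. T n \<omega> \<le> t} + prob (B n)"
        by (intro measure_Un_le) auto
      finally have lo: "prob {\<omega> \<in> space P. A n \<omega> \<le> t - \<epsilon>} \<le> prob {\<omega> \<in> space P. T n \<omega> \<le> t} + prob (B n)" .
      show "norm (prob {\<omega> \<in> space P. T n \<omega> \<le> t} - cdf \<mu> t) < \<delta>"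
        using up lo 1 e[of "t + \<epsilon>"] e[of "t - \<epsilon>"] \<epsilon> unfolding dist_real_def real_norm_def by linarith
    qed
    then show "\<exists>no. \<forall>n\<ge>no. norm (prob {\<omega> \<in> space P. T n \<omega> \<le> t} - cdf \<mu> t) < \<delta>"
      by (simp add: eventually_sequentially)
  qed
  then show ?thesis unfolding weak_conv_m_def weak_conv_def by (simp add: cdf)
qed

section \<open>Sums over an infinite sequence of independent p-Gaussians\<close>

abbreviation p_gaussian_seq :: "real \<Rightarrow> (nat \<Rightarrow> real) measure" where
  "p_gaussian_seq p \<equiv> PiM UNIV (\<lambda>_. p_gaussian p)"

lemma distr_p_gaussian_coord:
  assumes p: "p > 0"
  shows "distr (p_gaussian_seq p) borel (\<lambda>\<omega>. \<omega> i) = p_gaussian p"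
proof -
  have "distr (p_gaussian_seq p) borel (\<lambda>\<omega>. \<omega> i) = distr (p_gaussian_seq p) (p_gaussian p) (\<lambda>\<omega>. \<omega> i)"
    by (intro distr_cong) auto
  also have "\<dots> = p_gaussian p"
    by (rule distr_PiM_component) (use p prob_space_p_gaussian in auto)
  finally show ?thesis .
qed

lemma integral_p_gaussian_coord:
  fixes f :: "real \<Rightarrow> real"
  assumes p: "p > 0" and [measurable]: "f \<in> borel_measurable borel"
  shows "(\<integral>\<omega>. f (\<omega> i) \<partial>p_gaussian_seq p) = (\<integral>x. f x \<partial>p_gaussian p)"
    "integrable (p_gaussian_seq p) (\<lambda>\<omega>. f (\<omega> i)) \<longleftrightarrow> integrable (p_gaussian p) f"
proof -
  have [measurable]: "(\<lambda>\<omega>. \<omega> i) \<in> measurable (p_gaussian_seq p) borel"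
    by simp
  have "(\<integral>x. f x \<partial>distr (p_gaussian_seq p) borel (\<lambda>\<omega>. \<omega> i)) = (\<integral>\<omega>. f (\<omega> i) \<partial>p_gaussian_seq p)"
    by (rule integral_distr) auto
  then show "(\<integral>\<omega>. f (\<omega> i) \<partial>p_gaussian_seq p) = (\<integral>x. f x \<partial>p_gaussian p)"
    unfolding distr_p_gaussian_coord[OF p] ..
  have "integrable (distr (p_gaussian_seq p) borel (\<lambda>\<omega>. \<omega> i)) f \<longleftrightarrow> integrable (p_gaussian_seq p) (\<lambda>\<omega>. f (\<omega> i))"
    by (rule integrable_distr_eq) auto
  then show "integrable (p_gaussian_seq p) (\<lambda>\<omega>. f (\<omega> i)) \<longleftrightarrow> integrable (p_gaussian p) f"
    unfolding distr_p_gaussian_coord[OF p] ..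
qed

text \<open>The joint law of the coordinates, the law of the identity map, is the product of their
  individual laws; this characterizes independence.\<close>

lemma indep_vars_p_gaussian_coords:
  assumes p: "p > 0" and [measurable]: "f \<in> borel_measurable borel"
  shows "prob_space.indep_vars (p_gaussian_seq p) (\<lambda>_. borel) (\<lambda>i \<omega>. f (\<omega> i) :: real) UNIV"
proof -
  interpret prob_space "p_gaussian_seq p" by (rule prob_space_p_gaussian_vec[OF p])
  have "distr (p_gaussian_seq p) (\<Pi>\<^sub>M i\<in>UNIV. borel) (\<lambda>\<omega>. \<lambda>i\<in>UNIV. \<omega> i) = distr (p_gaussian_seq p) (p_gaussian_seq p) (\<lambda>\<omega>. \<omega>)"
    by (intro distr_cong) auto
  also have "\<dots> = (\<Pi>\<^sub>M i\<in>UNIV. distr (p_gaussian_seq p) borel (\<lambda>\<omega>. \<omega> i))"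
    by (simp add: distr_id distr_p_gaussian_coord[OF p])
  finally have "indep_vars (\<lambda>_. borel) (\<lambda>i \<omega>. \<omega> i) UNIV"
    by (subst indep_vars_iff_distr_eq_PiM) auto
  then show ?thesis by (rule indep_vars_compose2) auto
qed

text \<open>In the induction the new term is independent of the previous sum and has mean zero, so
  the cross term integrates to 0.\<close>

lemma second_moment_sum_coords:
  fixes f :: "real \<Rightarrow> real"
  assumes p: "p > 0" and f [measurable]: "f \<in> borel_measurable borel"
    and sq: "integrable (p_gaussian p) (\<lambda>x. (f x)\<^sup>2)" and mean: "(\<integral>x. f x \<partial>p_gaussian p) = 0"
  shows "integrable (p_gaussian_seq p) (\<lambda>\<omega>. (\<Sum>i<n. f (\<omega> i))\<^sup>2)"
    "(\<integral>\<omega>. (\<Sum>i<n. f (\<omega> i))\<^sup>2 \<partial>p_gaussian_seq p) = n * (\<integral>x. (f x)\<^sup>2 \<partial>p_gaussian p)"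
proof -
  interpret prob_space "p_gaussian_seq p" by (rule prob_space_p_gaussian_vec[OF p])
  interpret G: prob_space "p_gaussian p" by (rule prob_space_p_gaussian[OF p])
  have int: "integrable (p_gaussian p) f"
    by (rule G.square_integrable_imp_integrable[OF _ sq]) auto
  have "integrable (p_gaussian_seq p) (\<lambda>\<omega>. (\<Sum>i<n. f (\<omega> i))\<^sup>2) \<and>
    (\<integral>\<omega>. (\<Sum>i<n. f (\<omega> i))\<^sup>2 \<partial>p_gaussian_seq p) = n * (\<integral>x. (f x)\<^sup>2 \<partial>p_gaussian p)"
  proof (induction n)
    case (Suc n)
    let ?S = "\<lambda>\<omega>. \<Sum>i<n. f (\<omega> i)"
    have ind: "indep_var borel (\<lambda>\<omega>. f (\<omega> n)) borel ?S"
      by (rule indep_vars_sum[where X="\<lambda>i \<omega>. f (\<omega> i)"])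
         (auto intro!: indep_vars_subset[OF indep_vars_p_gaussian_coords[OF p f]])
    have i1: "integrable (p_gaussian_seq p) (\<lambda>\<omega>. f (\<omega> i))" for i
      using int by (subst integral_p_gaussian_coord(2)[OF p]) auto
    have i2: "integrable (p_gaussian_seq p) (\<lambda>\<omega>. (f (\<omega> i))\<^sup>2)" for i
      using sq by (subst integral_p_gaussian_coord(2)[OF p, of "\<lambda>x. (f x)\<^sup>2"]) auto
    have i3: "integrable (p_gaussian_seq p) ?S" using i1 by auto
    have i4: "integrable (p_gaussian_seq p) (\<lambda>\<omega>. f (\<omega> n) * ?S \<omega>)"
      by (rule indep_var_integrable[OF ind i1 i3])
    have e4: "(\<integral>\<omega>. f (\<omega> n) * ?S \<omega> \<partial>p_gaussian_seq p) = 0"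
      by (subst indep_var_lebesgue_integral[OF ind i1 i3]) (simp add: integral_p_gaussian_coord(1)[OF p f] mean)
    have eq: "(\<Sum>i<Suc n. f (\<omega> i))\<^sup>2 = (?S \<omega>)\<^sup>2 + 2 * (f (\<omega> n) * ?S \<omega>) + (f (\<omega> n))\<^sup>2" for \<omega> :: "nat \<Rightarrow> real"
      by (simp add: power2_eq_square algebra_simps)
    have "(\<integral>\<omega>. (f (\<omega> n))\<^sup>2 \<partial>p_gaussian_seq p) = (\<integral>x. (f x)\<^sup>2 \<partial>p_gaussian p)"
      by (rule integral_p_gaussian_coord(1)[OF p]) simp
    then show ?case
      unfolding eq using Suc i2 i4 e4 by (auto simp: algebra_simps)
  qed simp
  then show "integrable (p_gaussian_seq p) (\<lambda>\<omega>. (\<Sum>i<n. f (\<omega> i))\<^sup>2)"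
    "(\<integral>\<omega>. (\<Sum>i<n. f (\<omega> i))\<^sup>2 \<partial>p_gaussian_seq p) = n * (\<integral>x. (f x)\<^sup>2 \<partial>p_gaussian p)" by auto
qed

text \<open>Chebyshev's inequality. The bound is the same for all \<open>n\<close>, so the
  normalized sums are bounded in probability.\<close>

lemma normalized_sum_tail:
  fixes f :: "real \<Rightarrow> real"
  assumes p: "p > 0" and f [measurable]: "f \<in> borel_measurable borel"
    and sq: "integrable (p_gaussian p) (\<lambda>x. (f x)\<^sup>2)" and mean: "(\<integral>x. f x \<partial>p_gaussian p) = 0"
    and K: "K > 0" and n: "n \<ge> 1"
  shows "measure (p_gaussian_seq p) {\<omega> \<in> space (p_gaussian_seq p). \<bar>(\<Sum>i<n. f (\<omega> i)) / sqrt n\<bar> > K}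
     \<le> (\<integral>x. (f x)\<^sup>2 \<partial>p_gaussian p) / K\<^sup>2"
proof -
  interpret prob_space "p_gaussian_seq p" by (rule prob_space_p_gaussian_vec[OF p])
  let ?S = "\<lambda>\<omega>. \<Sum>i<n. f (\<omega> i)"
  note S = second_moment_sum_coords[OF p f sq mean, of n]
  have eq: "(?S \<omega> / sqrt n)\<^sup>2 = (?S \<omega>)\<^sup>2 / n" for \<omega> :: "nat \<Rightarrow> real" by (simp add: power_divide)
  have "prob {\<omega> \<in> space (p_gaussian_seq p). \<bar>?S \<omega> / sqrt n\<bar> > K} \<le>
      prob {\<omega> \<in> space (p_gaussian_seq p). (?S \<omega> / sqrt n)\<^sup>2 \<ge> K\<^sup>2}"
    using K by (intro finite_measure_mono) (auto intro!: abs_le_square_iff[THEN iffD1])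
  also have "\<dots> \<le> (\<integral>\<omega>. (?S \<omega> / sqrt n)\<^sup>2 \<partial>p_gaussian_seq p) / K\<^sup>2"
    by (rule integral_Markov_inequality_measure[where A="{}"]) (use S K in \<open>auto simp: eq\<close>)
  also have "(\<integral>\<omega>. (?S \<omega> / sqrt n)\<^sup>2 \<partial>p_gaussian_seq p) = (\<integral>x. (f x)\<^sup>2 \<partial>p_gaussian p)"
    unfolding eq using S n by simp
  finally show ?thesis .
qed

lemma integrable_p_gaussian_power2:
  fixes f g :: "real \<Rightarrow> real"
  assumes "p > 0" and [measurable]: "f \<in> borel_measurable borel" "g \<in> borel_measurable borel"
    and "integrable (p_gaussian p) (\<lambda>x. (f x)\<^sup>2)" "integrable (p_gaussian p) (\<lambda>x. (g x)\<^sup>2)"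
  shows "integrable (p_gaussian p) (\<lambda>x. (f x - g x)\<^sup>2)"
proof (rule Bochner_Integration.integrable_bound)
  show "integrable (p_gaussian p) (\<lambda>x. 2 * (f x)\<^sup>2 + 2 * (g x)\<^sup>2)" using assms by auto
  have "(f x - g x)\<^sup>2 \<le> 2 * (f x)\<^sup>2 + 2 * (g x)\<^sup>2" for x
    using zero_le_power2[of "f x + g x"] by (simp add: power2_eq_square algebra_simps)
  then show "AE x in p_gaussian p. norm ((f x - g x)\<^sup>2) \<le> norm (2 * (f x)\<^sup>2 + 2 * (g x)\<^sup>2)"
    by auto
qed measurable

lemma integrable_p_gaussian_abs_powr_squared:
  assumes "p > 0" "a \<ge> 0"
  shows "integrable (p_gaussian p) (\<lambda>x. (\<bar>x\<bar> powr a)\<^sup>2)"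
proof -
  have "(\<bar>x\<bar> powr a)\<^sup>2 = \<bar>x\<bar> powr (2 * a)" for x :: real
    by (simp add: power2_eq_square powr_add[symmetric])
  then show ?thesis using integrable_p_gaussian_abs_powr[of p "2 * a"] assms by simp
qed

lemma integrable_ln_minus_powr_squared:
  assumes p: "p > 0"
  shows "integrable (p_gaussian p) (\<lambda>x. (ln \<bar>x\<bar> - 1 / p * \<bar>x\<bar> powr p)\<^sup>2)"
proof (rule integrable_p_gaussian_power2[OF p])
  have "(\<lambda>x :: real. (1 / p * \<bar>x\<bar> powr p)\<^sup>2) = (\<lambda>x. (1 / p)\<^sup>2 * (\<bar>x\<bar> powr p)\<^sup>2)"
    by (simp add: power_mult_distrib power_divide)
  then show "integrable (p_gaussian p) (\<lambda>x. (1 / p * \<bar>x\<bar> powr p)\<^sup>2)"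
    using integrable_p_gaussian_abs_powr_squared[of p p] p by (simp only:) (intro integrable_mult_right, simp)
qed (use integrable_p_gaussian_ln_squared[OF p] in auto)

text \<open>Zero variance would make \<open>ln \<bar>x\<bar> - \<bar>x\<bar> powr p / p\<close>
  constant almost everywhere. Between 0 and 1 its derivative \<open>1 / t - t powr (p - 1)\<close>
  is positive, so it takes each value at most once there. Positivity permits division by the
  standard deviation in the central limit theorem.\<close>

lemma limit_variance_pos:
  assumes p: "p \<ge> 1"
  shows "limit_variance p > 0"
proof -
  interpret G: prob_space "p_gaussian p" using p by (intro prob_space_p_gaussian) simp
  define f where "f x = ln \<bar>x\<bar> - 1 / p * \<bar>x\<bar> powr p" for x :: real
  define m where "m = (\<integral>x. f x \<partial>p_gaussian p)"
  have [measurable]: "f \<in> borel_measurable borel" unfolding f_def by measurable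
  have var: "limit_variance p = (\<integral>x. (f x - m)\<^sup>2 \<partial>p_gaussian p)"
    by (simp add: limit_variance_def f_def m_def)
  have sq: "integrable (p_gaussian p) (\<lambda>x. (f x - m)\<^sup>2)"
  proof (rule integrable_p_gaussian_power2)
    show "integrable (p_gaussian p) (\<lambda>x. (f x)\<^sup>2)"
      unfolding f_def using p by (intro integrable_ln_minus_powr_squared) simp
  qed (use p in auto)
  have "limit_variance p \<noteq> 0"
  proof
    assume "limit_variance p = 0"
    then have "AE x in p_gaussian p. (f x - m)\<^sup>2 = 0"
      using integral_nonneg_eq_0_iff_AE[OF sq] var by simp
    \<comment> \<open>The p-Gaussian density vanishes nowhere, so the exceptional set is also
      Lebesgue null.\<close>
    then have AE_m: "AE x in lborel. f x = m"
      using p_gaussian_const_pos[of p] p unfolding p_gaussian_eq by (subst (asm) AE_density) auto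
    have inj: "x = y" if "f x = m" "f y = m" "x \<in> {0<..<1}" "y \<in> {0<..<1}" for x y
    proof (rule ccontr)
      assume "x \<noteq> y"
      have *: "f u < f v" if uv: "0 < u" "u < v" "v < 1" for u v
      proof (rule DERIV_pos_imp_increasing[OF uv(2)])
        fix t assume t: "u \<le> t" "t \<le> v"
        then have t01: "0 < t" "t < 1" using uv by auto
        have "((\<lambda>x. ln x - 1 / p * x powr p) has_real_derivative (1 / t - 1 / p * (p * t powr (p - 1)))) (at t)"
          using t01 p by (auto intro!: derivative_eq_intros has_real_derivative_powr simp: divide_inverse)
        moreover have "\<forall>\<^sub>F s in nhds t. f s = ln s - 1 / p * s powr p"
          by (rule eventually_nhds_in_open[of "{0<..}", THEN eventually_mono]) (use t01 in \<open>auto simp: f_def\<close>)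
        ultimately have "(f has_real_derivative (1 / t - 1 / p * (p * t powr (p - 1)))) (at t)"
          by (subst DERIV_cong_ev[OF refl _ refl]) auto
        moreover have "t powr (p - 1) \<le> 1" using t01 p by (intro powr_le1) auto
        moreover have "1 / t > 1" using t01 by simp
        ultimately show "\<exists>y. DERIV f t :> y \<and> y > 0" using p by (intro exI conjI) auto
      qed
      have "x < y \<or> y < x" using \<open>x \<noteq> y\<close> by linarith
      then show False using *[of x y] *[of y x] that by auto
    qed
    \<comment> \<open>The only candidate for a solution in the interval; if there is none, excluding
      an arbitrary point does no harm.\<close>
    define c where "c = (SOME x. x \<in> {0<..<1} \<and> f x = m)"
    have c: "x = c" if "f x = m" "x \<in> {0<..<1}" for x
    proof -
      have "c \<in> {0<..<1} \<and> f c = m" unfolding c_def by (rule someI[of _ x]) (use that in blast)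
      then show ?thesis using inj that by blast
    qed
    have "AE x in lborel. x \<noteq> c" by (rule AE_lborel_singleton)
    with AE_m have "AE x in lborel. x \<notin> {0<..<1::real}"
      by eventually_elim (use c in blast)
    then have "emeasure lborel {0<..<1::real} = 0"
      by (subst (asm) AE_iff_measurable[of "{0<..<1}"]) auto
    then show False by simp
  qed
  moreover have "limit_variance p \<ge> 0" unfolding var by (intro Bochner_Integration.integral_nonneg) auto
  ultimately show ?thesis by simp
qed

text \<open>Division by \<open>\<sigma>\<close> links the limit to the standard normal law, in terms
  of which the central limit theorem is stated. A law with a density has no atoms, whence
  continuity.\<close>

lemma density_normal_cdf:
  assumes \<sigma>: "\<sigma> > 0"
  shows "cdf (density lborel (normal_density 0 \<sigma>)) t = cdf std_normal_distribution (t / \<sigma>)"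
    "isCont (cdf (density lborel (normal_density 0 \<sigma>))) t"
proof -
  let ?N = "density lborel (normal_density 0 \<sigma>)"
  interpret N: prob_space ?N by (rule prob_space_normal_density[OF \<sigma>])
  interpret N: finite_borel_measure ?N by standard simp
  have "measure ?N {t} = 0"
    by (simp add: measure_def emeasure_density nn_integral_indicator_singleton)
  then show "isCont (cdf ?N) t" by (simp add: N.isCont_cdf)
  have "distributed ?N lborel (\<lambda>x. x) (normal_density 0 \<sigma>)"
    by (simp add: distributed_def distr_id2)
  then have "distributed ?N lborel (\<lambda>x. (x - 0) / \<sigma>) std_normal_density"
    by (subst (asm) N.normal_standard_normal_convert[OF \<sigma>])
  then have "distr ?N lborel (\<lambda>x. x / \<sigma>) = std_normal_distribution"
    by (simp add: distributed_def)
  then have "cdf std_normal_distribution (t / \<sigma>) = measure (distr ?N lborel (\<lambda>x. x / \<sigma>)) {..t / \<sigma>}"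
    by (simp add: cdf_def2)
  also have "\<dots> = measure ?N {..t}"
    using \<sigma> by (subst measure_distr) (auto intro!: arg_cong[where f="measure ?N"] simp: field_simps)
  finally show "cdf ?N t = cdf std_normal_distribution (t / \<sigma>)" by (simp add: cdf_def2)
qed

lemma eventually_divide_le:
  fixes c e :: real
  assumes "e > 0"
  shows "\<forall>\<^sub>F n in sequentially. c / sqrt (real n) \<le> e" "\<forall>\<^sub>F n in sequentially. c / real n \<le> e"
proof -
  have "(\<lambda>n. c / sqrt (real n)) \<longlonglongrightarrow> 0" "(\<lambda>n. c / real n) \<longlonglongrightarrow> 0" by real_asymp+
  then show "\<forall>\<^sub>F n in sequentially. c / sqrt (real n) \<le> e" "\<forall>\<^sub>F n in sequentially. c / real n \<le> e"
    using assms by (auto dest!: order_tendstoD(2)[of _ 0 _ e] elim: eventually_mono)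
qed

lemma ratio_fluctuation_measurable [measurable]:
  assumes "{..<n} \<subseteq> I"
  shows "ratio_fluctuation k p n \<in> borel_measurable (PiM I (\<lambda>_. borel))"
proof -
  have [measurable]: "(\<lambda>x. x i) \<in> borel_measurable (PiM I (\<lambda>_. borel))" if "i < n" for i
    using assms that by (intro measurable_component_singleton) auto
  have "(\<lambda>x. \<Prod>i\<in>J. \<bar>x i\<bar> powr p) \<in> borel_measurable (PiM I (\<lambda>_. borel))" if "J \<subseteq> {..<n}" for J
    using that by (intro borel_measurable_prod) auto
  then have [measurable]: "(\<lambda>x. \<Sum>J\<in>{J. J \<subseteq> {..<n} \<and> card J = m}. \<Prod>i\<in>J. \<bar>x i\<bar> powr p) \<in> borel_measurable (PiM I (\<lambda>_. borel))" for m
    by (intro borel_measurable_sum) auto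
  have "maclaurin_mean n m p \<in> borel_measurable (PiM I (\<lambda>_. borel))" for m
    unfolding maclaurin_mean_def[abs_def] by measurable
  then show ?thesis
    unfolding ratio_fluctuation_def[abs_def] maclaurin_ratio_def[abs_def] by measurable
qed

text \<open>The hypotheses of \<open>ratio_fluctuation_approx\<close> fail with probability at most
  a constant over \<open>K\<close>, uniformly in large \<open>n\<close>, and for fixed
  \<open>K\<close> its error tends to 0. The fluctuation is therefore close in probability to the
  sum \<open>A n\<close>, which obeys the classical theorem.\<close>

theorem ratio_fluctuation_CLT:
  assumes k: "k \<ge> 1" and p: "p \<ge> 1"
  shows "weak_conv_m (\<lambda>n. distr (p_gaussian_seq p) borel (ratio_fluctuation k p n))
    (density lborel (normal_density 0 (sqrt (limit_variance p))))"
proof -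
  have p0: "p > 0" using p by simp
  interpret P: prob_space "p_gaussian_seq p" by (rule prob_space_p_gaussian_vec[OF p0])
  interpret G: prob_space "p_gaussian p" by (rule prob_space_p_gaussian[OF p0])
  define \<sigma> where "\<sigma> = sqrt (limit_variance p)"
  have \<sigma>: "\<sigma> > 0" "\<sigma>\<^sup>2 = limit_variance p" using limit_variance_pos[OF p] by (auto simp: \<sigma>_def)
  define f where "f x = ln \<bar>x\<bar> - 1 / p * \<bar>x\<bar> powr p" for x :: real
  have f_meas [measurable]: "f \<in> borel_measurable borel" unfolding f_def by measurable
  define m where "m = log_mean p - 1 / p"
  have int_ln: "integrable (p_gaussian p) (\<lambda>x. ln \<bar>x\<bar>)"
    by (rule G.square_integrable_imp_integrable[OF _ integrable_p_gaussian_ln_squared[OF p0]]) auto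
  have int_p: "integrable (p_gaussian p) (\<lambda>x. \<bar>x\<bar> powr p)"
    using integrable_p_gaussian_abs_powr[of p p] p by simp
  have sq_p: "integrable (p_gaussian p) (\<lambda>x. (\<bar>x\<bar> powr p)\<^sup>2)"
    using integrable_p_gaussian_abs_powr_squared[of p p] p by simp
  have mean_f: "(\<integral>x. f x \<partial>p_gaussian p) = m"
    unfolding f_def m_def using int_ln int_p expectation_p_gaussian_abs_powr_p[OF p0]
    by (simp add: log_mean_def)
  have sq_f: "integrable (p_gaussian p) (\<lambda>x. (f x)\<^sup>2)"
    unfolding f_def by (rule integrable_ln_minus_powr_squared[OF p0])
  have sq_fm: "integrable (p_gaussian p) (\<lambda>x. (f x - m)\<^sup>2)"
    by (rule integrable_p_gaussian_power2[OF p0]) (use sq_f in auto)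
  have sq_z: "integrable (p_gaussian p) (\<lambda>x. (\<bar>x\<bar> powr p - 1)\<^sup>2)"
    by (rule integrable_p_gaussian_power2[OF p0]) (use sq_p in auto)
  have mean_fm: "(\<integral>x. f x - m \<partial>p_gaussian p) = 0"
    using mean_f G.square_integrable_imp_integrable[OF _ sq_f] G.prob_space by simp
  have mean_z: "(\<integral>x. \<bar>x\<bar> powr p - 1 \<partial>p_gaussian p) = 0"
    using int_p expectation_p_gaussian_abs_powr_p[OF p0] G.prob_space by simp
  have var_f: "(\<integral>x. (f x - m)\<^sup>2 \<partial>p_gaussian p) = \<sigma>\<^sup>2"
    using mean_f unfolding \<sigma>(2) limit_variance_def f_def by simp

  define A where "A n \<omega> = (\<Sum>i<n. f (\<omega> i) - m) / sqrt n" for n and \<omega> :: "nat \<Rightarrow> real"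
  have [measurable]: "A n \<in> borel_measurable (p_gaussian_seq p)" for n unfolding A_def by measurable
  have [measurable]: "ratio_fluctuation k p n \<in> borel_measurable (p_gaussian_seq p)" for n
    using ratio_fluctuation_measurable[of n UNIV k p]
    by (simp add: measurable_cong_sets[OF sets_p_gaussian_vec refl])

  have clt: "weak_conv_m (\<lambda>n. distr (p_gaussian_seq p) borel (\<lambda>\<omega>. (\<Sum>i<n. f (\<omega> i) - m) / sqrt (n * \<sigma>\<^sup>2))) std_normal_distribution"
  proof (rule P.central_limit_theorem[where X="\<lambda>i \<omega>. f (\<omega> i)" and \<mu>="distr (p_gaussian p) borel f"])
    show "P.indep_vars (\<lambda>i. borel) (\<lambda>i \<omega>. f (\<omega> i)) UNIV" by (rule indep_vars_p_gaussian_coords[OF p0 f_meas])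
    show "\<sigma> > 0" by fact
    fix n
    show "(\<integral>\<omega>. f (\<omega> n) \<partial>p_gaussian_seq p) = m"
      using integral_p_gaussian_coord(1)[OF p0 f_meas, of n] mean_f by simp
    show "integrable (p_gaussian_seq p) (\<lambda>\<omega>. (f (\<omega> n))\<^sup>2)"
      using integral_p_gaussian_coord(2)[OF p0, of "\<lambda>x. (f x)\<^sup>2" n] sq_f by simp
    show "(\<integral>\<omega>. (f (\<omega> n) - (\<integral>\<omega>. f (\<omega> n) \<partial>p_gaussian_seq p))\<^sup>2 \<partial>p_gaussian_seq p) = \<sigma>\<^sup>2"
      using integral_p_gaussian_coord(1)[OF p0, of "\<lambda>x. (f x - m)\<^sup>2" n]
        integral_p_gaussian_coord(1)[OF p0 f_meas, of n] mean_f var_f by simp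
    show "distr (p_gaussian_seq p) borel (\<lambda>\<omega>. f (\<omega> n)) = distr (p_gaussian p) borel f"
      using distr_distr[of f borel borel "\<lambda>\<omega>. \<omega> n" "p_gaussian_seq p"]
      by (simp add: distr_p_gaussian_coord[OF p0] comp_def)
  qed
  have convA: "weak_conv_m (\<lambda>n. distr (p_gaussian_seq p) borel (A n)) (density lborel (normal_density 0 \<sigma>))"
    unfolding weak_conv_m_def weak_conv_def
  proof (intro allI impI)
    fix t
    \<comment> \<open>Normalization by the standard deviation only moves the argument of the
      distribution function from \<open>t\<close> to \<open>t / \<sigma>\<close>.\<close>
    have A_eq: "A n \<omega> \<le> t \<longleftrightarrow> (\<Sum>i<n. f (\<omega> i) - m) / sqrt (n * \<sigma>\<^sup>2) \<le> t / \<sigma>" for n \<omega>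
    proof -
      have "sqrt (n * \<sigma>\<^sup>2) = sqrt n * \<sigma>" using \<sigma>(1) by (simp add: real_sqrt_mult)
      then have "(\<Sum>i<n. f (\<omega> i) - m) / sqrt (n * \<sigma>\<^sup>2) = A n \<omega> / \<sigma>"
        unfolding A_def by (simp only: divide_divide_eq_left)
      then show ?thesis using \<sigma>(1) by (simp add: divide_le_cancel)
    qed
    have "cdf (distr (p_gaussian_seq p) borel (A n)) t =
       cdf (distr (p_gaussian_seq p) borel (\<lambda>\<omega>. (\<Sum>i<n. f (\<omega> i) - m) / sqrt (n * \<sigma>\<^sup>2))) (t / \<sigma>)" for n
    proof -
      have "cdf (distr (p_gaussian_seq p) borel (A n)) t = P.prob {\<omega> \<in> space (p_gaussian_seq p). A n \<omega> \<le> t}"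
        unfolding cdf_def2 by (subst measure_distr) (auto intro!: arg_cong[where f="P.prob"])
      also have "\<dots> = P.prob {\<omega> \<in> space (p_gaussian_seq p). (\<Sum>i<n. f (\<omega> i) - m) / sqrt (n * \<sigma>\<^sup>2) \<le> t / \<sigma>}"
        by (simp only: A_eq)
      also have "\<dots> = cdf (distr (p_gaussian_seq p) borel (\<lambda>\<omega>. (\<Sum>i<n. f (\<omega> i) - m) / sqrt (n * \<sigma>\<^sup>2))) (t / \<sigma>)"
        unfolding cdf_def2 by (subst measure_distr) (auto intro!: arg_cong[where f="P.prob"])
      finally show ?thesis .
    qed
    moreover have "isCont (cdf std_normal_distribution) (t / \<sigma>)"
      using density_normal_cdf(2)[of 1] by simp
    then have "(\<lambda>n. cdf (distr (p_gaussian_seq p) borel (\<lambda>\<omega>. (\<Sum>i<n. f (\<omega> i) - m) / sqrt (n * \<sigma>\<^sup>2))) (t / \<sigma>))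
       \<longlonglongrightarrow> cdf std_normal_distribution (t / \<sigma>)"
      using clt unfolding weak_conv_m_def weak_conv_def by blast
    ultimately show "(\<lambda>n. cdf (distr (p_gaussian_seq p) borel (A n)) t) \<longlonglongrightarrow> cdf (density lborel (normal_density 0 \<sigma>)) t"
      by (simp add: density_normal_cdf(1)[OF \<sigma>(1)])
  qed

  define v where "v = (\<integral>x. (\<bar>x\<bar> powr p - 1)\<^sup>2 \<partial>p_gaussian p)"
  define w where "w = (\<integral>x. (\<bar>x\<bar> powr p)\<^sup>2 \<partial>p_gaussian p)"
  have v0: "v \<ge> 0" and w0: "w \<ge> 0" unfolding v_def w_def by (intro Bochner_Integration.integral_nonneg; simp)+
  \<comment> \<open>The logarithmic expansion requires nonzero coordinates; this holds almost surely
    for all indices at once.\<close>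
  have AE_nz: "AE \<omega> in p_gaussian_seq p. \<forall>i. \<omega> i \<noteq> 0"
    unfolding AE_all_countable
    by (intro allI AE_PiM_component) (use p0 prob_space_p_gaussian AE_p_gaussian_nonzero in auto)

  have "weak_conv_m (\<lambda>n. distr (p_gaussian_seq p) borel (ratio_fluctuation k p n)) (density lborel (normal_density 0 \<sigma>))"
  proof (rule weak_conv_m_Slutsky[OF P.prob_space_axioms _ _ convA])
    fix \<epsilon> :: real assume \<epsilon>: "\<epsilon> > 0"
    show "(\<lambda>n. P.prob {\<omega> \<in> space (p_gaussian_seq p). \<bar>ratio_fluctuation k p n \<omega> - A n \<omega>\<bar> > \<epsilon>}) \<longlonglongrightarrow> 0"
    proof (rule tendstoI)
      fix \<delta> :: real assume \<delta>: "\<delta> > 0"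
      \<comment> \<open>The quotient makes the failure probability
        \<open>(\<sigma>\<^sup>2 + v + w) / K\<close> less than \<open>\<delta>\<close>, strictly
        because of the added 1. Chebyshev gives \<open>1 / K\<^sup>2\<close> for two of the events
        and Markov \<open>1 / K\<close> for the third; \<open>K \<ge> 1\<close> brings them to a
        common form.\<close>
      define K where "K = max 1 ((\<sigma>\<^sup>2 + v + w + 1) / \<delta>)"
      have K: "K \<ge> 1" by (simp add: K_def)
      have "(\<sigma>\<^sup>2 + v + w + 1) / \<delta> \<le> K" by (simp add: K_def)
      then have "\<sigma>\<^sup>2 + v + w + 1 \<le> K * \<delta>" using \<delta> by (simp add: pos_divide_le_eq)
      then have K\<delta>: "(\<sigma>\<^sup>2 + v + w) / K < \<delta>" using K by (simp add: pos_divide_less_eq mult.commute)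
      have K2: "1 / K\<^sup>2 \<le> 1 / K" using K by (simp add: power2_eq_square field_simps)
      define C where "C = 2 * K\<^sup>2 + 8 * real k ^ 2 * K + 2 * real k ^ 2"
      have "\<forall>\<^sub>F n in sequentially. K / sqrt n \<le> 1/2" "\<forall>\<^sub>F n in sequentially. real k ^ 2 * (4 * K) / n \<le> 1/2"
        "\<forall>\<^sub>F n in sequentially. real k ^ 2 / n \<le> 1/2" "\<forall>\<^sub>F n in sequentially. (K + C) / sqrt n \<le> 1"
        "\<forall>\<^sub>F n in sequentially. (C + (K + C)\<^sup>2) / sqrt n \<le> \<epsilon>"
        by (intro eventually_divide_le; use \<epsilon> in simp)+
      moreover have "\<forall>\<^sub>F n in sequentially. n \<ge> k" by (rule eventually_ge_at_top)
      ultimately show "\<forall>\<^sub>F n in sequentially. dist (P.prob {\<omega> \<in> space (p_gaussian_seq p). \<bar>ratio_fluctuation k p n \<omega> - A n \<omega>\<bar> > \<epsilon>}) 0 < \<delta>"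
      proof eventually_elim
        fix n :: nat
        assume n: "K / sqrt n \<le> 1/2" "real k ^ 2 * (4 * K) / n \<le> 1/2" "real k ^ 2 / n \<le> 1/2" "(K + C) / sqrt n \<le> 1"
          "(C + (K + C)\<^sup>2) / sqrt n \<le> \<epsilon>" "n \<ge> k"
        have n1: "n \<ge> 1" using n k by simp
        define B1 where "B1 = {\<omega> \<in> space (p_gaussian_seq p). \<bar>(\<Sum>i<n. f (\<omega> i) - m) / sqrt n\<bar> > K}"
        define B2 where "B2 = {\<omega> \<in> space (p_gaussian_seq p). \<bar>(\<Sum>i<n. \<bar>\<omega> i\<bar> powr p - 1) / sqrt n\<bar> > K}"
        define B3 where "B3 = {\<omega> \<in> space (p_gaussian_seq p). (\<Sum>i<n. (\<bar>\<omega> i\<bar> powr p)\<^sup>2) \<ge> K * n}"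
        have Bm [measurable]: "B1 \<in> sets (p_gaussian_seq p)" "B2 \<in> sets (p_gaussian_seq p)" "B3 \<in> sets (p_gaussian_seq p)"
          unfolding B1_def B2_def B3_def by measurable
        have Bs: "B1 \<union> B2 \<union> B3 \<in> P.events" by measurable
        have B1: "P.prob B1 \<le> \<sigma>\<^sup>2 / K\<^sup>2"
          unfolding B1_def var_f[symmetric] by (rule normalized_sum_tail[OF p0 _ sq_fm mean_fm]) (use K n1 in auto)
        have B2: "P.prob B2 \<le> v / K\<^sup>2"
          unfolding B2_def v_def by (rule normalized_sum_tail[OF p0 _ sq_z mean_z]) (use K n1 in auto)
        have B3: "P.prob B3 \<le> w / K"
        proof -
          have i: "integrable (p_gaussian_seq p) (\<lambda>\<omega>. (\<bar>\<omega> i\<bar> powr p)\<^sup>2)" for i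
            using integral_p_gaussian_coord(2)[OF p0, of "\<lambda>x. (\<bar>x\<bar> powr p)\<^sup>2" i] sq_p by simp
          have "P.prob B3 \<le> (\<integral>\<omega>. (\<Sum>i<n. (\<bar>\<omega> i\<bar> powr p)\<^sup>2) \<partial>p_gaussian_seq p) / (K * n)"
            unfolding B3_def
            by (rule integral_Markov_inequality_measure[where A="{}"]) (use i K n1 in \<open>auto intro!: sum_nonneg\<close>)
          also have "(\<integral>\<omega>. (\<Sum>i<n. (\<bar>\<omega> i\<bar> powr p)\<^sup>2) \<partial>p_gaussian_seq p) = n * w"
            using i integral_p_gaussian_coord(1)[OF p0, of "\<lambda>x. (\<bar>x\<bar> powr p)\<^sup>2"] by (simp add: w_def)
          finally show ?thesis using n1 by (simp add: mult.commute)
        qed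
        have "P.prob {\<omega> \<in> space (p_gaussian_seq p). \<bar>ratio_fluctuation k p n \<omega> - A n \<omega>\<bar> > \<epsilon>} \<le> P.prob (B1 \<union> B2 \<union> B3)"
        proof (rule P.finite_measure_mono_AE)
          show "AE \<omega> in p_gaussian_seq p. \<omega> \<in> {\<omega> \<in> space (p_gaussian_seq p). \<bar>ratio_fluctuation k p n \<omega> - A n \<omega>\<bar> > \<epsilon>} \<longrightarrow> \<omega> \<in> B1 \<union> B2 \<union> B3"
            using AE_nz
          proof eventually_elim
            fix \<omega> :: "nat \<Rightarrow> real" assume nz: "\<forall>i. \<omega> i \<noteq> 0"
            show "\<omega> \<in> {\<omega> \<in> space (p_gaussian_seq p). \<bar>ratio_fluctuation k p n \<omega> - A n \<omega>\<bar> > \<epsilon>} \<longrightarrow> \<omega> \<in> B1 \<union> B2 \<union> B3"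
            proof (intro impI, rule ccontr)
              assume 1: "\<omega> \<in> {\<omega> \<in> space (p_gaussian_seq p). \<bar>ratio_fluctuation k p n \<omega> - A n \<omega>\<bar> > \<epsilon>}" and "\<omega> \<notin> B1 \<union> B2 \<union> B3"
              then have 2: "\<bar>A n \<omega>\<bar> \<le> K" "\<bar>(\<Sum>i<n. \<bar>\<omega> i\<bar> powr p - 1) / sqrt n\<bar> \<le> K" "(\<Sum>i<n. (\<bar>\<omega> i\<bar> powr p)\<^sup>2) \<le> K * n"
                unfolding B1_def B2_def B3_def A_def by auto
              have "sqrt n * ((\<Sum>i<n. \<bar>\<omega> i\<bar> powr p) / n - 1) = (\<Sum>i<n. \<bar>\<omega> i\<bar> powr p - 1) / sqrt n"
              proof -
                have "real n / sqrt n = sqrt n" by (rule real_div_sqrt) simp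
                moreover have "sqrt n / n = 1 / sqrt n" using n1 by (simp add: field_simps)
                moreover have "sqrt n * ((\<Sum>i<n. \<bar>\<omega> i\<bar> powr p) / n - 1) = sqrt n / n * (\<Sum>i<n. \<bar>\<omega> i\<bar> powr p) - sqrt n"
                  by (simp add: right_diff_distrib)
                moreover have "(\<Sum>i<n. \<bar>\<omega> i\<bar> powr p - 1) / sqrt n = 1 / sqrt n * (\<Sum>i<n. \<bar>\<omega> i\<bar> powr p) - n / sqrt n"
                  by (simp add: sum_subtractf diff_divide_distrib)
                ultimately show ?thesis by (simp only:)
              qed
              then have "\<bar>ratio_fluctuation k p n \<omega> - A n \<omega>\<bar> \<le> (C + (K + C)\<^sup>2) / sqrt n"
                using ratio_fluctuation_approx[OF k n(6) p, of \<omega> K] nz K 2 n unfolding A_def f_def m_def C_def by simp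
              then show False using 1 n(5) by simp
            qed
          qed
        qed (rule Bs)
        also have "\<dots> \<le> P.prob B1 + P.prob B2 + P.prob B3"
          by (intro order_trans[OF measure_Un_le] add_mono order_refl) (use Bm in auto)
        also have "\<dots> \<le> \<sigma>\<^sup>2 * (1 / K\<^sup>2) + v * (1 / K\<^sup>2) + w / K" using B1 B2 B3 by simp
        also have "\<dots> \<le> \<sigma>\<^sup>2 * (1 / K) + v * (1 / K) + w / K"
          using K2 v0 by (intro add_mono mult_left_mono) auto
        also have "\<dots> = (\<sigma>\<^sup>2 + v + w) / K" by (simp add: add_divide_distrib)
        also note K\<delta>
        finally show "dist (P.prob {\<omega> \<in> space (p_gaussian_seq p). \<bar>ratio_fluctuation k p n \<omega> - A n \<omega>\<bar> > \<epsilon>}) 0 < \<delta>" by simp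
      qed
    qed
  qed (use density_normal_cdf(2)[OF \<sigma>(1)] in auto)
  then show ?thesis by (simp add: \<sigma>_def)
qed

section \<open>Hausdorff measures\<close>

abbreviation real_vec :: "nat \<Rightarrow> (nat \<Rightarrow> real) set" where
  "real_vec n \<equiv> {..<n} \<rightarrow>\<^sub>E UNIV"

definition euclid_dist :: "nat \<Rightarrow> (nat \<Rightarrow> real) \<Rightarrow> (nat \<Rightarrow> real) \<Rightarrow> real" where
  "euclid_dist n x y = L2_set (\<lambda>i. x i - y i) {..<n}"

lemma euclid_dist_nonneg [simp]: "euclid_dist n x y \<ge> 0"
  by (simp add: euclid_dist_def)

lemma coord_diff_le_euclid_dist: "i < n \<Longrightarrow> \<bar>x i - y i\<bar> \<le> euclid_dist n x y"
  unfolding euclid_dist_def using member_le_L2_set[of "{..<n}" i "\<lambda>i. \<bar>x i - y i\<bar>"]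
  by (simp add: L2_set_def)

lemma euclid_diam_alt: "euclid_diam n U = (SUP x\<in>U. SUP y\<in>U. ennreal (euclid_dist n x y))"
  by (simp add: euclid_diam_def euclid_dist_def)

lemma euclid_dist_le_diam: "x \<in> U \<Longrightarrow> y \<in> U \<Longrightarrow> ennreal (euclid_dist n x y) \<le> euclid_diam n U"
  unfolding euclid_diam_alt by (intro SUP_upper2[of x] SUP_upper) auto

lemma euclid_diam_le: "(\<And>x y. x \<in> U \<Longrightarrow> y \<in> U \<Longrightarrow> ennreal (euclid_dist n x y) \<le> D) \<Longrightarrow> euclid_diam n U \<le> D"
  unfolding euclid_diam_alt by (intro SUP_least) auto

lemma euclid_diam_mono: "U \<subseteq> V \<Longrightarrow> euclid_diam n U \<le> euclid_diam n V"
  by (intro euclid_diam_le euclid_dist_le_diam) auto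

definition diam_power :: "nat \<Rightarrow> nat \<Rightarrow> (nat \<Rightarrow> real) set \<Rightarrow> ennreal" where
  "diam_power n d U = (if U = {} then 0 else euclid_diam n U ^ d)"

lemma diam_power_mono: "U \<subseteq> V \<Longrightarrow> diam_power n d U \<le> diam_power n d V"
  by (auto simp: diam_power_def intro!: power_mono euclid_diam_mono)

definition is_cover :: "nat \<Rightarrow> ennreal \<Rightarrow> (nat \<Rightarrow> real) set \<Rightarrow> (nat \<Rightarrow> (nat \<Rightarrow> real) set) \<Rightarrow> bool" where
  "is_cover n \<delta> A U \<longleftrightarrow> (\<forall>j. U j \<subseteq> real_vec n \<and> euclid_diam n (U j) \<le> \<delta>) \<and> A \<subseteq> (\<Union>j. U j)"

lemma hausdorff_premeasure_alt:
  "hausdorff_premeasure n d \<delta> A = (INF U \<in> Collect (is_cover n \<delta> A). \<Sum>j. diam_power n d (U j))"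
  unfolding hausdorff_premeasure_def diam_power_def is_cover_def ..

lemma hausdorff_premeasure_le: "is_cover n \<delta> A U \<Longrightarrow> hausdorff_premeasure n d \<delta> A \<le> (\<Sum>j. diam_power n d (U j))"
  unfolding hausdorff_premeasure_alt by (rule INF_lower) simp

lemma hausdorff_premeasure_geI:
  "(\<And>U. is_cover n \<delta> A U \<Longrightarrow> b \<le> (\<Sum>j. diam_power n d (U j))) \<Longrightarrow> b \<le> hausdorff_premeasure n d \<delta> A"
  unfolding hausdorff_premeasure_alt by (rule INF_greatest) simp

lemma hausdorff_premeasure_mono:
  assumes "A \<subseteq> B" "\<delta>' \<le> \<delta>"
  shows "hausdorff_premeasure n d \<delta> A \<le> hausdorff_premeasure n d \<delta>' B"
  by (rule hausdorff_premeasure_geI, rule hausdorff_premeasure_le)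
     (use assms in \<open>auto simp: is_cover_def intro: order_trans\<close>)

lemma hausdorff_premeasure_le_measure: "\<delta> > 0 \<Longrightarrow> hausdorff_premeasure n d \<delta> A \<le> hausdorff_measure n d A"
  unfolding hausdorff_measure_def by (rule SUP_upper) simp

lemma hausdorff_measure_leI:
  "(\<And>\<delta>. \<delta> > 0 \<Longrightarrow> hausdorff_premeasure n d \<delta> A \<le> b) \<Longrightarrow> hausdorff_measure n d A \<le> b"
  unfolding hausdorff_measure_def by (rule SUP_least) simp

lemma hausdorff_measure_mono: "A \<subseteq> B \<Longrightarrow> hausdorff_measure n d A \<le> hausdorff_measure n d B"
  by (rule hausdorff_measure_leI, rule order_trans[OF hausdorff_premeasure_mono hausdorff_premeasure_le_measure]) auto

lemma hausdorff_measure_empty [simp]: "hausdorff_measure n d {} = 0"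
proof -
  have "hausdorff_measure n d {} \<le> 0"
  proof (rule hausdorff_measure_leI)
    fix \<delta> :: ennreal
    have "is_cover n \<delta> {} (\<lambda>_. {})" by (simp add: is_cover_def euclid_diam_def)
    from hausdorff_premeasure_le[OF this, of d] show "hausdorff_premeasure n d \<delta> {} \<le> 0"
      by (simp add: diam_power_def)
  qed
  then show ?thesis by simp
qed

text \<open>Covers that are optimal up to \<open>e / 2 ^ Suc i\<close> are merged into one through
  the bijection between pairs and naturals. They exist because each summand is finite, the case of
  an infinite sum being trivial.\<close>

lemma hausdorff_premeasure_countable_subadditive:
  "hausdorff_premeasure n d \<delta> (\<Union>i :: nat. A i) \<le> (\<Sum>i. hausdorff_premeasure n d \<delta> (A i))"
proof (rule ennreal_le_epsilon)
  fix e :: real assume e: "e > 0" and fin: "(\<Sum>i. hausdorff_premeasure n d \<delta> (A i)) < top"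
  let ?h = "\<lambda>i. hausdorff_premeasure n d \<delta> (A i)"
  have "\<exists>U. is_cover n \<delta> (A i) U \<and> (\<Sum>j. diam_power n d (U j)) \<le> ?h i + ennreal (e * (1/2) ^ Suc i)" for i
  proof -
    have "?h i < top" using fin by (metis ennreal_suminf_lessD)
    moreover have "e * (1/2) ^ Suc i > 0" using e by simp
    ultimately have "?h i < ?h i + ennreal (e * (1/2) ^ Suc i)"
      using ennreal_add_left_cancel_less[of "?h i" 0 "ennreal (e * (1/2) ^ Suc i)"] by (simp add: less_top)
    then show ?thesis
      unfolding hausdorff_premeasure_alt INF_less_iff by (auto intro: less_imp_le)
  qed
  then obtain U where U: "\<And>i. is_cover n \<delta> (A i) (U i)"
    "\<And>i. (\<Sum>j. diam_power n d (U i j)) \<le> ?h i + ennreal (e * (1/2) ^ Suc i)" by metis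
  have "is_cover n \<delta> (\<Union>i. A i) (\<lambda>k. U (fst (prod_decode k)) (snd (prod_decode k)))"
    unfolding is_cover_def
  proof (intro conjI allI)
    fix k show "U (fst (prod_decode k)) (snd (prod_decode k)) \<subseteq> real_vec n"
      "euclid_diam n (U (fst (prod_decode k)) (snd (prod_decode k))) \<le> \<delta>"
      using U(1)[of "fst (prod_decode k)"] by (auto simp: is_cover_def)
  next
    show "(\<Union>i. A i) \<subseteq> (\<Union>k. U (fst (prod_decode k)) (snd (prod_decode k)))"
    proof
      fix x assume "x \<in> (\<Union>i. A i)"
      then obtain i j where "x \<in> U i j" using U(1) unfolding is_cover_def by blast
      then have "x \<in> U (fst (prod_decode (prod_encode (i, j)))) (snd (prod_decode (prod_encode (i, j))))" by simp
      then show "x \<in> (\<Union>k. U (fst (prod_decode k)) (snd (prod_decode k)))" by blast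
    qed
  qed
  from hausdorff_premeasure_le[OF this, of d]
  have "hausdorff_premeasure n d \<delta> (\<Union>i. A i) \<le> (\<Sum>k. diam_power n d (U (fst (prod_decode k)) (snd (prod_decode k))))" .
  also have "\<dots> = (\<Sum>k. (\<lambda>(i, j). diam_power n d (U i j)) (prod_decode k))"
    by (simp add: split_beta')
  also have "\<dots> = (\<Sum>i. \<Sum>j. diam_power n d (U i j))"
    by (rule suminf_ennreal_2dimen) simp
  also have "\<dots> \<le> (\<Sum>i. ?h i + ennreal (e * (1/2) ^ Suc i))"
    by (intro suminf_le U) auto
  also have "\<dots> = (\<Sum>i. ?h i) + (\<Sum>i. ennreal (e * (1/2) ^ Suc i))"
    by (rule suminf_add[symmetric]) auto
  also have "(\<Sum>i. ennreal (e * (1/2) ^ Suc i)) = ennreal e"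
  proof -
    have "(\<lambda>i. e * (1/2) ^ Suc i) sums (e * 1)" by (intro sums_mult power_half_series)
    then show ?thesis using e by (intro suminf_ennreal_eq) auto
  qed
  finally show "hausdorff_premeasure n d \<delta> (\<Union>i. A i) \<le> (\<Sum>i. ?h i) + ennreal e" .
qed

lemma hausdorff_measure_countable_subadditive:
  "hausdorff_measure n d (\<Union>i :: nat. A i) \<le> (\<Sum>i. hausdorff_measure n d (A i))"
  by (rule hausdorff_measure_leI, rule order_trans[OF hausdorff_premeasure_countable_subadditive])
     (intro suminf_le hausdorff_premeasure_le_measure; simp)

lemma hausdorff_measure_Un_le: "hausdorff_measure n d (A \<union> B) \<le> hausdorff_measure n d A + hausdorff_measure n d B"
proof -
  define C where "C i = (if i = 0 then A else if i = 1 then B else {})" for i :: nat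
  have "A \<union> B = (\<Union>i. C i)" by (auto simp: C_def split: if_splits)
  then have "hausdorff_measure n d (A \<union> B) \<le> (\<Sum>i. hausdorff_measure n d (C i))"
    using hausdorff_measure_countable_subadditive by simp
  also have "\<dots> = (\<Sum>i\<in>{0, 1}. hausdorff_measure n d (C i))"
    by (rule suminf_finite) (auto simp: C_def)
  finally show ?thesis by (simp add: C_def)
qed

text \<open>A cover of \<open>A\<close> is pushed forward, which enlarges diameters at most by the
  factor \<open>L\<close>. Its members are first cut down to \<open>A\<close>, the set on which
  \<open>f\<close> is Lipschitz.\<close>

lemma hausdorff_measure_Lipschitz_image:
  assumes L: "L > 0" and im: "f ` A \<subseteq> real_vec m"
    and lip: "\<And>x y. x \<in> A \<Longrightarrow> y \<in> A \<Longrightarrow> euclid_dist m (f x) (f y) \<le> L * euclid_dist n x y"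
  shows "hausdorff_measure m d (f ` A) \<le> ennreal (L ^ d) * hausdorff_measure n d A"
proof (rule hausdorff_measure_leI)
  fix \<delta> :: ennreal assume \<delta>: "\<delta> > 0"
  define \<delta>' where "\<delta>' = ennreal (1 / L) * \<delta>"
  have \<delta>': "\<delta>' > 0" using \<delta> L by (simp add: \<delta>'_def ennreal_zero_less_mult_iff)
  have L\<delta>: "ennreal L * \<delta>' = \<delta>"
    using L by (simp add: \<delta>'_def mult.assoc[symmetric] ennreal_mult[symmetric])
  \<comment> \<open>The power of \<open>L\<close> stands on the left so that the right-hand side is
    an infimum over covers of \<open>A\<close>.\<close>
  have "ennreal ((1 / L) ^ d) * hausdorff_premeasure m d \<delta> (f ` A) \<le> hausdorff_premeasure n d \<delta>' A"
  proof (rule hausdorff_premeasure_geI)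
    fix U assume U: "is_cover n \<delta>' A U"
    define V where "V j = f ` (U j \<inter> A)" for j
    have diam: "euclid_diam m (V j) \<le> ennreal L * euclid_diam n (U j)" for j
    proof (rule euclid_diam_le)
      fix u v assume "u \<in> V j" "v \<in> V j"
      then obtain x y where xy: "x \<in> U j \<inter> A" "y \<in> U j \<inter> A" "u = f x" "v = f y" by (auto simp: V_def)
      have "ennreal (euclid_dist m u v) \<le> ennreal (L * euclid_dist n x y)"
        using lip[of x y] xy by (intro ennreal_leI) auto
      also have "\<dots> = ennreal L * ennreal (euclid_dist n x y)" using L by (simp add: ennreal_mult)
      also have "\<dots> \<le> ennreal L * euclid_diam n (U j)"
        using xy by (intro mult_left_mono euclid_dist_le_diam) auto
      finally show "ennreal (euclid_dist m u v) \<le> ennreal L * euclid_diam n (U j)" .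
    qed
    have "is_cover m \<delta> (f ` A) V"
      unfolding is_cover_def
    proof (intro conjI allI)
      show "V j \<subseteq> real_vec m" for j using im by (auto simp: V_def)
      show "euclid_diam m (V j) \<le> \<delta>" for j
      proof -
        have "ennreal L * euclid_diam n (U j) \<le> ennreal L * \<delta>'"
          using U by (intro mult_left_mono) (auto simp: is_cover_def)
        with diam[of j] show ?thesis using L\<delta> by simp
      qed
      show "f ` A \<subseteq> (\<Union>j. V j)" using U unfolding is_cover_def V_def by blast
    qed
    then have "hausdorff_premeasure m d \<delta> (f ` A) \<le> (\<Sum>j. diam_power m d (V j))" by (rule hausdorff_premeasure_le)
    also have "\<dots> \<le> (\<Sum>j. ennreal (L ^ d) * diam_power n d (U j))"
    proof (intro suminf_le)
      fix j
      show "diam_power m d (V j) \<le> ennreal (L ^ d) * diam_power n d (U j)"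
      proof (cases "V j = {}")
        case False
        then have "U j \<noteq> {}" by (auto simp: V_def)
        then show ?thesis
          using False power_mono[OF diam[of j], of d] L
          by (simp add: diam_power_def power_mult_distrib ennreal_power)
      qed (simp add: diam_power_def)
    qed auto
    also have "\<dots> = ennreal (L ^ d) * (\<Sum>j. diam_power n d (U j))" by (rule ennreal_suminf_cmult)
    finally have "ennreal ((1 / L) ^ d) * hausdorff_premeasure m d \<delta> (f ` A) \<le>
       ennreal ((1 / L) ^ d) * (ennreal (L ^ d) * (\<Sum>j. diam_power n d (U j)))"
      by (rule mult_left_mono) simp
    also have "\<dots> = (\<Sum>j. diam_power n d (U j))"
      using L by (simp add: mult.assoc[symmetric] ennreal_mult[symmetric] power_mult_distrib[symmetric])
    finally show "ennreal ((1 / L) ^ d) * hausdorff_premeasure m d \<delta> (f ` A) \<le> (\<Sum>j. diam_power n d (U j))" .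
  qed
  also have "\<dots> \<le> hausdorff_measure n d A" by (rule hausdorff_premeasure_le_measure[OF \<delta>'])
  finally have "ennreal (L ^ d) * (ennreal ((1 / L) ^ d) * hausdorff_premeasure m d \<delta> (f ` A)) \<le> ennreal (L ^ d) * hausdorff_measure n d A"
    by (rule mult_left_mono) simp
  then show "hausdorff_premeasure m d \<delta> (f ` A) \<le> ennreal (L ^ d) * hausdorff_measure n d A"
    using L by (simp add: mult.assoc[symmetric] ennreal_mult[symmetric] power_mult_distrib[symmetric])
qed

text \<open>A set of diameter less than the distance between \<open>A\<close> and \<open>B\<close> meets at most one of them.\<close>

lemma hausdorff_measure_separated:
  assumes t: "t > 0" and sep: "\<And>x y. x \<in> A \<Longrightarrow> y \<in> B \<Longrightarrow> euclid_dist n x y \<ge> t"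
  shows "hausdorff_measure n d A + hausdorff_measure n d B \<le> hausdorff_measure n d (A \<union> B)"
proof -
  \<comment> \<open>Two independent scales, so that the suprema defining the two measures can be
    taken one after the other.\<close>
  have *: "hausdorff_premeasure n d \<delta>1 A + hausdorff_premeasure n d \<delta>2 B \<le> hausdorff_measure n d (A \<union> B)"
    if "\<delta>1 > 0" "\<delta>2 > 0" for \<delta>1 \<delta>2
  proof -
    define \<delta> where "\<delta> = min (min \<delta>1 \<delta>2) (ennreal (t / 2))"
    have \<delta>: "\<delta> > 0" "\<delta> \<le> \<delta>1" "\<delta> \<le> \<delta>2" "\<delta> \<le> ennreal (t / 2)" using that t by (auto simp: \<delta>_def intro: min.coboundedI1)
    have "hausdorff_premeasure n d \<delta>1 A + hausdorff_premeasure n d \<delta>2 B \<le> hausdorff_premeasure n d \<delta> A + hausdorff_premeasure n d \<delta> B"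
      using \<delta> by (intro add_mono hausdorff_premeasure_mono) auto
    also have "\<dots> \<le> hausdorff_premeasure n d \<delta> (A \<union> B)"
    proof (rule hausdorff_premeasure_geI)
      fix U assume U: "is_cover n \<delta> (A \<union> B) U"
      have "is_cover n \<delta> A (\<lambda>j. U j \<inter> A)" "is_cover n \<delta> B (\<lambda>j. U j \<inter> B)"
        using U by (auto simp: is_cover_def intro!: order_trans[OF euclid_diam_mono[of "U _ \<inter> _" "U _"]])
      then have "hausdorff_premeasure n d \<delta> A + hausdorff_premeasure n d \<delta> B \<le>
         (\<Sum>j. diam_power n d (U j \<inter> A)) + (\<Sum>j. diam_power n d (U j \<inter> B))"
        by (intro add_mono hausdorff_premeasure_le)
      also have "\<dots> = (\<Sum>j. diam_power n d (U j \<inter> A) + diam_power n d (U j \<inter> B))"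
        by (rule suminf_add) auto
      also have "\<dots> \<le> (\<Sum>j. diam_power n d (U j))"
      proof (intro suminf_le)
        fix j
        have "U j \<inter> A = {} \<or> U j \<inter> B = {}"
        proof (rule ccontr)
          assume "\<not> ?thesis"
          then obtain x y where xy: "x \<in> U j" "x \<in> A" "y \<in> U j" "y \<in> B" by auto
          have "ennreal t \<le> ennreal (euclid_dist n x y)" using sep xy by (intro ennreal_leI) auto
          also have "\<dots> \<le> euclid_diam n (U j)" using xy by (intro euclid_dist_le_diam) auto
          also have "\<dots> \<le> ennreal (t / 2)" using U \<delta>(4) by (auto simp: is_cover_def intro: order_trans)
          finally show False using t by simp
        qed
        then show "diam_power n d (U j \<inter> A) + diam_power n d (U j \<inter> B) \<le> diam_power n d (U j)"
          by (elim disjE) (auto simp: diam_power_def[of n d "{}"] intro!: diam_power_mono)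
      qed auto
      finally show "hausdorff_premeasure n d \<delta> A + hausdorff_premeasure n d \<delta> B \<le> (\<Sum>j. diam_power n d (U j))" .
    qed
    also have "\<dots> \<le> hausdorff_measure n d (A \<union> B)" by (rule hausdorff_premeasure_le_measure[OF \<delta>(1)])
    finally show ?thesis .
  qed
  have ne: "{0<..} \<noteq> ({} :: ennreal set)" by (metis greaterThan_iff empty_iff zero_less_one)
  have "hausdorff_premeasure n d \<delta>1 A + hausdorff_measure n d B \<le> hausdorff_measure n d (A \<union> B)" if "\<delta>1 > 0" for \<delta>1
  proof -
    have "hausdorff_premeasure n d \<delta>1 A + hausdorff_measure n d B = (SUP \<delta>2\<in>{0<..}. hausdorff_premeasure n d \<delta>1 A + hausdorff_premeasure n d \<delta>2 B)"
      unfolding hausdorff_measure_def by (rule ennreal_SUP_add_right[OF ne])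
    also have "\<dots> \<le> hausdorff_measure n d (A \<union> B)" using * that by (intro SUP_least) auto
    finally show ?thesis .
  qed
  moreover have "hausdorff_measure n d A + hausdorff_measure n d B = (SUP \<delta>1\<in>{0<..}. hausdorff_premeasure n d \<delta>1 A + hausdorff_measure n d B)"
    unfolding hausdorff_measure_def[of n d A] by (rule ennreal_SUP_add_left[OF ne, symmetric])
  ultimately show ?thesis by (auto intro: SUP_least)
qed

text \<open>Caratheodory's argument for metric outer measures. The part above \<open>t\<close> need
  not have positive distance from the part below, but the sets \<open>F k\<close> do. What lies
  between is cut into layers \<open>R j\<close>. Layers of equal parity are separated, so each
  parity sums to at most the measure of \<open>E\<close>, and the tail of a convergent series
  controls what \<open>F k\<close> misses.\<close>

lemma hausdorff_measure_halfspace_split: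
  assumes i: "i < n"
  shows "hausdorff_measure n d {x \<in> E. x i \<le> t} + hausdorff_measure n d {x \<in> E. x i > t} \<le> hausdorff_measure n d E"
proof (cases "hausdorff_measure n d E = top")
  case False
  let ?H = "hausdorff_measure n d"
  define F where "F k = {x \<in> E. x i > t + 1 / Suc k}" for k :: nat
  define R where "R k = {x \<in> E. t + 1 / Suc (Suc k) < x i \<and> x i \<le> t + 1 / Suc k}" for k :: nat
  have sep: "?H A + ?H B \<le> ?H (A \<union> B)" if "s < r" "\<And>x. x \<in> A \<Longrightarrow> x i \<le> s" "\<And>x. x \<in> B \<Longrightarrow> x i \<ge> r" for A B s r
  proof (rule hausdorff_measure_separated)
    fix x y assume "x \<in> A" "y \<in> B"
    with that(2)[of x] that(3)[of y] have "r - s \<le> \<bar>x i - y i\<bar>" by linarith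
    also have "\<dots> \<le> euclid_dist n x y" by (rule coord_diff_le_euclid_dist[OF i])
    finally show "r - s \<le> euclid_dist n x y" .
  qed (use that in simp)
  have F: "?H {x \<in> E. x i \<le> t} + ?H (F k) \<le> ?H E" for k
  proof -
    have "?H {x \<in> E. x i \<le> t} + ?H (F k) \<le> ?H ({x \<in> E. x i \<le> t} \<union> F k)"
      by (rule sep[of t "t + 1 / Suc k"]) (auto simp: F_def)
    also have "\<dots> \<le> ?H E" by (rule hausdorff_measure_mono) (auto simp: F_def)
    finally show ?thesis .
  qed
  \<comment> \<open>\<open>b\<close> selects the parity. Each new layer lies nearer to the level
    \<open>t\<close> than all earlier ones of the same parity, at a positive distance.\<close>
  have part: "(\<Sum>j<m. ?H (R (2 * j + b))) \<le> ?H E" for m b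
  proof -
    have "(\<Sum>j<m. ?H (R (2 * j + b))) \<le> ?H (\<Union>j<m. R (2 * j + b))"
    proof (induction m)
      case (Suc m)
      have "(\<Sum>j<Suc m. ?H (R (2 * j + b))) \<le> ?H (R (2 * m + b)) + ?H (\<Union>j<m. R (2 * j + b))"
        using Suc by (simp add: add.commute add_mono)
      also have "\<dots> \<le> ?H (R (2 * m + b) \<union> (\<Union>j<m. R (2 * j + b)))"
      proof (rule sep)
        \<comment> \<open>The separating level lies between the reciprocals of
          \<open>2 * m + b + 1\<close> and \<open>2 * m + b\<close>; the summand 1/2 avoids division
          by zero for \<open>m = b = 0\<close>.\<close>
        show "t + 1 / Suc (2 * m + b) < t + 1 / (real (2 * m + b) + 1 / 2)"
          by (intro add_strict_left_mono divide_strict_left_mono) auto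
        show "x i \<le> t + 1 / Suc (2 * m + b)" if "x \<in> R (2 * m + b)" for x using that by (simp add: R_def)
        show "x i \<ge> t + 1 / (real (2 * m + b) + 1 / 2)" if x: "x \<in> (\<Union>j<m. R (2 * j + b))" for x
        proof -
          obtain j where j: "j < m" "x \<in> R (2 * j + b)" using x by auto
          then have j2: "x i > t + 1 / Suc (Suc (2 * j + b))" by (simp add: R_def)
          have "1 / (real (2 * m + b) + 1 / 2) \<le> 1 / real (Suc (Suc (2 * j + b)))"
            using j(1) by (intro divide_left_mono) auto
          then show ?thesis using j2 by linarith
        qed
      qed
      also have "R (2 * m + b) \<union> (\<Union>j<m. R (2 * j + b)) = (\<Union>j<Suc m. R (2 * j + b))"
        by (auto simp: lessThan_Suc)
      finally show ?case .
    qed simp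
    also have "\<dots> \<le> ?H E" by (rule hausdorff_measure_mono) (auto simp: R_def)
    finally show ?thesis .
  qed
  have "(\<Sum>j<m. ?H (R j)) \<le> ?H E + ?H E" for m
  proof -
    have "(\<Sum>j<m. ?H (R j)) \<le> (\<Sum>j<2 * m. ?H (R j))"
      by (rule sum_mono2) auto
    also have "\<dots> = (\<Sum>j<m. ?H (R (2 * j + 0))) + (\<Sum>j<m. ?H (R (2 * j + 1)))"
      by (induction m) (auto simp: add_ac)
    also have "\<dots> \<le> ?H E + ?H E" by (intro add_mono part)
    finally show ?thesis .
  qed
  then have "(\<Sum>j. ?H (R j)) \<le> ?H E + ?H E" by (intro suminf_le_const) auto
  then have fin: "(\<Sum>j. ?H (R j)) \<noteq> top" using False by (auto simp: top_unique)
  define r where "r j = enn2real (?H (R j))" for j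
  have r: "?H (R j) = ennreal (r j)" for j
    using fin ennreal_suminf_lessD[of "\<lambda>j. ?H (R j)" top j] by (simp add: r_def less_top)
  have r0: "r j \<ge> 0" for j by (simp add: r_def)
  have sr: "summable r" using fin unfolding r by (intro summable_suminf_not_top r0) auto
  show ?thesis
  proof (rule ennreal_le_epsilon)
    fix e :: real assume e: "e > 0"
    obtain k where "norm (\<Sum>j. r (j + k)) < e"
      using suminf_exist_split[OF e sr] by auto
    moreover have "(\<Sum>j. ?H (R (j + k))) = ennreal (\<Sum>j. r (j + k))"
      unfolding r using sr r0 by (intro suminf_ennreal2) (auto simp: summable_iff_shift)
    ultimately have tail: "(\<Sum>j. ?H (R (j + k))) \<le> ennreal e"
      by (simp add: ennreal_leI abs_less_iff)
    have "{x \<in> E. x i > t} \<subseteq> F k \<union> (\<Union>j. R (j + k))"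
    proof
      fix x assume x: "x \<in> {x \<in> E. x i > t}"
      show "x \<in> F k \<union> (\<Union>j. R (j + k))"
      proof (cases "x \<in> F k")
        case False
        \<comment> \<open>The first \<open>m\<close> with \<open>P m\<close> locates
          \<open>x\<close> in the layer \<open>R (m - 1)\<close>; it exceeds \<open>k\<close>
          because \<open>x\<close> is not in \<open>F k\<close>.\<close>
        define P where "P m \<longleftrightarrow> x i > t + 1 / Suc m" for m :: nat
        obtain m0 where "P m0"
          using x reals_Archimedean[of "x i - t"] by (auto simp: P_def inverse_eq_divide algebra_simps)
        define m where "m = (LEAST m. P m)"
        have Pm: "P m" unfolding m_def by (rule LeastI, fact)
        have "k < m"
        proof (rule ccontr)
          assume "\<not> k < m"
          then have "1 / real (Suc k) \<le> 1 / real (Suc m)" by (intro divide_left_mono) auto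
          then show False using Pm False x by (auto simp: P_def F_def)
        qed
        then obtain m' where m': "m = Suc m'" "k \<le> m'" by (cases m) auto
        have "\<not> P m'" using not_less_Least[of m' P] m' by (simp add: m_def)
        then have "x \<in> R ((m' - k) + k)" using Pm x m' by (auto simp: P_def R_def not_less)
        then show ?thesis by blast
      qed simp
    qed
    then have "?H {x \<in> E. x i > t} \<le> ?H (F k \<union> (\<Union>j. R (j + k)))" by (rule hausdorff_measure_mono)
    also have "\<dots> \<le> ?H (F k) + (\<Sum>j. ?H (R (j + k)))"
      by (rule order_trans[OF hausdorff_measure_Un_le add_left_mono[OF hausdorff_measure_countable_subadditive]])
    also have "\<dots> \<le> ?H (F k) + ennreal e" by (rule add_left_mono[OF tail])
    finally have "?H {x \<in> E. x i \<le> t} + ?H {x \<in> E. x i > t} \<le> (?H {x \<in> E. x i \<le> t} + ?H (F k)) + ennreal e"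
      by (simp add: add.assoc add_left_mono)
    also have "\<dots> \<le> ?H E + ennreal e" by (rule add_right_mono[OF F])
    finally show "?H {x \<in> E. x i \<le> t} + ?H {x \<in> E. x i > t} \<le> ?H E + ennreal e" .
  qed
qed simp

text \<open>Caratheodory's theorem yields a measure on the sets that split every \<open>E\<close>
  additively. These contain the half-spaces \<open>x i \<le> t\<close>, which generate the Borel
  sets.\<close>

lemma measure_space_hausdorff:
  "measure_space (space (borel_vec n)) (sets (borel_vec n)) (hausdorff_measure n d)"
proof -
  let ?\<Omega> = "real_vec n" and ?H = "hausdorff_measure n d"
  have sp: "space (borel_vec n) = ?\<Omega>" by (simp add: space_PiM)
  interpret P: sigma_algebra ?\<Omega> "Pow ?\<Omega>" by (rule sigma_algebra_Pow)
  define L where "L = lambda_system ?\<Omega> (Pow ?\<Omega>) ?H"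
  have oms: "outer_measure_space (Pow ?\<Omega>) ?H"
    by (auto simp: outer_measure_space_def positive_def increasing_def countably_subadditive_def
        intro: hausdorff_measure_mono hausdorff_measure_countable_subadditive)
  have ms: "measure_space ?\<Omega> L ?H"
    unfolding L_def by (rule P.caratheodory_lemma[OF oms])
  interpret L: sigma_algebra ?\<Omega> L using ms by (simp add: measure_space_def)
  have half: "{x \<in> ?\<Omega>. x i \<le> t} \<in> L" if i: "i < n" for i t
    unfolding L_def lambda_system_def
  proof (intro CollectI conjI ballI)
    fix E assume E: "E \<in> Pow ?\<Omega>"
    have eq: "{x \<in> ?\<Omega>. x i \<le> t} \<inter> E = {x \<in> E. x i \<le> t}" "(?\<Omega> - {x \<in> ?\<Omega>. x i \<le> t}) \<inter> E = {x \<in> E. x i > t}"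
      using E by auto
    have "{x \<in> E. x i \<le> t} \<union> {x \<in> E. x i > t} = E" by auto
    then have "?H E \<le> ?H {x \<in> E. x i \<le> t} + ?H {x \<in> E. x i > t}"
      using hausdorff_measure_Un_le[of n d "{x \<in> E. x i \<le> t}" "{x \<in> E. x i > t}"] by simp
    then show "?H ({x \<in> ?\<Omega>. x i \<le> t} \<inter> E) + ?H ((?\<Omega> - {x \<in> ?\<Omega>. x i \<le> t}) \<inter> E) = ?H E"
      unfolding eq using hausdorff_measure_halfspace_split[OF i, of d E t] by (rule antisym[rotated])
  qed auto
  have single: "{x \<in> ?\<Omega>. x i \<in> A} \<in> L" if i: "i < n" and A: "A \<in> sets borel" for i A
  proof -
    have "A \<in> sigma_sets UNIV (range (\<lambda>a::real. {..a}))"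
      using A by (simp add: borel_eq_atMost sets_measure_of)
    then show ?thesis
    proof induction
      case (Basic a)
      then show ?case using half[OF i] by auto
    next
      case Empty
      then show ?case using L.empty_sets by simp
    next
      case (Compl a)
      have "{x \<in> ?\<Omega>. x i \<in> UNIV - a} = ?\<Omega> - {x \<in> ?\<Omega>. x i \<in> a}" by auto
      then show ?case using Compl by (simp add: L.compl_sets)
    next
      case (Union a)
      have "{x \<in> ?\<Omega>. x i \<in> \<Union> (range a)} = (\<Union>j. {x \<in> ?\<Omega>. x i \<in> a j})" by auto
      then show ?case using Union by (simp add: L.countable_UN image_subset_iff)
    qed
  qed
  have "sets (borel_vec n) \<subseteq> L"
    unfolding sets_PiM_single space_borel
    by (rule L.sigma_sets_subset) (auto intro: single)
  then show ?thesis
    unfolding sp by (intro measure_down[OF ms]) (use sets.sigma_algebra_axioms[of "borel_vec n"] in \<open>simp_all add: space_PiM\<close>)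
qed

definition hausdorff_borel :: "nat \<Rightarrow> nat \<Rightarrow> (nat \<Rightarrow> real) measure" where
  "hausdorff_borel n d = measure_of (space (borel_vec n)) (sets (borel_vec n)) (hausdorff_measure n d)"

lemma sets_hausdorff_borel [simp, measurable_cong]: "sets (hausdorff_borel n d) = sets (borel_vec n)"
  by (simp add: hausdorff_borel_def)

lemma space_hausdorff_borel [simp]: "space (hausdorff_borel n d) = space (borel_vec n)"
  by (simp add: hausdorff_borel_def space_measure_of_conv)

lemma emeasure_hausdorff_borel:
  "A \<in> sets (borel_vec n) \<Longrightarrow> emeasure (hausdorff_borel n d) A = hausdorff_measure n d A"
  unfolding hausdorff_borel_def
  by (subst emeasure_measure_of_conv) (simp add: sets.sigma_sets_eq measure_space_hausdorff)

section \<open>Hausdorff measure of full dimension\<close>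

definition unit_cube :: "nat \<Rightarrow> (nat \<Rightarrow> real) set" where
  "unit_cube n = Pi\<^sub>E {..<n} (\<lambda>_. {0..<1})"

lemma unit_cube_sets [measurable]: "unit_cube n \<in> sets (borel_vec n)"
  unfolding unit_cube_def by (rule sets_PiM_I_finite) auto

lemma emeasure_unit_cube: "emeasure (lborel_vec n) (unit_cube n) = 1"
  unfolding unit_cube_def by (subst lborel_PiM.emeasure_PiM) auto

lemma euclid_dist_le_sum: "euclid_dist n x y \<le> (\<Sum>i<n. \<bar>x i - y i\<bar>)"
  unfolding euclid_dist_def by (rule L2_set_le_sum_abs)

text \<open>A grid of \<open>N ^ n\<close> cubes of diameter at most \<open>n / N\<close> gives the
  sum \<open>n ^ n\<close>, whatever the fineness. This finiteness is the source of the
  sigma-finiteness that Fubini requires.\<close>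

lemma hausdorff_measure_unit_cube: "hausdorff_measure n n (unit_cube n) < top"
proof -
  have "hausdorff_measure n n (unit_cube n) \<le> ennreal (real n ^ n)"
  proof (rule hausdorff_measure_leI)
    fix \<delta> :: ennreal assume \<delta>: "\<delta> > 0"
    obtain e where e: "e > 0" "ennreal e \<le> \<delta>"
    proof (cases \<delta> rule: ennreal_cases)
      case (real r)
      then show ?thesis using that[of r] \<delta> by auto
    next
      case top
      then show ?thesis using that[of 1] by auto
    qed
    obtain N :: nat where N: "real n / e < real N" using reals_Archimedean2 by blast
    have "real n / e \<ge> 0" using e by simp
    then have N0: "N > 0" using N by (cases N) auto
    have nN: "real n / real N \<le> e" using N N0 e by (simp add: field_simps)
    define K where "K = Pi\<^sub>E {..<n} (\<lambda>_. {..<N})"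
    have K: "finite K" "card K = N ^ n" unfolding K_def by (auto simp: finite_PiE card_PiE)
    obtain g where g: "bij_betw g {0..<N ^ n} K" using ex_bij_betw_nat_finite[OF K(1)] K(2) by auto
    define c where "c k = {x \<in> real_vec n. \<forall>i<n. real (k i) / N \<le> x i \<and> x i \<le> (real (k i) + 1) / N}" for k :: "nat \<Rightarrow> nat"
    define U where "U j = (if j < N ^ n then c (g j) else {})" for j
    have diam_c: "euclid_diam n (c k) \<le> ennreal (real n / N)" for k
    proof (rule euclid_diam_le)
      fix x y assume xy: "x \<in> c k" "y \<in> c k"
      have "euclid_dist n x y \<le> (\<Sum>i<n. \<bar>x i - y i\<bar>)" by (rule euclid_dist_le_sum)
      also have "\<dots> \<le> (\<Sum>i<n. 1 / real N)"
      proof (rule sum_mono)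
        fix i assume "i \<in> {..<n}"
        then have "real (k i) / N \<le> x i" "x i \<le> real (k i) / N + 1 / N" "real (k i) / N \<le> y i" "y i \<le> real (k i) / N + 1 / N"
          using xy by (auto simp: c_def add_divide_distrib)
        then show "\<bar>x i - y i\<bar> \<le> 1 / real N" by linarith
      qed
      finally show "ennreal (euclid_dist n x y) \<le> ennreal (real n / N)" by (intro ennreal_leI) simp
    qed
    have "is_cover n \<delta> (unit_cube n) U"
      unfolding is_cover_def
    proof (intro conjI allI)
      fix j
      show "U j \<subseteq> real_vec n" by (auto simp: U_def c_def)
      have "euclid_diam n (U j) \<le> ennreal (real n / N)"
        using diam_c by (auto simp: U_def euclid_diam_def bot_ennreal)
      also have "\<dots> \<le> ennreal e" using nN by (rule ennreal_leI)
      finally show "euclid_diam n (U j) \<le> \<delta>" using e(2) by (rule order_trans)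
    next
      show "unit_cube n \<subseteq> (\<Union>j. U j)"
      proof
        fix x assume x: "x \<in> unit_cube n"
        define k where "k = (\<lambda>i\<in>{..<n}. nat \<lfloor>real N * x i\<rfloor>)"
        have ki: "real (k i) \<le> real N * x i \<and> real N * x i < real (k i) + 1 \<and> k i < N" if i: "i < n" for i
        proof -
          have x01: "0 \<le> x i" "x i < 1" using x i by (auto simp: unit_cube_def PiE_iff)
          then have nn: "\<lfloor>real N * x i\<rfloor> \<ge> 0" by simp
          have "real N * x i < real N * 1" using x01 N0 by (intro mult_strict_left_mono) auto
          then have "\<lfloor>real N * x i\<rfloor> < int N" by (simp add: floor_less_iff)
          with nn i show ?thesis by (simp add: k_def nat_less_iff)
        qed
        have "k \<in> K" using ki by (auto simp: K_def k_def PiE_iff)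
        then obtain j where j: "j < N ^ n" "g j = k" using g by (auto simp: bij_betw_def)
        have "x \<in> c k"
          using ki N0 x by (auto simp: c_def unit_cube_def PiE_iff field_simps less_imp_le)
        then have "x \<in> U j" using j by (simp add: U_def)
        then show "x \<in> (\<Union>j. U j)" by blast
      qed
    qed
    then have "hausdorff_premeasure n n \<delta> (unit_cube n) \<le> (\<Sum>j. diam_power n n (U j))" by (rule hausdorff_premeasure_le)
    also have "\<dots> = (\<Sum>j<N ^ n. diam_power n n (U j))"
      by (rule suminf_finite) (auto simp: U_def diam_power_def)
    also have "\<dots> \<le> (\<Sum>j<N ^ n. ennreal ((real n / N) ^ n))"
    proof (rule sum_mono)
      fix j
      have "diam_power n n (c (g j)) \<le> ennreal (real n / N) ^ n"
        unfolding diam_power_def using power_mono[OF diam_c[of "g j"], of n] by auto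
      then show "diam_power n n (U j) \<le> ennreal ((real n / N) ^ n)"
        by (auto simp: U_def ennreal_power diam_power_def[of n n "{}"])
    qed
    also have "\<dots> = ennreal (real (N ^ n) * (real n / N) ^ n)"
      by (simp add: ennreal_mult ennreal_of_nat_eq_real_of_nat)
    also have "real (N ^ n) * (real n / N) ^ n = real n ^ n" using N0 by (simp add: power_divide)
    finally show "hausdorff_premeasure n n \<delta> (unit_cube n) \<le> ennreal (real n ^ n)" .
  qed
  then show ?thesis by (rule order_le_less_trans) simp
qed

lemma euclid_dist_affine_vec: "euclid_dist n (affine_vec n 1 v x) (affine_vec n 1 v y) = euclid_dist n x y"
  unfolding euclid_dist_def by (rule L2_set_cong) (auto simp: affine_vec_def)

lemma hausdorff_measure_translate:
  "hausdorff_measure n d (affine_vec n 1 v ` A) \<le> hausdorff_measure n d A"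
proof -
  have "hausdorff_measure n d (affine_vec n 1 v ` A) \<le> ennreal (1 ^ d) * hausdorff_measure n d A"
  proof (rule hausdorff_measure_Lipschitz_image)
    show "affine_vec n 1 v ` A \<subseteq> real_vec n" by (rule image_subsetI) (rule affine_vec_PiE)
  qed (simp_all add: euclid_dist_affine_vec)
  then show ?thesis by simp
qed

text \<open>The inverse of a translation is a translation, so the inequality of
  \<open>hausdorff_measure_translate\<close> works in both directions.\<close>

lemma distr_hausdorff_translate:
  "distr (hausdorff_borel n d) (borel_vec n) (affine_vec n 1 v) = hausdorff_borel n d"
proof (rule measure_eqI)
  fix A assume "A \<in> sets (distr (hausdorff_borel n d) (borel_vec n) (affine_vec n 1 v))"
  then have A: "A \<in> sets (borel_vec n)" by simp
  let ?T = "affine_vec n 1 v" and ?T' = "affine_vec n 1 (\<lambda>i. - v i)"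
  let ?P = "?T -` A \<inter> space (borel_vec n)"
  have sub: "A \<subseteq> space (borel_vec n)" using A by (rule sets.sets_into_space)
  have "?P = ?T' ` A"
  proof (intro equalityI subsetI)
    fix x assume "x \<in> ?P"
    then show "x \<in> ?T' ` A" using affine_vec_inverse[of x n v] by (metis Int_iff image_eqI vimageE)
  next
    fix x assume "x \<in> ?T' ` A"
    then show "x \<in> ?P" using affine_vec_inverse'[of _ n v] sub by auto
  qed
  then have 1: "hausdorff_measure n d ?P \<le> hausdorff_measure n d A" by (simp add: hausdorff_measure_translate)
  have "A = ?T ` ?P"
  proof (intro equalityI subsetI)
    fix x assume "x \<in> A"
    then have "?T (?T' x) = x" "?T' x \<in> ?P" using affine_vec_inverse'[of x n v] sub by auto
    then show "x \<in> ?T ` ?P" by (metis image_eqI)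
  qed auto
  then have 2: "hausdorff_measure n d A \<le> hausdorff_measure n d ?P" by (metis hausdorff_measure_translate)
  have P: "?P \<in> sets (borel_vec n)" using A by simp
  have "emeasure (distr (hausdorff_borel n d) (borel_vec n) ?T) A = emeasure (hausdorff_borel n d) ?P"
    using A by (subst emeasure_distr) auto
  then show "emeasure (distr (hausdorff_borel n d) (borel_vec n) ?T) A = emeasure (hausdorff_borel n d) A"
    using 1 2 A P by (simp add: emeasure_hausdorff_borel)
qed simp

text \<open>Countably many integer translates of the unit cube cover the space, all of the same
  finite measure.\<close>

lemma sigma_finite_hausdorff_borel: "sigma_finite_measure (hausdorff_borel n n)"
proof
  define K where "K = Pi\<^sub>E {..<n} (\<lambda>_. \<int> :: real set)"
  have "countable (\<int> :: real set)" unfolding Ints_def by simp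
  then have K: "countable K" unfolding K_def by (intro countable_PiE) auto
  define C where "C v = affine_vec n 1 (\<lambda>i. - v i) -` unit_cube n \<inter> space (borel_vec n)" for v
  have C: "C v \<in> sets (borel_vec n)" for v unfolding C_def by measurable
  have "emeasure (hausdorff_borel n n) (C v) \<noteq> \<infinity>" for v
  proof -
    have "emeasure (hausdorff_borel n n) (C v) = emeasure (distr (hausdorff_borel n n) (borel_vec n) (affine_vec n 1 (\<lambda>i. - v i))) (unit_cube n)"
      by (subst emeasure_distr) (auto simp: C_def)
    also have "\<dots> = hausdorff_measure n n (unit_cube n)"
      by (simp add: distr_hausdorff_translate emeasure_hausdorff_borel)
    finally show ?thesis using hausdorff_measure_unit_cube[of n] by simp
  qed
  moreover have "(\<Union>v\<in>K. C v) = space (borel_vec n)"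
  proof (intro equalityI subsetI)
    fix x assume x: "x \<in> space (borel_vec n)"
    define v where "v = (\<lambda>i\<in>{..<n}. of_int \<lfloor>x i\<rfloor> :: real)"
    have "v \<in> K" by (auto simp: K_def v_def)
    moreover have "x \<in> C v"
    proof -
      have "0 \<le> x i - v i \<and> x i - v i < 1" if "i < n" for i
        using that by (simp add: v_def) linarith
      then show ?thesis using x by (auto simp: C_def unit_cube_def affine_vec_def PiE_iff)
    qed
    ultimately show "x \<in> (\<Union>v\<in>K. C v)" by blast
  qed (auto simp: C_def)
  ultimately show "\<exists>A. countable A \<and> A \<subseteq> sets (hausdorff_borel n n) \<and> \<Union> A = space (hausdorff_borel n n) \<and> (\<forall>a\<in>A. emeasure (hausdorff_borel n n) a \<noteq> \<infinity>)"
    using K C by (intro exI[of _ "C ` K"]) auto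
qed

text \<open>Uniqueness of Haar measure: both sides below are evaluations of
  \<open>\<integral>\<integral> 1\<^sub>B(x) 1\<^sub>Q(x + y) dy dh(x)\<close>.\<close>

lemma hausdorff_measure_eq_lborel:
  assumes B: "B \<in> sets (borel_vec n)"
  shows "hausdorff_measure n n B = hausdorff_measure n n (unit_cube n) * emeasure (lborel_vec n) B"
proof -
  let ?h = "hausdorff_borel n n" and ?l = "lborel_vec n" and ?Q = "unit_cube n"
  interpret h: sigma_finite_measure ?h by (rule sigma_finite_hausdorff_borel)
  interpret l: sigma_finite_measure ?l by (rule sigma_finite_lborel_vec) simp
  have P: "pair_sigma_finite ?h ?l" "pair_sigma_finite ?l ?h"
    by (intro pair_sigma_finite.intro h.sigma_finite_measure_axioms l.sigma_finite_measure_axioms)+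
  have [measurable]: "B \<in> sets (borel_vec n)" by (rule B)
  have [measurable_cong]: "sets (?h \<Otimes>\<^sub>M ?l) = sets (borel_vec n \<Otimes>\<^sub>M borel_vec n)" "sets (?l \<Otimes>\<^sub>M ?h) = sets (borel_vec n \<Otimes>\<^sub>M borel_vec n)"
    by (intro sets_pair_measure_cong sets_lborel_vec sets_hausdorff_borel)+
  have l_inv: "(\<integral>\<^sup>+y. indicator A (affine_vec n s v y) \<partial>?l) = emeasure ?l A"
    if "\<bar>s\<bar> = 1" "A \<in> sets (borel_vec n)" for A s v
    using that by (subst nn_integral_affine_vec) (auto simp: sets_lborel_vec)
  have h_inv: "(\<integral>\<^sup>+x. G (affine_vec n 1 v x) \<partial>?h) = (\<integral>\<^sup>+x. G x \<partial>?h)"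
    if [measurable]: "G \<in> borel_measurable (borel_vec n)" for G v
  proof -
    have "(\<integral>\<^sup>+x. G x \<partial>distr ?h (borel_vec n) (affine_vec n 1 v)) = (\<integral>\<^sup>+x. G (affine_vec n 1 v x) \<partial>?h)"
      by (rule nn_integral_distr) auto
    then show ?thesis by (simp add: distr_hausdorff_translate)
  qed
  have "emeasure ?h B = (\<integral>\<^sup>+x. indicator B x * emeasure ?l ?Q \<partial>?h)"
    by (simp add: emeasure_unit_cube nn_integral_indicator)
  also have "\<dots> = (\<integral>\<^sup>+x. (\<integral>\<^sup>+y. indicator B x * indicator ?Q (affine_vec n 1 x y) \<partial>?l) \<partial>?h)"
  proof (rule nn_integral_cong)
    fix x :: "nat \<Rightarrow> real"
    have "(\<integral>\<^sup>+y. indicator B x * indicator ?Q (affine_vec n 1 x y) \<partial>?l) = indicator B x * (\<integral>\<^sup>+y. indicator ?Q (affine_vec n 1 x y) \<partial>?l)"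
      by (rule nn_integral_cmult) simp
    then show "indicator B x * emeasure ?l ?Q = (\<integral>\<^sup>+y. indicator B x * indicator ?Q (affine_vec n 1 x y) \<partial>?l)"
      by (simp add: l_inv)
  qed
  also have "\<dots> = (\<integral>\<^sup>+y. (\<integral>\<^sup>+x. indicator B x * indicator ?Q (affine_vec n 1 x y) \<partial>?h) \<partial>?l)"
    by (rule pair_sigma_finite.Fubini'[OF P(2)]) (simp add: split_beta')
  \<comment> \<open>Translating \<open>x\<close> by \<open>y\<close> preserves the Hausdorff measure
    and turns the first factor into the indicator of \<open>B\<close> at \<open>x - y\<close>,
    encoded as \<open>affine_vec n (-1) x y\<close>.\<close>
  also have "\<dots> = (\<integral>\<^sup>+y. (\<integral>\<^sup>+x. indicator B (affine_vec n (-1) x y) * indicator ?Q x \<partial>?h) \<partial>?l)"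
  proof (rule nn_integral_cong)
    fix y assume y: "y \<in> space ?l"
    have *: "affine_vec n 1 (\<lambda>i. - y i) x = affine_vec n (-1) x y" for x by (auto simp: affine_vec_def)
    have "(\<integral>\<^sup>+x. indicator B x * indicator ?Q (affine_vec n 1 x y) \<partial>?h) =
        (\<integral>\<^sup>+x. indicator B (affine_vec n 1 (\<lambda>i. - y i) (affine_vec n 1 y x)) * indicator ?Q (affine_vec n 1 y x) \<partial>?h)"
    proof (rule nn_integral_cong)
      fix x assume "x \<in> space ?h"
      moreover have "affine_vec n 1 x y = affine_vec n 1 y x" by (auto simp: affine_vec_def add.commute)
      ultimately show "indicator B x * indicator ?Q (affine_vec n 1 x y) =
         indicator B (affine_vec n 1 (\<lambda>i. - y i) (affine_vec n 1 y x)) * (indicator ?Q (affine_vec n 1 y x) :: ennreal)"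
        by (simp add: affine_vec_inverse)
    qed
    also have "\<dots> = (\<integral>\<^sup>+x. indicator B (affine_vec n 1 (\<lambda>i. - y i) x) * indicator ?Q x \<partial>?h)"
      by (rule h_inv) simp
    finally show "(\<integral>\<^sup>+x. indicator B x * indicator ?Q (affine_vec n 1 x y) \<partial>?h) =
       (\<integral>\<^sup>+x. indicator B (affine_vec n (-1) x y) * indicator ?Q x \<partial>?h)" by (simp only: *)
  qed
  \<comment> \<open>For fixed \<open>x\<close> the map from \<open>y\<close> to \<open>x - y\<close>
    preserves Lebesgue measure, so the inner integral no longer depends on \<open>x\<close> except
    through the cube.\<close>
  also have "\<dots> = (\<integral>\<^sup>+x. (\<integral>\<^sup>+y. indicator B (affine_vec n (-1) x y) * indicator ?Q x \<partial>?l) \<partial>?h)"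
    by (rule pair_sigma_finite.Fubini'[OF P(1)]) (simp add: split_beta')
  also have "\<dots> = (\<integral>\<^sup>+x. indicator ?Q x * emeasure ?l B \<partial>?h)"
  proof (rule nn_integral_cong)
    fix x :: "nat \<Rightarrow> real"
    have "(\<integral>\<^sup>+y. indicator B (affine_vec n (-1) x y) * indicator ?Q x \<partial>?l) = (\<integral>\<^sup>+y. indicator B (affine_vec n (-1) x y) \<partial>?l) * indicator ?Q x"
      by (rule nn_integral_multc) simp
    then show "(\<integral>\<^sup>+y. indicator B (affine_vec n (-1) x y) * indicator ?Q x \<partial>?l) = indicator ?Q x * emeasure ?l B"
      by (simp add: l_inv mult.commute)
  qed
  also have "\<dots> = emeasure ?h ?Q * emeasure ?l B"
    by (simp add: nn_integral_multc)
  finally show ?thesis by (simp add: emeasure_hausdorff_borel)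
qed

section \<open>Jacobians of shears and rank-one updates\<close>

lemma nn_integral_shear:
  fixes F :: "(nat \<Rightarrow> real) \<Rightarrow> ennreal"
  assumes m: "m < n" and F [measurable]: "F \<in> borel_measurable (borel_vec n)"
  shows "(\<integral>\<^sup>+x. F (\<lambda>i\<in>{..<n}. if i = m then x i else x i + c i * x m) \<partial>lborel_vec n) = (\<integral>\<^sup>+x. F x \<partial>lborel_vec n)"
proof -
  \<comment> \<open>Coordinates below \<open>j\<close> are already sheared. Coordinate
    \<open>m\<close> never changes, so each step adds a quantity independent of the coordinate being
    changed.\<close>
  have "j \<le> n \<Longrightarrow> (\<integral>\<^sup>+x. F (\<lambda>i\<in>{..<n}. if i < j \<and> i \<noteq> m then x i + c i * x m else x i) \<partial>lborel_vec n) = (\<integral>\<^sup>+x. F x \<partial>lborel_vec n)" for j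
  proof (induction j)
    case 0
    have "(\<lambda>i\<in>{..<n}. x i) = x" if "x \<in> space (lborel_vec n)" for x :: "nat \<Rightarrow> real"
      using that by (auto simp: space_PiM PiE_def extensional_def)
    then show ?case by (simp cong: nn_integral_cong_simp)
  next
    case (Suc j)
    show ?case
    proof (cases "j = m")
      case True
      then have E: "(\<lambda>i\<in>{..<n}. if i < Suc j \<and> i \<noteq> m then x i + c i * x m else x i) = (\<lambda>i\<in>{..<n}. if i < j \<and> i \<noteq> m then x i + c i * x m else x i)"
        for x :: "nat \<Rightarrow> real" by (auto simp: restrict_def less_Suc_eq)
      show ?thesis unfolding E by (rule Suc.IH) (use Suc.prems in simp)
    next
      case False
      define G where "G x = F (\<lambda>i\<in>{..<n}. if i < j \<and> i \<noteq> m then x i + c i * x m else x i)" for x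
      have [measurable]: "(\<lambda>x. x m) \<in> borel_measurable (borel_vec n)" using m by simp
      have [measurable]: "G \<in> borel_measurable (borel_vec n)"
        unfolding G_def by measurable
      have "(\<integral>\<^sup>+x. F (\<lambda>i\<in>{..<n}. if i < Suc j \<and> i \<noteq> m then x i + c i * x m else x i) \<partial>lborel_vec n) =
        (\<integral>\<^sup>+x. G (x(j := 1 * x j + c j * x m)) \<partial>lborel_vec n)"
        unfolding G_def using False by (intro nn_integral_cong arg_cong[where f=F]) (auto simp: restrict_def)
      also have "\<dots> = ennreal (1 / \<bar>1\<bar>) * (\<integral>\<^sup>+x. G x \<partial>lborel_vec n)"
        by (rule nn_integral_PiM_affine_coordinate) (use Suc False in auto)
      also have "(\<integral>\<^sup>+x. G x \<partial>lborel_vec n) = (\<integral>\<^sup>+x. F x \<partial>lborel_vec n)"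
        unfolding G_def by (rule Suc.IH) (use Suc.prems in simp)
      finally show ?thesis by simp
    qed
  qed
  note * = this[of n, OF order.refl]
  have E: "(\<lambda>i\<in>{..<n}. if i = m then x i else x i + c i * x m) = (\<lambda>i\<in>{..<n}. if i < n \<and> i \<noteq> m then x i + c i * x m else x i)"
    for x :: "nat \<Rightarrow> real" by (intro restrict_ext) auto
  show ?thesis unfolding E by (rule *)
qed

text \<open>The map \<open>x \<mapsto> x + \<langle>v, x\<rangle> w\<close> is conjugate, by a shear sending \<open>w\<close> to a multiple of a basis vector,
  to a map that changes only one coordinate.\<close>

lemma nn_integral_rank_one_update:
  fixes F :: "(nat \<Rightarrow> real) \<Rightarrow> ennreal" and v w :: "nat \<Rightarrow> real"
  assumes m: "m < n" "w m \<noteq> 0" and F [measurable]: "F \<in> borel_measurable (borel_vec n)"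
  defines "s \<equiv> 1 + (\<Sum>j<n. v j * w j)"
  assumes s: "s \<noteq> 0"
  shows "(\<integral>\<^sup>+x. F (\<lambda>i\<in>{..<n}. x i + (\<Sum>j<n. v j * x j) * w i) \<partial>lborel_vec n) = ennreal (1 / \<bar>s\<bar>) * (\<integral>\<^sup>+x. F x \<partial>lborel_vec n)"
proof -
  define c where "c i = w i / w m" for i
  \<comment> \<open>In sheared coordinates only coordinate \<open>m\<close> changes: it is
    multiplied by \<open>s\<close>, the determinant of the map, and shifted by \<open>h\<close>,
    which involves the other coordinates.\<close>
  define h where "h x = w m * (\<Sum>j\<in>{..<n} - {m}. v j * x j)" for x :: "nat \<Rightarrow> real"
  define P where "P a x = (\<lambda>i\<in>{..<n}. if i = m then x i else x i + (a * c i) * x m)" for a :: real and x :: "nat \<Rightarrow> real"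
  have xm [measurable]: "(\<lambda>x. x m) \<in> borel_measurable (borel_vec n)" using m by simp
  have P_meas [measurable]: "P a \<in> measurable (borel_vec n) (borel_vec n)" for a
    unfolding P_def[abs_def] by measurable
  have h_meas [measurable]: "h \<in> borel_measurable (borel_vec n)" unfolding h_def by measurable
  have D_meas [measurable]: "(\<lambda>x. x(m := s * x m + h x)) \<in> measurable (borel_vec n) (borel_vec n)"
    by (rule measurable_fun_upd[where J="{..<n}"]) (use m in auto)
  have key: "(\<lambda>i\<in>{..<n}. x i + (\<Sum>j<n. v j * x j) * w i) = P 1 ((P (-1) x)(m := s * P (-1) x m + h (P (-1) x)))" for x :: "nat \<Rightarrow> real"
  proof -
    define S where "S = (\<Sum>j<n. v j * x j)"
    define A where "A = (\<Sum>j\<in>{..<n} - {m}. v j * x j)"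
    define Bc where "Bc = (\<Sum>j\<in>{..<n} - {m}. v j * c j)"
    have S: "S = v m * x m + A" unfolding S_def A_def using m by (simp add: sum.remove)
    have "(\<Sum>j<n. v j * w j) = v m * w m + (\<Sum>j\<in>{..<n} - {m}. v j * w j)" using m by (simp add: sum.remove)
    also have "(\<Sum>j\<in>{..<n} - {m}. v j * w j) = Bc * w m"
      unfolding Bc_def sum_distrib_right using m by (intro sum.cong) (auto simp: c_def)
    finally have s_eq: "s = 1 + v m * w m + Bc * w m" by (simp add: s_def)
    have "h (P (-1) x) = w m * (\<Sum>j\<in>{..<n} - {m}. v j * x j - v j * c j * x m)"
      unfolding h_def by (intro arg_cong2[where f="(*)"] sum.cong refl) (auto simp: P_def algebra_simps)
    also have "\<dots> = w m * (A - Bc * x m)" by (simp add: sum_subtractf A_def Bc_def sum_distrib_right)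
    finally have hP: "h (P (-1) x) = w m * (A - Bc * x m)" .
    have Pm: "P (-1) x m = x m" using m by (simp add: P_def)
    have "s * P (-1) x m + h (P (-1) x) = x m + S * w m"
      unfolding hP Pm s_eq S by (simp add: algebra_simps)
    then have "P 1 ((P (-1) x)(m := s * P (-1) x m + h (P (-1) x))) i = (\<lambda>i\<in>{..<n}. x i + S * w i) i" for i
      using m by (auto simp: P_def c_def field_simps)
    then show ?thesis unfolding S_def by (simp add: fun_eq_iff)
  qed
  have shear: "(\<integral>\<^sup>+x. G (P a x) \<partial>lborel_vec n) = (\<integral>\<^sup>+x. G x \<partial>lborel_vec n)"
    if "G \<in> borel_measurable (borel_vec n)" for G a
    unfolding P_def by (rule nn_integral_shear[OF m(1) that])
  define G where "G x = F (P 1 (x(m := s * x m + h x)))" for x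
  have [measurable]: "G \<in> borel_measurable (borel_vec n)" unfolding G_def by measurable
  have "(\<integral>\<^sup>+x. F (\<lambda>i\<in>{..<n}. x i + (\<Sum>j<n. v j * x j) * w i) \<partial>lborel_vec n) = (\<integral>\<^sup>+x. G (P (-1) x) \<partial>lborel_vec n)"
    unfolding key G_def ..
  also have "\<dots> = (\<integral>\<^sup>+x. G x \<partial>lborel_vec n)" by (rule shear) simp
  also have "\<dots> = ennreal (1 / \<bar>s\<bar>) * (\<integral>\<^sup>+x. F (P 1 x) \<partial>lborel_vec n)"
    unfolding G_def by (rule nn_integral_PiM_affine_coordinate) (use m s in \<open>auto simp: h_def\<close>)
  also have "(\<integral>\<^sup>+x. F (P 1 x) \<partial>lborel_vec n) = (\<integral>\<^sup>+x. F x \<partial>lborel_vec n)" by (rule shear) simp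
  finally show ?thesis .
qed

section \<open>Charts of the sphere\<close>

definition lp_proj :: "nat \<Rightarrow> real \<Rightarrow> (nat \<Rightarrow> real) \<Rightarrow> nat \<Rightarrow> real" where
  "lp_proj n p x = scale_vec n (1 / lp_norm n p x) x"

definition lp_weight :: "nat \<Rightarrow> real \<Rightarrow> (nat \<Rightarrow> real) \<Rightarrow> real" where
  "lp_weight n p x = sqrt (\<Sum>i<n. \<bar>x i\<bar> powr (2 * p - 2))"

text \<open>At a point of the sphere with nonzero coordinates this is the gradient of the
  p-norm.\<close>

definition lp_grad :: "real \<Rightarrow> (nat \<Rightarrow> real) \<Rightarrow> nat \<Rightarrow> real" where
  "lp_grad p a i = \<bar>a i\<bar> powr (p - 1) * sgn (a i)"

text \<open>The cone measure with density \<open>lp_weight\<close>, up to a constant factor. Taking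
  the weight at \<open>x\<close> and not at its projection keeps the product of the first two
  factors homogeneous of degree \<open>p - 1\<close>, as the p-Gaussian comparison demands; after
  radial integration only the constant is affected.\<close>

definition cone_weight :: "nat \<Rightarrow> real \<Rightarrow> (nat \<Rightarrow> real) set \<Rightarrow> ennreal" where
  "cone_weight n p A = (\<integral>\<^sup>+x. indicator A (lp_proj n p x) * ennreal (lp_weight n p x) * indicator (lp_ball n p) x \<partial>lborel_vec n)"

lemma lp_proj_measurable [measurable]: "lp_proj n p \<in> measurable (borel_vec n) (borel_vec n)"
  unfolding lp_proj_def[abs_def] by measurable

lemma lp_weight_measurable [measurable]: "lp_weight n p \<in> borel_measurable (borel_vec n)"
  unfolding lp_weight_def[abs_def] by measurable

lemma lp_weight_nonneg [simp]: "lp_weight n p x \<ge> 0"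
  by (simp add: lp_weight_def sum_nonneg)

lemma lp_weight_scale_vec:
  assumes "s > 0"
  shows "lp_weight n p (scale_vec n s x) = s powr (p - 1) * lp_weight n p x"
proof -
  have "(\<Sum>i<n. \<bar>scale_vec n s x i\<bar> powr (2 * p - 2)) = s powr (2 * p - 2) * (\<Sum>i<n. \<bar>x i\<bar> powr (2 * p - 2))"
    using assms by (simp add: scale_vec_apply abs_mult powr_mult sum_distrib_left)
  moreover have "s powr (2 * p - 2) = (s powr (p - 1))\<^sup>2"
    by (simp add: power2_eq_square powr_add[symmetric])
  ultimately show ?thesis by (simp add: lp_weight_def real_sqrt_mult)
qed

lemma lp_proj_scale_vec:
  assumes "s > 0" "p > 0"
  shows "lp_proj n p (scale_vec n s x) = lp_proj n p x"
  using assms by (simp add: lp_proj_def lp_norm_scale_vec)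

text \<open>Where the norm is 0, division by zero makes the projection the zero vector, which is not
  on the sphere.\<close>

lemma lp_proj_in_sphere:
  assumes p: "p > 0" and x: "lp_proj n p x \<in> lp_sphere n p" "x \<in> space (borel_vec n)"
  shows "lp_norm n p x > 0" "x = scale_vec n (lp_norm n p x) (lp_proj n p x)"
proof -
  have "lp_norm n p (lp_proj n p x) = 1" using x by (simp add: lp_sphere_def)
  then have "lp_norm n p x \<noteq> 0" using p by (auto simp: lp_proj_def lp_norm_scale_vec)
  then show "lp_norm n p x > 0" using lp_norm_nonneg[of n p x] by linarith
  then show "x = scale_vec n (lp_norm n p x) (lp_proj n p x)" using x by (simp add: lp_proj_def)
qed

text \<open>For a unit vector \<open>w\<close>, the reflection in the hyperplane orthogonal to
  \<open>w\<close>, written as a rank-one update so that \<open>nn_integral_rank_one_update\<close>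
  applies.\<close>

definition householder :: "nat \<Rightarrow> (nat \<Rightarrow> real) \<Rightarrow> (nat \<Rightarrow> real) \<Rightarrow> nat \<Rightarrow> real" where
  "householder n w x = (\<lambda>i\<in>{..<n}. x i + (\<Sum>j<n. (- 2 * w j) * x j) * w i)"

lemma householder_measurable [measurable]:
  "householder n w \<in> measurable (borel_vec n) (borel_vec n)"
  unfolding householder_def[abs_def] by measurable

lemma householder_space [simp]: "householder n w x \<in> space (borel_vec n)"
  by (simp add: householder_def space_PiM)

lemma nn_integral_householder:
  assumes w: "(\<Sum>i<n. (w i)\<^sup>2) = 1" and F: "F \<in> borel_measurable (borel_vec n)"
  shows "(\<integral>\<^sup>+x. F (householder n w x) \<partial>lborel_vec n) = (\<integral>\<^sup>+x. F x \<partial>lborel_vec n)"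
proof -
  obtain m where m: "m < n" "w m \<noteq> 0"
  proof (rule ccontr)
    assume "\<not> thesis"
    then have "\<forall>m<n. w m = 0" using that by auto
    then show False using w by simp
  qed
  have "(\<Sum>j<n. (- 2 * w j) * w j) = - 2 * (\<Sum>j<n. (w j)\<^sup>2)"
    by (simp add: sum_distrib_left power2_eq_square mult.assoc)
  then have s: "1 + (\<Sum>j<n. (- 2 * w j) * w j) = -1" using w by simp
  show ?thesis
    unfolding householder_def
    using nn_integral_rank_one_update[where w=w and v="\<lambda>j. - 2 * w j", OF m(1) m(2) F] unfolding s by simp
qed

lemma euclid_dist_householder:
  assumes w: "(\<Sum>i<n. (w i)\<^sup>2) = 1"
  shows "euclid_dist n (householder n w x) (householder n w y) = euclid_dist n x y"
proof -
  define z where "z i = x i - y i" for i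
  define t where "t = (\<Sum>j<n. w j * z j)"
  have "(\<Sum>i<n. (householder n w x i - householder n w y i)\<^sup>2) = (\<Sum>i<n. (z i - 2 * t * w i)\<^sup>2)"
  proof (rule sum.cong[OF refl])
    fix i assume i: "i \<in> {..<n}"
    have "(\<Sum>j<n. (- 2 * w j) * x j) - (\<Sum>j<n. (- 2 * w j) * y j) = - 2 * t"
      unfolding t_def z_def by (simp add: sum_subtractf[symmetric] sum_distrib_left algebra_simps)
    then have "householder n w x i - householder n w y i = z i + (- 2 * t) * w i"
      using i by (simp add: householder_def z_def) (simp only: left_diff_distrib[symmetric])
    then show "(householder n w x i - householder n w y i)\<^sup>2 = (z i - 2 * t * w i)\<^sup>2" by simp
  qed
  also have "\<dots> = (\<Sum>i<n. (z i)\<^sup>2 - 4 * t * (w i * z i) + 4 * t\<^sup>2 * (w i)\<^sup>2)"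
    by (intro sum.cong) (auto simp: power2_eq_square algebra_simps)
  also have "\<dots> = (\<Sum>i<n. (z i)\<^sup>2) - 4 * t * t + 4 * t\<^sup>2 * (\<Sum>i<n. (w i)\<^sup>2)"
    by (simp add: sum.distrib sum_subtractf sum_distrib_left[symmetric] t_def)
  also have "\<dots> = (\<Sum>i<n. (z i)\<^sup>2)" unfolding w by (simp add: power2_eq_square)
  finally show ?thesis unfolding euclid_dist_def L2_set_def by (simp only: z_def)
qed

lemma householder_involution:
  assumes w: "(\<Sum>i<n. (w i)\<^sup>2) = 1" and x: "x \<in> space (borel_vec n)"
  shows "householder n w (householder n w x) = x"
proof -
  define t where "t = (\<Sum>j<n. (- 2 * w j) * x j)"
  have "(\<Sum>j<n. (- 2 * w j) * householder n w x j) = (\<Sum>j<n. (- 2 * w j) * x j + (- 2 * t) * (w j)\<^sup>2)"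
  proof (rule sum.cong[OF refl])
    fix j assume "j \<in> {..<n}"
    then have "householder n w x j = x j + t * w j" by (simp add: householder_def t_def)
    then show "(- 2 * w j) * householder n w x j = (- 2 * w j) * x j + (- 2 * t) * (w j)\<^sup>2"
      by (simp add: power2_eq_square algebra_simps)
  qed
  also have "\<dots> = t + (- 2 * t) * (\<Sum>j<n. (w j)\<^sup>2)" by (simp only: sum.distrib sum_distrib_left[symmetric] t_def)
  finally have *: "(\<Sum>j<n. (- 2 * w j) * householder n w x j) = - t" by (simp add: w)
  show ?thesis
  proof
    fix i show "householder n w (householder n w x) i = x i"
    proof (cases "i < n")
      case True
      have "householder n w (householder n w x) i = householder n w x i - t * w i"
        using True * by (simp add: householder_def[of n w "householder n w x"])
      also have "householder n w x i = x i + t * w i" using True by (simp add: householder_def t_def)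
      finally show ?thesis by simp
    next
      case False
      then show ?thesis using x by (simp add: householder_def space_PiM PiE_def extensional_def)
    qed
  qed
qed

lemma householder_scale_vec: "householder n w (scale_vec n s x) = scale_vec n s (householder n w x)"
proof -
  have "(\<Sum>j<n. (- 2 * w j) * scale_vec n s x j) = s * (\<Sum>j<n. (- 2 * w j) * x j)"
    unfolding sum_distrib_left by (intro sum.cong) (auto simp: scale_vec_def)
  then have "householder n w (scale_vec n s x) i = scale_vec n s (householder n w x) i" for i
    unfolding householder_def by (cases "i < n") (auto simp: scale_vec_apply distrib_left, auto simp: scale_vec_def)
  then show ?thesis by blast
qed

text \<open>The reflection exchanging \<open>g / |g|\<close> with the last basis vector.\<close>

lemma householder_exists:
  fixes g :: "nat \<Rightarrow> real"
  assumes i: "i < d" "g i \<noteq> 0"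
  defines "r \<equiv> sqrt (\<Sum>i<Suc d. (g i)\<^sup>2)"
  obtains w where "(\<Sum>i<Suc d. (w i)\<^sup>2) = 1"
    "\<And>x. householder (Suc d) w x d = (\<Sum>i<Suc d. g i * x i) / r"
proof -
  have r2: "r\<^sup>2 = (\<Sum>i<Suc d. (g i)\<^sup>2)" by (simp add: r_def sum_nonneg)
  \<comment> \<open>A nonzero coordinate before the last one keeps \<open>g / r\<close> different
    from the last basis vector, so their difference can be normalized.\<close>
  have "(g d)\<^sup>2 + (g i)\<^sup>2 \<le> r\<^sup>2"
    using i(1) member_le_sum[of i "{..<d}" "\<lambda>i. (g i)\<^sup>2"] by (simp add: r2)
  moreover have "(g i)\<^sup>2 > 0" using i by simp
  ultimately have "(g d)\<^sup>2 < r\<^sup>2" by linarith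
  moreover have "r \<ge> 0" by (simp add: r_def sum_nonneg)
  ultimately have gd: "\<bar>g d\<bar> < r" by (metis abs_le_square_iff abs_of_nonneg not_le)
  then have r: "r > 0" by linarith
  \<comment> \<open>The squared length of the difference between \<open>g / r\<close> and the last
    basis vector.\<close>
  define N2 where "N2 = 2 - 2 * g d / r"
  have N2: "N2 > 0" using gd r by (simp add: N2_def field_simps)
  define w where "w i = (g i / r - (if i = d then 1 else 0)) / sqrt N2" for i
  have w_lt: "w i = g i / r / sqrt N2" if "i < d" for i using that by (simp add: w_def)
  have "(\<Sum>i<Suc d. (w i)\<^sup>2) = (\<Sum>i<d. (g i)\<^sup>2) / r\<^sup>2 / N2 + (w d)\<^sup>2"
    using N2 by (simp add: w_lt power_divide power_mult_distrib sum_divide_distrib)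
  also have "(\<Sum>i<d. (g i)\<^sup>2) = r\<^sup>2 - (g d)\<^sup>2" by (simp add: r2)
  also have "(w d)\<^sup>2 = (g d / r - 1)\<^sup>2 / N2" using N2 by (simp add: w_def power_divide)
  also have "(r\<^sup>2 - (g d)\<^sup>2) / r\<^sup>2 / N2 + (g d / r - 1)\<^sup>2 / N2 = ((1 - (g d / r)\<^sup>2) + (g d / r - 1)\<^sup>2) / N2"
    using r by (simp add: diff_divide_distrib power_divide add_divide_distrib)
  also have "(1 - (g d / r)\<^sup>2) + (g d / r - 1)\<^sup>2 = N2" by (simp add: N2_def power2_eq_square algebra_simps)
  finally have w1: "(\<Sum>i<Suc d. (w i)\<^sup>2) = 1" using N2 by simp
  have "householder (Suc d) w x d = (\<Sum>i<Suc d. g i * x i) / r" for x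
  proof -
    define l where "l = (\<Sum>i<Suc d. g i * x i) / r"
    have "(\<Sum>j<Suc d. w j * x j) = (\<Sum>j<d. g j * x j) / r / sqrt N2 + (g d / r - 1) * x d / sqrt N2"
      by (simp add: w_lt sum_divide_distrib) (simp add: w_def)
    also have "\<dots> = (l - x d) / sqrt N2"
      unfolding l_def by (simp add: add_divide_distrib diff_divide_distrib left_diff_distrib)
    finally have wx: "(\<Sum>j<Suc d. w j * x j) = (l - x d) / sqrt N2" .
    have "householder (Suc d) w x d = x d + (\<Sum>j<Suc d. (- 2 * w j) * x j) * w d"
      by (simp add: householder_def)
    also have "(\<Sum>j<Suc d. (- 2 * w j) * x j) = - 2 * ((l - x d) / sqrt N2)"
      unfolding wx[symmetric] sum_distrib_left by (intro sum.cong) auto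
    also have "w d = - (N2 / 2) / sqrt N2"
    proof -
      have "w d = (g d / r - 1) / sqrt N2" by (simp add: w_def)
      moreover have "g d / r - 1 = - (N2 / 2)" by (simp add: N2_def diff_divide_distrib)
      ultimately show ?thesis by (simp only:)
    qed
    also have "x d + - 2 * ((l - x d) / sqrt N2) * (- (N2 / 2) / sqrt N2) = x d + (l - x d) * (N2 / (sqrt N2 * sqrt N2))"
    proof -
      have "x d + - 2 * ((l - x d) / q) * (- (N2 / 2) / q) = x d + (l - x d) * (N2 / (q * q))" for q
        by (simp add: divide_simps) (simp add: algebra_simps)
      then show ?thesis .
    qed
    also have "N2 / (sqrt N2 * sqrt N2) = 1" using N2 by simp
    finally show ?thesis by (simp add: l_def)
  qed
  with w1 show ?thesis by (rule that)
qed

text \<open>The chart is central projection to the hyperplane \<open>lin x = 1\<close>, which in the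
  application is tangent to the sphere at the point with gradient \<open>g\<close>. The reflection
  \<open>Q\<close> moves this hyperplane to the set where the last coordinate is
  \<open>1 / r\<close>, parametrized by the first \<open>d\<close> coordinates. How close
  \<open>lin\<close> is to 1 on a given piece of the sphere is left to the hypotheses of the
  lemmas.\<close>

locale sphere_chart =
  fixes d :: nat and p :: real and g w :: "nat \<Rightarrow> real"
  assumes p: "p \<ge> 1"
    and w: "(\<Sum>i<Suc d. (w i)\<^sup>2) = 1"
    and wg: "\<And>x. householder (Suc d) w x d = (\<Sum>i<Suc d. g i * x i) / sqrt (\<Sum>i<Suc d. (g i)\<^sup>2)"
    and g: "(\<Sum>i<Suc d. (g i)\<^sup>2) > 0"
begin

abbreviation "Q \<equiv> householder (Suc d) w"

definition "r = sqrt (\<Sum>i<Suc d. (g i)\<^sup>2)"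

definition "lin x = (\<Sum>i<Suc d. g i * x i)" for x :: "nat \<Rightarrow> real"

definition "chart u = lp_proj (Suc d) p (Q (u(d := 1 / r)))" for u :: "nat \<Rightarrow> real"

definition "chart_dom A = {u \<in> space (borel_vec d). chart u \<in> A}"

definition "tangent_proj x = scale_vec (Suc d) (1 / lin x) x" for x :: "nat \<Rightarrow> real"

lemma r_pos: "r > 0" using g by (simp add: r_def)

lemma Q_last: "Q x d = lin x / r" by (simp add: wg lin_def r_def)

lemma lin_Q: "x \<in> space (borel_vec (Suc d)) \<Longrightarrow> lin (Q x) = r * x d"
  using Q_last[of "Q x"] householder_involution[OF w] r_pos by (simp add: field_simps)

lemma lin_scale_vec: "lin (scale_vec (Suc d) s x) = s * lin x"
  unfolding lin_def sum_distrib_left by (intro sum.cong) (auto simp: scale_vec_def)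

lemma lin_measurable [measurable]: "lin \<in> borel_measurable (borel_vec (Suc d))"
  unfolding lin_def[abs_def] by measurable

lemma fun_upd_measurable_Suc [measurable]:
  "(\<lambda>u. u(d := t)) \<in> measurable (borel_vec d) (borel_vec (Suc d))"
  by (rule measurable_fun_upd[where J="{..<d}"]) (auto simp: lessThan_Suc)

lemma chart_measurable [measurable]: "chart \<in> measurable (borel_vec d) (borel_vec (Suc d))"
  unfolding chart_def[abs_def] by measurable

lemma chart_dom_sets [measurable]: "A \<in> sets (borel_vec (Suc d)) \<Longrightarrow> chart_dom A \<in> sets (borel_vec d)"
  using measurable_sets[OF chart_measurable, of A] by (simp add: chart_dom_def vimage_def Int_def conj_commute)

lemma fun_upd_space: "u \<in> space (borel_vec d) \<Longrightarrow> u(d := t) \<in> space (borel_vec (Suc d))"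
  by (auto simp: space_PiM PiE_def extensional_def)

text \<open>With the truncation \<open>lin x \<le> s\<close> in place of the ball and a power of
  \<open>lin x\<close> in place of the weight, the integral is exact. After reflection the cone is
  sliced at heights \<open>t\<close>; the slice is \<open>r * t\<close> times
  \<open>chart_dom A\<close>, and the resulting power of \<open>r * t\<close> is integrated from 0
  to \<open>s / r\<close>.\<close>

lemma nn_integral_linear_cone:
  assumes A [measurable]: "A \<in> sets (borel_vec (Suc d))" and s: "s > 0"
  shows "(\<integral>\<^sup>+x. indicator A (lp_proj (Suc d) p x) * indicator {0<..s} (lin x) * ennreal (lin x powr (p - 1)) \<partial>lborel_vec (Suc d))
    = emeasure (lborel_vec d) (chart_dom A) * ennreal (1 / r * s powr (p + real d) / (p + real d))"
proof -
  let ?n = "Suc d"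
  define G where "G x = indicator A (lp_proj ?n p x) * indicator {0<..s} (lin x) * ennreal (lin x powr (p - 1))" for x
  have [measurable]: "G \<in> borel_measurable (borel_vec ?n)" unfolding G_def by measurable
  have inner: "(\<integral>\<^sup>+u. G (Q (u(d := t))) \<partial>lborel_vec d) =
      emeasure (lborel_vec d) (chart_dom A) * ennreal (indicator {0..s / r} t * (r powr (p - 1 + d) * t powr (p - 1 + d)))"
    if t: "t \<noteq> 0" for t
  proof -
    have lt: "lin (Q (u(d := t))) = r * t" if "u \<in> space (borel_vec d)" for u
      using lin_Q[OF fun_upd_space[OF that]] by simp
    show ?thesis
    proof (cases "t > 0 \<and> r * t \<le> s")
      case False
      then have "indicator {0<..s} (r * t) = (0::ennreal)" using r_pos by (auto simp: indicator_def zero_less_mult_iff)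
      then have "(\<integral>\<^sup>+u. G (Q (u(d := t))) \<partial>lborel_vec d) = (\<integral>\<^sup>+u. 0 \<partial>lborel_vec d)"
        by (intro nn_integral_cong) (simp add: G_def lt)
      moreover have "t \<notin> {0..s / r}" using False t r_pos by (auto simp: field_simps)
      ultimately show ?thesis by simp
    next
      case True
      then have t0: "t > 0" and ts: "r * t \<le> s" by auto
      define F where "F u = (indicator A (lp_proj ?n p (Q (u(d := t)))) :: ennreal)" for u
      have [measurable]: "F \<in> borel_measurable (borel_vec d)" unfolding F_def by measurable
      have F_scale: "F (scale_vec d (r * t) u) = indicator (chart_dom A) u" if u: "u \<in> space (borel_vec d)" for u
      proof -
        have "(scale_vec d (r * t) u)(d := t) = scale_vec ?n (r * t) (u(d := 1 / r))"
          using r_pos by (auto simp: scale_vec_def restrict_def fun_eq_iff)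
        then have "lp_proj ?n p (Q ((scale_vec d (r * t) u)(d := t))) = chart u"
          using r_pos t0 p by (simp add: householder_scale_vec lp_proj_scale_vec chart_def)
        then show ?thesis using u by (simp add: F_def chart_dom_def indicator_def)
      qed
      have "emeasure (lborel_vec d) (chart_dom A) = (\<integral>\<^sup>+u. indicator (chart_dom A) u \<partial>lborel_vec d)"
        by (simp add: nn_integral_indicator sets_lborel_vec)
      also have "\<dots> = (\<integral>\<^sup>+u. F (scale_vec d (r * t) u) \<partial>lborel_vec d)"
        by (intro nn_integral_cong) (simp add: F_scale)
      also have "\<dots> = ennreal ((1 / (r * t)) ^ d) * (\<integral>\<^sup>+u. F u \<partial>lborel_vec d)"
        using r_pos t0 by (intro nn_integral_scale_vec) auto
      finally have "ennreal ((r * t) ^ d) * emeasure (lborel_vec d) (chart_dom A) = ennreal ((r * t) ^ d * (1 / (r * t)) ^ d) * (\<integral>\<^sup>+u. F u \<partial>lborel_vec d)"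
        using r_pos t0 by (simp add: ennreal_mult mult.assoc)
      also have "(r * t) ^ d * (1 / (r * t)) ^ d = 1" using r_pos t0 by (simp add: power_mult_distrib[symmetric])
      finally have F_int: "(\<integral>\<^sup>+u. F u \<partial>lborel_vec d) = emeasure (lborel_vec d) (chart_dom A) * ennreal ((r * t) ^ d)"
        by (simp add: mult.commute)
      have "(\<integral>\<^sup>+u. G (Q (u(d := t))) \<partial>lborel_vec d) = (\<integral>\<^sup>+u. F u * ennreal ((r * t) powr (p - 1)) \<partial>lborel_vec d)"
        using r_pos t0 ts by (intro nn_integral_cong) (simp add: G_def F_def lt)
      also have "\<dots> = emeasure (lborel_vec d) (chart_dom A) * ennreal ((r * t) ^ d) * ennreal ((r * t) powr (p - 1))"
        by (simp add: nn_integral_multc F_int)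
      also have "\<dots> = emeasure (lborel_vec d) (chart_dom A) * ennreal ((r * t) ^ d * (r * t) powr (p - 1))"
        using r_pos t0 by (simp add: ennreal_mult mult.assoc)
      also have "(r * t) ^ d * (r * t) powr (p - 1) = (r * t) powr (p - 1 + d)"
        using r_pos t0 by (simp add: powr_realpow[symmetric] powr_add[symmetric] add.commute)
      also have "\<dots> = r powr (p - 1 + d) * t powr (p - 1 + d)" using r_pos t0 by (simp add: powr_mult)
      finally have E: "(\<integral>\<^sup>+u. G (Q (u(d := t))) \<partial>lborel_vec d) =
         emeasure (lborel_vec d) (chart_dom A) * ennreal (r powr (p - 1 + d) * t powr (p - 1 + d))" .
      have ind: "indicator {0..s / r} t = (1 :: real)" using ts t0 r_pos by (simp add: indicator_def field_simps)
      show ?thesis unfolding E ind mult_1_left ..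
    qed
  qed
  have "(\<integral>\<^sup>+x. G x \<partial>lborel_vec ?n) = (\<integral>\<^sup>+x. G (Q x) \<partial>lborel_vec ?n)"
    by (rule nn_integral_householder[OF w, symmetric]) simp
  also have "\<dots> = (\<integral>\<^sup>+t. (\<integral>\<^sup>+u. G (Q (u(d := t))) \<partial>lborel_vec d) \<partial>lborel)"
  proof -
    have "(\<lambda>x. G (Q x)) \<in> borel_measurable (borel_vec ?n)" by measurable
    then show ?thesis
      using lborel_PiM.product_nn_integral_insert_rev[of "{..<d}" d "\<lambda>x. G (Q x)"] by (simp add: lessThan_Suc)
  qed
  also have "\<dots> = (\<integral>\<^sup>+t. emeasure (lborel_vec d) (chart_dom A) * ennreal (indicator {0..s / r} t * (r powr (p - 1 + d) * t powr (p - 1 + d))) \<partial>lborel)"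
    by (rule nn_integral_cong_AE, use AE_lborel_singleton[of 0] in eventually_elim) (rule inner)
  also have "\<dots> = emeasure (lborel_vec d) (chart_dom A) * (\<integral>\<^sup>+t. ennreal (indicator {0..s / r} t * (r powr (p - 1 + d) * t powr (p - 1 + d))) \<partial>lborel)"
    by (rule nn_integral_cmult) simp
  also have "(\<integral>\<^sup>+t. ennreal (indicator {0..s / r} t * (r powr (p - 1 + d) * t powr (p - 1 + d))) \<partial>lborel) =
      ennreal (r powr (p - 1 + d) * ((s / r) powr (p - 1 + d + 1) / (p - 1 + d + 1)))"
    by (rule nn_integral_has_integral_lebesgue[OF _ has_integral_mult_right[OF has_integral_powr_from_0]])
       (use p s r_pos in auto)
  also have "r powr (p - 1 + d) * ((s / r) powr (p - 1 + d + 1) / (p - 1 + d + 1)) = 1 / r * s powr (p + d) / (p + d)"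
  proof -
    have e: "p - 1 + d + 1 = p + real d" by simp
    have "r powr (p + d) = r powr (p - 1 + d) * r" using r_pos powr_add[of r "p - 1 + d" 1] by simp
    then have "(s / r) powr (p + d) = s powr (p + d) / (r powr (p - 1 + d) * r)"
      using r_pos s by (simp add: powr_divide)
    then show ?thesis unfolding e using r_pos by simp
  qed
  finally show ?thesis by (simp add: G_def)
qed

text \<open>On the cone over \<open>A\<close> the norm and \<open>lin\<close> agree up to the factor
  \<open>L\<close>, so there the ball lies between the truncations of \<open>lin\<close> at
  \<open>1 / L\<close> and at \<open>L\<close>. Exchanging the weights costs
  \<open>L powr p\<close>, namely \<open>p - 1\<close> powers for the radius and one for
  \<open>lp_weight\<close>; the truncation costs \<open>L powr (p + d)\<close>.\<close>

lemma cone_weight_comparison: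
  assumes A [measurable]: "A \<in> sets (borel_vec (Suc d))" and AS: "A \<subseteq> lp_sphere (Suc d) p" and L: "L \<ge> 1"
    and lin: "\<And>x. x \<in> A \<Longrightarrow> 1 / L \<le> lin x \<and> lin x \<le> L"
    and wt: "\<And>x. x \<in> A \<Longrightarrow> r / L \<le> lp_weight (Suc d) p x \<and> lp_weight (Suc d) p x \<le> L * r"
  shows "cone_weight (Suc d) p A \<le> emeasure (lborel_vec d) (chart_dom A) * ennreal (L powr (2 * p + real d) / (p + real d))"
    "emeasure (lborel_vec d) (chart_dom A) * ennreal (1 / (p + real d)) \<le> ennreal (L powr (2 * p + real d)) * cone_weight (Suc d) p A"
proof -
  let ?n = "Suc d"
  define J where "J s x = indicator A (lp_proj ?n p x) * indicator {0<..s} (lin x) * ennreal (lin x powr (p - 1))" for s x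
  define W where "W x = indicator A (lp_proj ?n p x) * ennreal (lp_weight ?n p x) * indicator (lp_ball ?n p) x" for x
  have [measurable]: "J s \<in> borel_measurable (borel_vec ?n)" "W \<in> borel_measurable (borel_vec ?n)" for s
    unfolding J_def W_def by measurable
  have p0: "p > 0" "p + real d > 0" "L > 0" using p L by auto
  have polar: "lp_norm ?n p x > 0 \<and> lin x = lp_norm ?n p x * lin (lp_proj ?n p x) \<and>
     lp_weight ?n p x = lp_norm ?n p x powr (p - 1) * lp_weight ?n p (lp_proj ?n p x)"
    if "lp_proj ?n p x \<in> A" "x \<in> space (borel_vec ?n)" for x
  proof -
    have "lp_proj ?n p x \<in> lp_sphere ?n p" using that AS by auto
    note * = lp_proj_in_sphere[OF p0(1) this that(2)]
    have "lin x = lin (scale_vec ?n (lp_norm ?n p x) (lp_proj ?n p x))" "lp_weight ?n p x = lp_weight ?n p (scale_vec ?n (lp_norm ?n p x) (lp_proj ?n p x))"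
      using *(2) by simp_all
    then show ?thesis using *(1) by (simp add: lin_scale_vec lp_weight_scale_vec)
  qed
  have WJ: "W x \<le> ennreal (L powr p * r) * J L x" if x: "x \<in> space (borel_vec ?n)" for x
  proof (cases "lp_proj ?n p x \<in> A \<and> x \<in> lp_ball ?n p")
    case True
    define \<theta> where "\<theta> = lp_proj ?n p x"
    define R where "R = lp_norm ?n p x"
    have R: "R > 0" "lin x = R * lin \<theta>" "lp_weight ?n p x = R powr (p - 1) * lp_weight ?n p \<theta>" "R \<le> 1"
      using polar[OF _ x] True by (auto simp: R_def \<theta>_def lp_ball_def)
    have \<theta>: "\<theta> \<in> A" "1 / L \<le> lin \<theta>" "lin \<theta> \<le> L" "lp_weight ?n p \<theta> \<le> L * r"
      using True lin wt by (auto simp: \<theta>_def)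
    have lpos: "lin \<theta> > 0" using \<theta>(2) p0(3) by (meson divide_pos_pos less_le_trans zero_less_one)
    have lx: "lin x \<in> {0<..L}"
      using R \<theta> lpos mult_mono[of R 1 "lin \<theta>" L] p0 by auto
    have "R * 1 \<le> R * (L * lin \<theta>)"
      using \<theta>(2) p0(3) R by (intro mult_left_mono) (auto simp: field_simps)
    then have "R powr (p - 1) \<le> (L * lin x) powr (p - 1)"
      using R p by (intro powr_mono2) (auto simp: mult_ac)
    also have "\<dots> = L powr (p - 1) * lin x powr (p - 1)"
      using R lpos p0 by (simp add: powr_mult)
    finally have "lp_weight ?n p x \<le> (L powr (p - 1) * lin x powr (p - 1)) * (L * r)"
      unfolding R(3) using \<theta>(4) by (intro mult_mono) auto
    also have "\<dots> = L powr p * r * lin x powr (p - 1)"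
      using p0 by (simp add: powr_diff)
    finally have "ennreal (lp_weight ?n p x) \<le> ennreal (L powr p * r * lin x powr (p - 1))" by (rule ennreal_leI)
    then show ?thesis using True lx r_pos by (simp add: W_def J_def ennreal_mult)
  qed (auto simp: W_def)
  have JW: "J (1 / L) x \<le> ennreal (L powr p / r) * W x" if x: "x \<in> space (borel_vec ?n)" for x
  proof (cases "lp_proj ?n p x \<in> A \<and> lin x \<in> {0<..1 / L}")
    case True
    define \<theta> where "\<theta> = lp_proj ?n p x"
    define R where "R = lp_norm ?n p x"
    have R: "R > 0" "lin x = R * lin \<theta>" "lp_weight ?n p x = R powr (p - 1) * lp_weight ?n p \<theta>"
      using polar[OF _ x] True by (auto simp: R_def \<theta>_def)
    have \<theta>: "\<theta> \<in> A" "1 / L \<le> lin \<theta>" "lin \<theta> \<le> L" "r / L \<le> lp_weight ?n p \<theta>"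
      using True lin wt by (auto simp: \<theta>_def)
    have lpos: "lin \<theta> > 0" using \<theta>(2) p0(3) by (meson divide_pos_pos less_le_trans zero_less_one)
    have "R * (1 / L) \<le> R * lin \<theta>" using \<theta>(2) R by (intro mult_left_mono) auto
    also have "\<dots> \<le> 1 / L" using True R by simp
    finally have "R \<le> 1" using p0(3) by (simp add: field_simps)
    then have ball: "x \<in> lp_ball ?n p" using x by (simp add: lp_ball_def R_def space_PiM)
    have "lin x powr (p - 1) = R powr (p - 1) * lin \<theta> powr (p - 1)"
      using R lpos by (simp add: powr_mult)
    also have "\<dots> \<le> R powr (p - 1) * L powr (p - 1)"
      using \<theta> lpos p by (intro mult_left_mono powr_mono2) auto
    also have "\<dots> = L powr p / r * (R powr (p - 1) * (r / L))"
      using p0 r_pos by (simp add: powr_diff)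
    also have "\<dots> \<le> L powr p / r * (R powr (p - 1) * lp_weight ?n p \<theta>)"
      using \<theta>(4) r_pos by (intro mult_left_mono) auto
    finally have "ennreal (lin x powr (p - 1)) \<le> ennreal (L powr p / r * lp_weight ?n p x)"
      unfolding R(3) by (rule ennreal_leI)
    also have "\<dots> = ennreal (L powr p / r) * ennreal (lp_weight ?n p x)"
      using r_pos by (intro ennreal_mult) auto
    finally show ?thesis using True ball by (simp add: W_def J_def)
  qed (auto simp: J_def)
  have cw: "cone_weight ?n p A = (\<integral>\<^sup>+x. W x \<partial>lborel_vec ?n)" by (simp add: cone_weight_def W_def)
  have J_int: "(\<integral>\<^sup>+x. J s x \<partial>lborel_vec ?n) = emeasure (lborel_vec d) (chart_dom A) * ennreal (1 / r * s powr (p + real d) / (p + real d))"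
    if "s > 0" for s
    unfolding J_def by (rule nn_integral_linear_cone[OF A that])
  have "cone_weight ?n p A \<le> (\<integral>\<^sup>+x. ennreal (L powr p * r) * J L x \<partial>lborel_vec ?n)"
    unfolding cw by (rule nn_integral_mono) (simp add: WJ)
  also have "\<dots> = ennreal (L powr p * r) * (emeasure (lborel_vec d) (chart_dom A) * ennreal (1 / r * L powr (p + real d) / (p + real d)))"
    by (subst nn_integral_cmult) (use J_int[OF p0(3)] in auto)
  also have "\<dots> = emeasure (lborel_vec d) (chart_dom A) * (ennreal (L powr p * r) * ennreal (1 / r * L powr (p + real d) / (p + real d)))"
    by (simp add: mult_ac)
  also have "ennreal (L powr p * r) * ennreal (1 / r * L powr (p + real d) / (p + real d)) = ennreal ((L powr p * r) * (1 / r * L powr (p + real d) / (p + real d)))"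
    using r_pos p0 by (intro ennreal_mult[symmetric]) auto
  also have "(L powr p * r) * (1 / r * L powr (p + real d) / (p + real d)) = L powr (2 * p + real d) / (p + real d)"
    using r_pos by (simp add: powr_add[symmetric])
  finally show "cone_weight ?n p A \<le> emeasure (lborel_vec d) (chart_dom A) * ennreal (L powr (2 * p + real d) / (p + real d))" .
  have "emeasure (lborel_vec d) (chart_dom A) * ennreal (1 / r * (1 / L) powr (p + real d) / (p + real d)) \<le> (\<integral>\<^sup>+x. ennreal (L powr p / r) * W x \<partial>lborel_vec ?n)"
    unfolding J_int[of "1 / L", OF divide_pos_pos[OF zero_less_one p0(3)], symmetric]
    by (rule nn_integral_mono) (simp add: JW)
  also have "\<dots> = ennreal (L powr p / r) * cone_weight ?n p A"
    unfolding cw by (rule nn_integral_cmult) simp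
  finally have *: "ennreal (r * L powr (p + real d)) * (emeasure (lborel_vec d) (chart_dom A) * ennreal (1 / r * (1 / L) powr (p + real d) / (p + real d)))
     \<le> ennreal (r * L powr (p + real d)) * (ennreal (L powr p / r) * cone_weight ?n p A)"
    by (rule mult_left_mono) simp
  have "ennreal (r * L powr (p + real d)) * (emeasure (lborel_vec d) (chart_dom A) * ennreal (1 / r * (1 / L) powr (p + real d) / (p + real d)))
     = emeasure (lborel_vec d) (chart_dom A) * (ennreal (r * L powr (p + real d)) * ennreal (1 / r * (1 / L) powr (p + real d) / (p + real d)))"
    by (simp add: mult_ac)
  also have "ennreal (r * L powr (p + real d)) * ennreal (1 / r * (1 / L) powr (p + real d) / (p + real d)) =
     ennreal ((r * L powr (p + real d)) * (1 / r * (1 / L) powr (p + real d) / (p + real d)))"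
    using r_pos p0 by (intro ennreal_mult[symmetric]) auto
  also have "(r * L powr (p + real d)) * (1 / r * (1 / L) powr (p + real d) / (p + real d)) = 1 / (p + real d)"
    using r_pos p0 by (simp add: powr_divide)
  finally have l: "emeasure (lborel_vec d) (chart_dom A) * ennreal (1 / (p + real d)) =
     ennreal (r * L powr (p + real d)) * (emeasure (lborel_vec d) (chart_dom A) * ennreal (1 / r * (1 / L) powr (p + real d) / (p + real d)))" ..
  have "ennreal (r * L powr (p + real d)) * (ennreal (L powr p / r) * cone_weight ?n p A) =
    ennreal ((r * L powr (p + real d)) * (L powr p / r)) * cone_weight ?n p A"
    using r_pos by (subst ennreal_mult) (auto simp: mult.assoc)
  also have "(r * L powr (p + real d)) * (L powr p / r) = L powr (2 * p + real d)"
    using r_pos by (simp add: powr_add[symmetric])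
  finally show "emeasure (lborel_vec d) (chart_dom A) * ennreal (1 / (p + real d)) \<le> ennreal (L powr (2 * p + real d)) * cone_weight ?n p A"
    using * l by simp
qed

text \<open>The inverse \<open>f\<close> of the chart is \<open>tangent_proj\<close> followed by the
  reflection and by dropping the last coordinate. That coordinate is constantly \<open>1 / r\<close>
  and the reflection is an isometry, so \<open>f\<close> has exactly the Lipschitz behaviour of
  \<open>tangent_proj\<close>, in both directions.\<close>

lemma hausdorff_measure_chart:
  assumes AS: "A \<subseteq> lp_sphere (Suc d) p" and L: "L > 0"
    and lin: "\<And>x. x \<in> A \<Longrightarrow> lin x > 0"
    and lip: "\<And>x y. x \<in> A \<Longrightarrow> y \<in> A \<Longrightarrow> euclid_dist (Suc d) (tangent_proj x) (tangent_proj y) \<le> L * euclid_dist (Suc d) x y"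
      "\<And>x y. x \<in> A \<Longrightarrow> y \<in> A \<Longrightarrow> euclid_dist (Suc d) x y \<le> L * euclid_dist (Suc d) (tangent_proj x) (tangent_proj y)"
  shows "hausdorff_measure (Suc d) d A \<le> ennreal (L ^ d) * hausdorff_measure d d (chart_dom A)"
    "hausdorff_measure d d (chart_dom A) \<le> ennreal (L ^ d) * hausdorff_measure (Suc d) d A"
proof -
  let ?n = "Suc d"
  have p0: "p > 0" using p by simp
  define f where "f x = restrict (Q (tangent_proj x)) {..<d}" for x
  have sp: "x \<in> space (borel_vec ?n)" "lp_norm ?n p x = 1" if "x \<in> A" for x
    using that AS by (auto simp: lp_sphere_def space_PiM)
  have tsp: "tangent_proj x \<in> space (borel_vec ?n)" for x by (simp add: tangent_proj_def)
  have Q_d: "Q (tangent_proj x) d = 1 / r" if "x \<in> A" for x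
    using lin[OF that] by (simp add: Q_last tangent_proj_def lin_scale_vec)
  have f_upd: "(f x)(d := 1 / r) = Q (tangent_proj x)" if "x \<in> A" for x
  proof
    fix i show "((f x)(d := 1 / r)) i = Q (tangent_proj x) i"
      using Q_d[OF that] householder_space[of ?n w "tangent_proj x"]
      by (cases "i < ?n") (auto simp: f_def less_Suc_eq space_PiM PiE_def extensional_def)
  qed
  have chart_f: "chart (f x) = x" if x: "x \<in> A" for x
  proof -
    have "chart (f x) = lp_proj ?n p (tangent_proj x)"
      unfolding chart_def f_upd[OF x] by (simp add: householder_involution[OF w tsp])
    also have "\<dots> = x"
      using lin[OF x] sp[OF x] p0 by (simp add: tangent_proj_def lp_proj_scale_vec) (simp add: lp_proj_def)
    finally show ?thesis .
  qed
  have f_chart: "f (chart u) = u" if u: "u \<in> chart_dom A" for u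
  proof -
    have us: "u \<in> space (borel_vec d)" "chart u \<in> A" using u by (auto simp: chart_dom_def)
    define y where "y = Q (u(d := 1 / r))"
    have ys: "y \<in> space (borel_vec ?n)" by (simp add: y_def)
    have ly: "lin y = 1" using lin_Q[OF fun_upd_space[OF us(1)], of "1 / r"] r_pos by (simp add: y_def)
    have ch: "chart u = scale_vec ?n (1 / lp_norm ?n p y) y" by (simp add: chart_def lp_proj_def y_def)
    then have lch: "lin (chart u) = 1 / lp_norm ?n p y" by (simp add: lin_scale_vec ly)
    then have N: "lp_norm ?n p y > 0" using lin[OF us(2)] by simp
    have "tangent_proj (chart u) = y"
      unfolding tangent_proj_def lch using ch N ys by simp
    then have "Q (tangent_proj (chart u)) = u(d := 1 / r)"
      using householder_involution[OF w fun_upd_space[OF us(1)]] by (simp add: y_def)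
    then show ?thesis
      using us(1) by (auto simp: f_def restrict_def space_PiM PiE_def extensional_def fun_eq_iff)
  qed
  have f_space: "f x \<in> space (borel_vec d)" for x by (simp add: f_def space_PiM)
  have img: "f ` A = chart_dom A"
  proof (intro equalityI subsetI)
    fix u assume "u \<in> f ` A"
    then show "u \<in> chart_dom A" using chart_f f_space by (auto simp: chart_dom_def)
  next
    fix u assume u: "u \<in> chart_dom A"
    then have "chart u \<in> A" by (simp add: chart_dom_def)
    then show "u \<in> f ` A" using f_chart[OF u] by (metis image_eqI)
  qed
  have img': "chart ` chart_dom A = A"
    using chart_f img by (auto simp: image_image[symmetric] chart_dom_def) (metis chart_f f_space image_eqI mem_Collect_eq)
  have dist: "euclid_dist d (f x) (f y) = euclid_dist ?n (tangent_proj x) (tangent_proj y)" if "x \<in> A" "y \<in> A" for x y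
  proof -
    have "euclid_dist d (f x) (f y) = euclid_dist ?n (Q (tangent_proj x)) (Q (tangent_proj y))"
      using Q_d[OF that(1)] Q_d[OF that(2)] by (simp add: euclid_dist_def L2_set_def f_def)
    then show ?thesis by (simp add: euclid_dist_householder[OF w])
  qed
  have "hausdorff_measure d d (f ` A) \<le> ennreal (L ^ d) * hausdorff_measure ?n d A"
  proof (rule hausdorff_measure_Lipschitz_image[OF L])
    show "f ` A \<subseteq> real_vec d" using f_space by (simp add: space_PiM image_subset_iff)
  qed (simp add: dist lip)
  then show "hausdorff_measure d d (chart_dom A) \<le> ennreal (L ^ d) * hausdorff_measure ?n d A" by (simp add: img)
  have "hausdorff_measure ?n d (chart ` chart_dom A) \<le> ennreal (L ^ d) * hausdorff_measure d d (chart_dom A)"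
  proof (rule hausdorff_measure_Lipschitz_image[OF L])
    show "chart ` chart_dom A \<subseteq> real_vec ?n" unfolding img' using AS by (auto simp: lp_sphere_def)
    fix u v assume uv: "u \<in> chart_dom A" "v \<in> chart_dom A"
    then have "chart u \<in> A" "chart v \<in> A" by (auto simp: chart_dom_def)
    then show "euclid_dist ?n (chart u) (chart v) \<le> L * euclid_dist d u v"
      using lip(2)[of "chart u" "chart v"] dist[of "chart u" "chart v"] f_chart[OF uv(1)] f_chart[OF uv(2)] by simp
  qed
  then show "hausdorff_measure ?n d A \<le> ennreal (L ^ d) * hausdorff_measure d d (chart_dom A)" by (simp add: img')
qed

end

section \<open>Local geometry of the sphere\<close>

lemma lp_sphere_sum: "p > 0 \<Longrightarrow> x \<in> lp_sphere n p \<Longrightarrow> (\<Sum>i<n. \<bar>x i\<bar> powr p) = 1"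
  using lp_norm_powr[of p n x] by (simp add: lp_sphere_def)

lemma lp_sphere_coord_le:
  assumes "p > 0" "x \<in> lp_sphere n p" "i < n"
  shows "\<bar>x i\<bar> \<le> 1"
proof (rule ccontr)
  assume "\<not> ?thesis"
  then have "1 < \<bar>x i\<bar> powr p" using assms(1) by (simp add: gr_one_powr)
  also have "\<dots> \<le> (\<Sum>i<n. \<bar>x i\<bar> powr p)" using assms(3) by (intro member_le_sum) auto
  finally show False using lp_sphere_sum[OF assms(1,2)] by simp
qed

lemma abs_powr_has_derivative:
  fixes t p :: real
  assumes "t \<noteq> 0"
  shows "((\<lambda>s. \<bar>s\<bar> powr p) has_real_derivative (p * (\<bar>t\<bar> powr (p - 1) * sgn t))) (at t)"
proof (cases "t > 0")
  case True
  have "((\<lambda>s. s powr p) has_real_derivative (p * t powr (p - 1))) (at t)"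
    by (rule has_real_derivative_powr[OF True])
  moreover have "\<forall>\<^sub>F s in nhds t. \<bar>s\<bar> powr p = s powr p"
    by (rule eventually_mono[OF eventually_nhds_in_open[of "{0<..}"]]) (use True in auto)
  ultimately show ?thesis using True by (subst DERIV_cong_ev[OF refl _ refl]) auto
next
  case False
  then have t: "t < 0" using assms by simp
  have "((\<lambda>s. (- s) powr p) has_real_derivative (p * (- t) powr (p - 1) * (- 1))) (at t)"
    by (rule DERIV_chain2[where g=uminus]) (use t in \<open>auto intro!: has_real_derivative_powr derivative_eq_intros\<close>)
  moreover have "\<forall>\<^sub>F s in nhds t. \<bar>s\<bar> powr p = (- s) powr p"
    by (rule eventually_mono[OF eventually_nhds_in_open[of "{..<0}"]]) (use t in auto)
  ultimately show ?thesis using t by (subst DERIV_cong_ev[OF refl _ refl]) auto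
qed

text \<open>The derivative \<open>p * \<phi>\<close> of the power is continuous away from 0, so near
  \<open>a\<close> the mean value inequality bounds the Lipschitz constant of the power minus its
  linear part. The square of \<open>L\<close> anticipates the square root in
  \<open>lp_weight\<close>.\<close>

lemma abs_powr_local_estimates:
  fixes a p \<epsilon> L :: real
  assumes a: "a \<noteq> 0" and p: "p > 0" and \<epsilon>: "\<epsilon> > 0" and L: "L > 1"
  defines "\<phi> \<equiv> (\<lambda>t. \<bar>t\<bar> powr (p - 1) * sgn t)"
  obtains e where "e > 0"
    "\<And>t. \<bar>t - a\<bar> < e \<Longrightarrow> \<bar>a\<bar> powr (2 * p - 2) / L\<^sup>2 \<le> \<bar>t\<bar> powr (2 * p - 2) \<and> \<bar>t\<bar> powr (2 * p - 2) \<le> L\<^sup>2 * \<bar>a\<bar> powr (2 * p - 2)"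
    "\<And>s t. \<bar>s - a\<bar> < e \<Longrightarrow> \<bar>t - a\<bar> < e \<Longrightarrow> \<bar>\<bar>s\<bar> powr p - \<bar>t\<bar> powr p - p * \<phi> a * (s - t)\<bar> \<le> p * \<epsilon> * \<bar>s - t\<bar>"
proof -
  have "isCont (\<lambda>t. \<bar>t\<bar> powr (p - 1) * (t / \<bar>t\<bar>)) a"
    using a by (intro continuous_intros) auto
  moreover have \<phi>_eq: "\<phi> = (\<lambda>t. \<bar>t\<bar> powr (p - 1) * (t / \<bar>t\<bar>))"
    by (auto simp: \<phi>_def fun_eq_iff sgn_if)
  ultimately have \<phi>_cont: "(\<phi> \<longlongrightarrow> \<phi> a) (nhds a)"
    unfolding \<phi>_eq by (simp add: continuous_at tendsto_nhds_iff)
  then have ev1: "\<forall>\<^sub>F t in nhds a. \<bar>\<phi> t - \<phi> a\<bar> < \<epsilon>"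
    using \<epsilon> unfolding tendsto_iff dist_real_def by blast
  define \<psi> where "\<psi> t = \<bar>t\<bar> powr (2 * p - 2)" for t :: real
  have \<psi>a: "\<psi> a > 0" using a by (simp add: \<psi>_def)
  have "isCont \<psi> a" unfolding \<psi>_def using a by (intro continuous_intros) auto
  then have \<psi>_cont: "(\<psi> \<longlongrightarrow> \<psi> a) (nhds a)" by (simp add: continuous_at tendsto_nhds_iff)
  have L2: "L\<^sup>2 > 1" using L by (simp add: one_less_power)
  have "\<psi> a / L\<^sup>2 < \<psi> a" using \<psi>a L2 by (simp add: divide_less_eq)
  then have ev2: "\<forall>\<^sub>F t in nhds a. \<psi> a / L\<^sup>2 < \<psi> t" by (rule order_tendstoD(1)[OF \<psi>_cont])
  have "\<psi> a < L\<^sup>2 * \<psi> a" using \<psi>a L2 by simp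
  then have ev3: "\<forall>\<^sub>F t in nhds a. \<psi> t < L\<^sup>2 * \<psi> a" by (rule order_tendstoD(2)[OF \<psi>_cont])
  have ev4: "\<forall>\<^sub>F t in nhds a. t \<noteq> 0"
    by (rule eventually_mono[OF eventually_nhds_in_open[of "- {0}"]]) (use a in auto)
  have "\<forall>\<^sub>F t in nhds a. \<bar>\<phi> t - \<phi> a\<bar> < \<epsilon> \<and> \<psi> a / L\<^sup>2 < \<psi> t \<and> \<psi> t < L\<^sup>2 * \<psi> a \<and> t \<noteq> 0"
    using ev1 ev2 ev3 ev4 by eventually_elim simp
  then obtain e where e: "e > 0" "\<And>t. \<bar>t - a\<bar> < e \<Longrightarrow> \<bar>\<phi> t - \<phi> a\<bar> < \<epsilon> \<and> \<psi> a / L\<^sup>2 < \<psi> t \<and> \<psi> t < L\<^sup>2 * \<psi> a \<and> t \<noteq> 0"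
    unfolding eventually_nhds_metric dist_real_def by blast
  show ?thesis
  proof (rule that[OF e(1)])
    fix t assume "\<bar>t - a\<bar> < e"
    from e(2)[OF this] show "\<bar>a\<bar> powr (2 * p - 2) / L\<^sup>2 \<le> \<bar>t\<bar> powr (2 * p - 2) \<and> \<bar>t\<bar> powr (2 * p - 2) \<le> L\<^sup>2 * \<bar>a\<bar> powr (2 * p - 2)"
      by (auto simp: \<psi>_def)
  next
    fix s t assume st: "\<bar>s - a\<bar> < e" "\<bar>t - a\<bar> < e"
    have "norm ((\<bar>s\<bar> powr p - p * \<phi> a * s) - (\<bar>t\<bar> powr p - p * \<phi> a * t)) \<le> p * \<epsilon> * norm (s - t)"
    proof (rule field_differentiable_bound[where S="{a - e<..<a + e}" and f'="\<lambda>z. p * \<phi> z - p * \<phi> a"])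
      fix z assume "z \<in> {a - e<..<a + e}"
      then have z: "\<bar>\<phi> z - \<phi> a\<bar> < \<epsilon>" "z \<noteq> 0" using e(2)[of z] by (auto simp: abs_less_iff)
      have "((\<lambda>z. \<bar>z\<bar> powr p - p * \<phi> a * z) has_real_derivative (p * \<phi> z - p * \<phi> a * 1)) (at z)"
        unfolding \<phi>_def by (rule DERIV_diff[OF abs_powr_has_derivative[OF z(2)] DERIV_cmult[OF DERIV_ident]])
      then show "((\<lambda>z. \<bar>z\<bar> powr p - p * \<phi> a * z) has_field_derivative (p * \<phi> z - p * \<phi> a)) (at z within {a - e<..<a + e})"
        unfolding mult_1_right by (rule has_field_derivative_at_within)
      have "p * \<phi> z - p * \<phi> a = p * (\<phi> z - \<phi> a)" by (rule right_diff_distrib[symmetric])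
      then have "norm (p * \<phi> z - p * \<phi> a) = p * \<bar>\<phi> z - \<phi> a\<bar>"
        using p by (simp only: real_norm_def abs_mult abs_of_pos)
      then show "norm (p * \<phi> z - p * \<phi> a) \<le> p * \<epsilon>" using z p by simp
    qed (use st in \<open>auto simp: abs_less_iff\<close>)
    then show "\<bar>\<bar>s\<bar> powr p - \<bar>t\<bar> powr p - p * \<phi> a * (s - t)\<bar> \<le> p * \<epsilon> * \<bar>s - t\<bar>"
      by (simp add: algebra_simps)
  qed
qed

lemma sum_abs_le_euclid_dist: "(\<Sum>i<n. \<bar>x i - y i\<bar>) \<le> real n * euclid_dist n x y"
proof -
  have "(\<Sum>i<n. \<bar>x i - y i\<bar>) \<le> (\<Sum>i<n. euclid_dist n x y)"
    by (intro sum_mono coord_diff_le_euclid_dist) auto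
  then show ?thesis by simp
qed

text \<open>The p-th power sum is constant on the sphere, so its linear part \<open>p * lin\<close>
  changes between two points only by the linearization error, a small multiple of their distance.
  Hence \<open>lin\<close> stays near 1 with a small Lipschitz constant, and division by it barely
  distorts distances.\<close>

lemma sphere_local_estimates:
  fixes a :: "nat \<Rightarrow> real"
  assumes p: "p \<ge> 1" and n: "n \<ge> 1" and L: "L > 1"
    and a: "a \<in> lp_sphere n p" and nz: "\<And>i. i < n \<Longrightarrow> a i \<noteq> 0"
  defines "g \<equiv> lp_grad p a"
  defines "lin \<equiv> (\<lambda>x. \<Sum>i<n. g i * x i)"
  defines "\<pi> \<equiv> (\<lambda>x. scale_vec n (1 / lin x) x)"
  obtains \<delta> where "\<delta> > 0"
    "\<And>x. x \<in> lp_sphere n p \<Longrightarrow> (\<And>i. i < n \<Longrightarrow> \<bar>x i - a i\<bar> < \<delta>) \<Longrightarrow>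
       1 / L \<le> lin x \<and> lin x \<le> L \<and>
       sqrt (\<Sum>i<n. (g i)\<^sup>2) / L \<le> lp_weight n p x \<and> lp_weight n p x \<le> L * sqrt (\<Sum>i<n. (g i)\<^sup>2)"
    "\<And>x y. x \<in> lp_sphere n p \<Longrightarrow> y \<in> lp_sphere n p \<Longrightarrow>
       (\<And>i. i < n \<Longrightarrow> \<bar>x i - a i\<bar> < \<delta>) \<Longrightarrow> (\<And>i. i < n \<Longrightarrow> \<bar>y i - a i\<bar> < \<delta>) \<Longrightarrow>
       euclid_dist n (\<pi> x) (\<pi> y) \<le> L * euclid_dist n x y \<and> euclid_dist n x y \<le> L * euclid_dist n (\<pi> x) (\<pi> y)"
proof -
  have p0: "p > 0" using p by simp
  have n0: "real n \<ge> 1" using n by simp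
  \<comment> \<open>\<open>1 - \<theta> = 1 / L\<close> serves the lower Lipschitz bound and
    \<open>1 + \<theta> \<le> L\<close> the upper one.\<close>
  define \<theta> where "\<theta> = (L - 1) / L"
  have \<theta>: "\<theta> > 0" "\<theta> < 1" "1 + \<theta> \<le> L" "1 - \<theta> = 1 / L"
  proof -
    show "\<theta> > 0" "\<theta> < 1" "1 - \<theta> = 1 / L" using L by (auto simp: \<theta>_def field_simps)
    have "\<theta> \<le> L - 1" using L mult_left_mono[of 1 L "L - 1"] by (simp add: \<theta>_def divide_le_eq)
    then show "1 + \<theta> \<le> L" by simp
  qed
  \<comment> \<open>Of the six parts, two are spent on the first summand of the error
    \<open>E\<close> below and four on the second.\<close>
  define \<eta> where "\<eta> = \<theta> / (6 * real n)"
  have \<eta>: "\<eta> > 0" "6 * real n * \<eta> = \<theta>" using \<theta> n0 by (auto simp: \<eta>_def)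
  have "\<eta> * 1 \<le> \<eta> * real n" using \<eta> n0 by (intro mult_left_mono) auto
  moreover have "6 * (\<eta> * real n) = \<theta>" using \<eta>(2) by (simp only: mult_ac)
  ultimately have \<eta>2: "\<eta> \<le> \<theta>" "\<eta> \<le> 1 / 2" using \<eta>(1) \<theta>(1,2) by linarith+
  have "\<exists>e>0. (\<forall>t. \<bar>t - a i\<bar> < e \<longrightarrow> \<bar>a i\<bar> powr (2 * p - 2) / L\<^sup>2 \<le> \<bar>t\<bar> powr (2 * p - 2) \<and> \<bar>t\<bar> powr (2 * p - 2) \<le> L\<^sup>2 * \<bar>a i\<bar> powr (2 * p - 2)) \<and>
      (\<forall>s t. \<bar>s - a i\<bar> < e \<longrightarrow> \<bar>t - a i\<bar> < e \<longrightarrow> \<bar>\<bar>s\<bar> powr p - \<bar>t\<bar> powr p - p * g i * (s - t)\<bar> \<le> p * (\<eta> / n) * \<bar>s - t\<bar>)"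
    if "i < n" for i
  proof -
    have "\<eta> / n > 0" using \<eta> n0 by simp
    from abs_powr_local_estimates[OF nz[OF that] p0 this L] show ?thesis
      unfolding g_def lp_grad_def by metis
  qed
  then obtain e where e: "\<And>i. i < n \<Longrightarrow> e i > 0"
    "\<And>i t. i < n \<Longrightarrow> \<bar>t - a i\<bar> < e i \<Longrightarrow> \<bar>a i\<bar> powr (2 * p - 2) / L\<^sup>2 \<le> \<bar>t\<bar> powr (2 * p - 2) \<and> \<bar>t\<bar> powr (2 * p - 2) \<le> L\<^sup>2 * \<bar>a i\<bar> powr (2 * p - 2)"
    "\<And>i s t. i < n \<Longrightarrow> \<bar>s - a i\<bar> < e i \<Longrightarrow> \<bar>t - a i\<bar> < e i \<Longrightarrow> \<bar>\<bar>s\<bar> powr p - \<bar>t\<bar> powr p - p * g i * (s - t)\<bar> \<le> p * (\<eta> / n) * \<bar>s - t\<bar>"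
    by metis
  \<comment> \<open>The bound 1 keeps the sum of the coordinate distances to \<open>a\<close> at
    most \<open>n\<close>, as the estimate of \<open>lin\<close> near 1 uses.\<close>
  define \<delta> where "\<delta> = min 1 (Min (e ` {..<n}))"
  have ne: "e ` {..<n} \<noteq> {}" using n by (auto simp: lessThan_empty_iff)
  have \<delta>: "\<delta> > 0" "\<delta> \<le> 1" "\<And>i. i < n \<Longrightarrow> \<delta> \<le> e i"
    using e(1) ne by (auto simp: \<delta>_def min_le_iff_disj)
  define near where "near x \<longleftrightarrow> x \<in> lp_sphere n p \<and> (\<forall>i<n. \<bar>x i - a i\<bar> < \<delta>)" for x
  have near_a: "near a" using a \<delta> by (simp add: near_def)
  have near_e: "\<bar>x i - a i\<bar> < e i" if "near x" "i < n" for x i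
    using that \<delta>(3)[OF that(2)] unfolding near_def by (meson less_le_trans)
  have g2: "(g i)\<^sup>2 = \<bar>a i\<bar> powr (2 * p - 2)" if "i < n" for i
  proof -
    have "(g i)\<^sup>2 = \<bar>a i\<bar> powr (p - 1) * \<bar>a i\<bar> powr (p - 1)"
      using nz[OF that] by (simp add: g_def lp_grad_def power2_eq_square sgn_if)
    then show ?thesis by (simp add: powr_add[symmetric])
  qed
  have lin_diff: "\<bar>lin x - lin y\<bar> \<le> \<eta> / n * (\<Sum>i<n. \<bar>x i - y i\<bar>)" if x: "near x" and y: "near y" for x y
  proof -
    have "(\<Sum>i<n. \<bar>x i\<bar> powr p - \<bar>y i\<bar> powr p) = 0"
      using lp_sphere_sum[OF p0, of x n] lp_sphere_sum[OF p0, of y n] x y by (simp add: near_def sum_subtractf)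
    then have eq: "p * (lin x - lin y) = - (\<Sum>i<n. \<bar>x i\<bar> powr p - \<bar>y i\<bar> powr p - p * g i * (x i - y i))"
      by (simp add: lin_def sum_subtractf sum.distrib sum_distrib_left algebra_simps)
    have "p * \<bar>lin x - lin y\<bar> = \<bar>p * (lin x - lin y)\<bar>"
      using p0 by (simp only: abs_mult abs_of_pos)
    also have "\<dots> = \<bar>\<Sum>i<n. \<bar>x i\<bar> powr p - \<bar>y i\<bar> powr p - p * g i * (x i - y i)\<bar>"
      by (simp only: eq abs_minus_cancel)
    also have "\<dots> \<le> (\<Sum>i<n. p * (\<eta> / n) * \<bar>x i - y i\<bar>)"
      by (rule order_trans[OF sum_abs sum_mono]) (use e(3) near_e x y in auto)
    also have "\<dots> = p * (\<eta> / n * (\<Sum>i<n. \<bar>x i - y i\<bar>))" by (simp add: sum_distrib_left mult.assoc)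
    finally show ?thesis using p0 by (rule mult_left_le_imp_le)
  qed
  \<comment> \<open>Euler's identity for the homogeneous norm, at a point of norm 1.\<close>
  have lin_a: "lin a = 1"
  proof -
    have "lin a = (\<Sum>i<n. \<bar>a i\<bar> powr p)"
      unfolding lin_def
    proof (rule sum.cong[OF refl])
      fix i assume "i \<in> {..<n}"
      have "g i * a i = \<bar>a i\<bar> powr (p - 1) * \<bar>a i\<bar>" by (simp add: g_def lp_grad_def abs_sgn mult_ac)
      also have "\<dots> = \<bar>a i\<bar> powr p" using nz[of i] \<open>i \<in> {..<n}\<close> powr_mult_base[of "\<bar>a i\<bar>" "p - 1"] by (simp add: mult.commute)
      finally show "g i * a i = \<bar>a i\<bar> powr p" .
    qed
    then show ?thesis using lp_sphere_sum[OF p0 a] by simp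
  qed
  have lin_near: "\<bar>lin x - 1\<bar> \<le> \<eta>" if x: "near x" for x
  proof -
    have "\<bar>lin x - lin a\<bar> \<le> \<eta> / n * (\<Sum>i<n. \<bar>x i - a i\<bar>)" by (rule lin_diff[OF x near_a])
    also have "\<dots> \<le> \<eta> / n * (\<Sum>i<n. 1)"
      using x \<delta>(2) \<eta>(1) unfolding near_def by (intro mult_left_mono sum_mono) (auto simp: less_imp_le intro: order_trans[OF less_imp_le])
    also have "\<dots> = \<eta>" using n0 by simp
    finally show ?thesis by (simp add: lin_a)
  qed
  show ?thesis
  proof (rule that[OF \<delta>(1)])
    fix x assume "x \<in> lp_sphere n p" "\<And>i. i < n \<Longrightarrow> \<bar>x i - a i\<bar> < \<delta>"
    then have x: "near x" by (simp add: near_def)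
    have "1 / L \<le> lin x" "lin x \<le> L" using lin_near[OF x] \<eta>2(1) \<theta> by linarith+
    moreover have "lp_weight n p x \<le> L * sqrt (\<Sum>i<n. (g i)\<^sup>2)"
    proof -
      have "(\<Sum>i<n. \<bar>x i\<bar> powr (2 * p - 2)) \<le> (\<Sum>i<n. L\<^sup>2 * (g i)\<^sup>2)"
        by (intro sum_mono) (use e(2) near_e[OF x] in \<open>auto simp: g2\<close>)
      then have "lp_weight n p x \<le> sqrt (L\<^sup>2 * (\<Sum>i<n. (g i)\<^sup>2))"
        unfolding lp_weight_def by (simp add: sum_distrib_left)
      then show ?thesis using L by (simp add: real_sqrt_mult)
    qed
    moreover have "sqrt (\<Sum>i<n. (g i)\<^sup>2) / L \<le> lp_weight n p x"
    proof -
      have "(\<Sum>i<n. (g i)\<^sup>2 / L\<^sup>2) \<le> (\<Sum>i<n. \<bar>x i\<bar> powr (2 * p - 2))"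
        by (intro sum_mono) (use e(2) near_e[OF x] in \<open>auto simp: g2\<close>)
      then have "sqrt ((\<Sum>i<n. (g i)\<^sup>2) / L\<^sup>2) \<le> lp_weight n p x"
        unfolding lp_weight_def by (simp add: sum_divide_distrib)
      then show ?thesis using L by (simp add: real_sqrt_divide)
    qed
    ultimately show "1 / L \<le> lin x \<and> lin x \<le> L \<and> sqrt (\<Sum>i<n. (g i)\<^sup>2) / L \<le> lp_weight n p x \<and> lp_weight n p x \<le> L * sqrt (\<Sum>i<n. (g i)\<^sup>2)"
      by blast
  next
    fix x y assume "x \<in> lp_sphere n p" "y \<in> lp_sphere n p" "\<And>i. i < n \<Longrightarrow> \<bar>x i - a i\<bar> < \<delta>" "\<And>i. i < n \<Longrightarrow> \<bar>y i - a i\<bar> < \<delta>"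
    then have x: "near x" and y: "near y" by (simp_all add: near_def)
    define D where "D = euclid_dist n x y"
    have D: "D \<ge> 0" by (simp add: D_def)
    define lx where "lx = lin x"
    define ly where "ly = lin y"
    have l: "lx \<ge> 1/2" "ly \<ge> 1/2" "\<bar>lx - 1\<bar> \<le> \<eta>" using lin_near[OF x] lin_near[OF y] \<eta>2 unfolding lx_def ly_def by linarith+
    have "\<bar>lx - ly\<bar> \<le> \<eta> / n * (\<Sum>i<n. \<bar>x i - y i\<bar>)" unfolding lx_def ly_def by (rule lin_diff[OF x y])
    also have "\<dots> \<le> \<eta> / n * (real n * D)"
      unfolding D_def using \<eta>(1) by (intro mult_left_mono sum_abs_le_euclid_dist) auto
    also have "\<dots> = \<eta> * D" using n0 by simp
    finally have lxy: "\<bar>lx - ly\<bar> \<le> \<eta> * D" .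
    have c1: "\<bar>1 / lx - 1\<bar> \<le> 2 * \<eta>"
    proof -
      have "\<bar>1 / lx - 1\<bar> = \<bar>lx - 1\<bar> / lx" using l(1) by (simp add: abs_if field_simps)
      also have "\<dots> \<le> \<eta> / (1/2)" using l \<eta> by (intro frac_le) auto
      finally show ?thesis by simp
    qed
    have c2: "\<bar>1 / lx - 1 / ly\<bar> \<le> 4 * \<eta> * D"
    proof -
      have "1 / lx - 1 / ly = (ly - lx) / (lx * ly)" using l by (simp add: field_simps)
      then have "\<bar>1 / lx - 1 / ly\<bar> = \<bar>lx - ly\<bar> / (lx * ly)" using l by (simp add: abs_mult abs_minus_commute)
      also have "\<dots> \<le> (\<eta> * D) / ((1/2) * (1/2))" using l lxy \<eta> D by (intro frac_le mult_mono) auto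
      finally show ?thesis by simp
    qed
    \<comment> \<open>The amount by which the difference of the projections deviates from
      \<open>x - y\<close>; \<open>lin\<close> near 1 makes its first summand small, the slow
      variation of \<open>lin\<close> the second.\<close>
    define E where "E i = (x i - y i) * (1 / lx - 1) + y i * (1 / lx - 1 / ly)" for i
    have "(\<Sum>i<n. \<bar>E i\<bar>) \<le> (\<Sum>i<n. \<bar>x i - y i\<bar> * (2 * \<eta>) + 1 * (4 * \<eta> * D))"
    proof (rule sum_mono)
      fix i assume i: "i \<in> {..<n}"
      have yi: "\<bar>y i\<bar> \<le> 1" using lp_sphere_coord_le[OF p0] y i by (auto simp: near_def)
      have "\<bar>E i\<bar> \<le> \<bar>x i - y i\<bar> * \<bar>1 / lx - 1\<bar> + \<bar>y i\<bar> * \<bar>1 / lx - 1 / ly\<bar>"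
        unfolding E_def abs_mult[symmetric] by (rule abs_triangle_ineq)
      also have "\<dots> \<le> \<bar>x i - y i\<bar> * (2 * \<eta>) + 1 * (4 * \<eta> * D)"
        using c1 c2 yi by (intro add_mono mult_mono) auto
      finally show "\<bar>E i\<bar> \<le> \<bar>x i - y i\<bar> * (2 * \<eta>) + 1 * (4 * \<eta> * D)" .
    qed
    also have "\<dots> = (\<Sum>i<n. \<bar>x i - y i\<bar>) * (2 * \<eta>) + real n * (4 * \<eta> * D)"
      by (simp add: sum.distrib sum_distrib_right)
    also have "\<dots> \<le> (real n * D) * (2 * \<eta>) + real n * (4 * \<eta> * D)"
      unfolding D_def using \<eta>(1) by (intro add_right_mono mult_right_mono sum_abs_le_euclid_dist) auto
    also have "\<dots> = \<theta> * D" unfolding \<eta>(2)[symmetric] by (simp add: algebra_simps)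
    finally have E1: "(\<Sum>i<n. \<bar>E i\<bar>) \<le> \<theta> * D" .
    have LE: "L2_set E {..<n} \<le> \<theta> * D" "L2_set (\<lambda>i. - E i) {..<n} \<le> \<theta> * D"
      using L2_set_le_sum_abs[of E "{..<n}"] L2_set_le_sum_abs[of "\<lambda>i. - E i" "{..<n}"] E1 by auto
    have diff: "\<pi> x i - \<pi> y i = (x i - y i) + E i" if "i < n" for i
      using that l by (simp add: \<pi>_def scale_vec_apply E_def lx_def[symmetric] ly_def[symmetric] algebra_simps)
    have "euclid_dist n (\<pi> x) (\<pi> y) = L2_set (\<lambda>i. (x i - y i) + E i) {..<n}"
      unfolding euclid_dist_def by (intro L2_set_cong) (auto simp: diff)
    also have "\<dots> \<le> D + L2_set E {..<n}"
      unfolding D_def euclid_dist_def by (rule L2_set_triangle_ineq)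
    also have "\<dots> \<le> (1 + \<theta>) * D" using LE by (simp add: algebra_simps)
    also have "\<dots> \<le> L * D" using \<theta> D by (intro mult_right_mono) auto
    finally have 1: "euclid_dist n (\<pi> x) (\<pi> y) \<le> L * D" .
    have "D = L2_set (\<lambda>i. (\<pi> x i - \<pi> y i) + - E i) {..<n}"
      unfolding D_def euclid_dist_def by (intro L2_set_cong) (auto simp: diff)
    also have "\<dots> \<le> euclid_dist n (\<pi> x) (\<pi> y) + L2_set (\<lambda>i. - E i) {..<n}"
      unfolding euclid_dist_def by (rule L2_set_triangle_ineq)
    also have "\<dots> \<le> euclid_dist n (\<pi> x) (\<pi> y) + \<theta> * D" using LE by simp
    finally have "(1 - \<theta>) * D \<le> euclid_dist n (\<pi> x) (\<pi> y)" by (simp add: algebra_simps)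
    then have "D / L \<le> euclid_dist n (\<pi> x) (\<pi> y)" by (simp add: \<theta>(4))
    then have 2: "D \<le> L * euclid_dist n (\<pi> x) (\<pi> y)" using L by (simp add: divide_le_eq mult.commute)
    show "euclid_dist n (\<pi> x) (\<pi> y) \<le> L * euclid_dist n x y \<and> euclid_dist n x y \<le> L * euclid_dist n (\<pi> x) (\<pi> y)"
      using 1 2 by (simp add: D_def)
  qed
qed

section \<open>The surface measure\<close>

text \<open>The first factor converts Lebesgue into Hausdorff measure in dimension \<open>d\<close>;
  the second undoes the radial integration in \<open>nn_integral_linear_cone\<close>.\<close>

definition surface_const :: "nat \<Rightarrow> real \<Rightarrow> ennreal" where
  "surface_const d p = hausdorff_measure d d (unit_cube d) * ennreal (p + real d)"

lemma surface_const_finite: "surface_const d p < top"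
  using hausdorff_measure_unit_cube[of d] by (simp add: surface_const_def ennreal_mult_less_top)

text \<open>Both set functions are compared with the Lebesgue measure of the same chart domain.
  Lipschitz distortion costs \<open>L ^ d\<close> and the cone comparison
  \<open>L powr (2 * p + d)\<close>; \<open>L\<close> is the root of \<Lambda> for which the product
  is \<Lambda>.\<close>

lemma hausdorff_cone_weight_local:
  assumes p: "p \<ge> 1" and d: "d \<ge> 1" and \<Lambda>: "\<Lambda> > 1"
    and a: "a \<in> lp_sphere (Suc d) p" and nz: "\<And>i. i < Suc d \<Longrightarrow> a i \<noteq> 0"
  obtains \<delta> where "\<delta> > 0"
    "\<And>A. A \<in> sets (borel_vec (Suc d)) \<Longrightarrow> A \<subseteq> lp_sphere (Suc d) p \<Longrightarrow> (\<And>x i. x \<in> A \<Longrightarrow> i < Suc d \<Longrightarrow> \<bar>x i - a i\<bar> < \<delta>) \<Longrightarrow>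
      hausdorff_measure (Suc d) d A \<le> ennreal \<Lambda> * (surface_const d p * cone_weight (Suc d) p A) \<and>
      surface_const d p * cone_weight (Suc d) p A \<le> ennreal \<Lambda> * hausdorff_measure (Suc d) d A"
proof -
  define L where "L = \<Lambda> powr (1 / (2 * p + 2 * real d))"
  have L: "L > 1" unfolding L_def using \<Lambda> p by (intro gr_one_powr) auto
  have L\<Lambda>: "L ^ d * L powr (2 * p + real d) = \<Lambda>"
  proof -
    have "L ^ d * L powr (2 * p + real d) = L powr (2 * p + 2 * real d)"
      using L by (simp add: powr_realpow[symmetric] powr_add[symmetric]) (simp add: add.commute)
    also have "\<dots> = \<Lambda>" unfolding L_def powr_powr using p \<Lambda> by simp
    finally show ?thesis .
  qed
  define g where "g = lp_grad p a"
  have g0: "g 0 \<noteq> 0" using nz[of 0] by (simp add: g_def lp_grad_def sgn_if)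
  have gsum: "(\<Sum>i<Suc d. (g i)\<^sup>2) > 0"
    using g0 by (intro sum_pos2[of _ 0]) auto
  obtain w where w: "(\<Sum>i<Suc d. (w i)\<^sup>2) = 1"
    "\<And>x. householder (Suc d) w x d = (\<Sum>i<Suc d. g i * x i) / sqrt (\<Sum>i<Suc d. (g i)\<^sup>2)"
    \<comment> \<open>As \<open>d \<ge> 1\<close>, coordinate 0 is not the last one, as the
      construction of the reflection demands.\<close>
    by (rule householder_exists[where g=g and i=0 and d=d]) (use d g0 in simp, use g0 in simp, blast)
  interpret sphere_chart d p g w
    by standard (use p w gsum in auto)
  have n1: "Suc d \<ge> 1" by simp
  obtain \<delta> where \<delta>: "\<delta> > 0"
    and e1': "\<And>x. x \<in> lp_sphere (Suc d) p \<Longrightarrow> (\<And>i. i < Suc d \<Longrightarrow> \<bar>x i - a i\<bar> < \<delta>) \<Longrightarrow>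
       1 / L \<le> (\<Sum>i<Suc d. g i * x i) \<and> (\<Sum>i<Suc d. g i * x i) \<le> L \<and>
       sqrt (\<Sum>i<Suc d. (g i)\<^sup>2) / L \<le> lp_weight (Suc d) p x \<and> lp_weight (Suc d) p x \<le> L * sqrt (\<Sum>i<Suc d. (g i)\<^sup>2)"
    and e2': "\<And>x y. x \<in> lp_sphere (Suc d) p \<Longrightarrow> y \<in> lp_sphere (Suc d) p \<Longrightarrow>
       (\<And>i. i < Suc d \<Longrightarrow> \<bar>x i - a i\<bar> < \<delta>) \<Longrightarrow> (\<And>i. i < Suc d \<Longrightarrow> \<bar>y i - a i\<bar> < \<delta>) \<Longrightarrow>
       euclid_dist (Suc d) (scale_vec (Suc d) (1 / (\<Sum>i<Suc d. g i * x i)) x) (scale_vec (Suc d) (1 / (\<Sum>i<Suc d. g i * y i)) y) \<le> L * euclid_dist (Suc d) x y \<and>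
       euclid_dist (Suc d) x y \<le> L * euclid_dist (Suc d) (scale_vec (Suc d) (1 / (\<Sum>i<Suc d. g i * x i)) x) (scale_vec (Suc d) (1 / (\<Sum>i<Suc d. g i * y i)) y)"
    by (rule sphere_local_estimates[OF p n1 L a nz, folded g_def]) (assumption, blast)
  note e1 = e1'[folded r_def lin_def] and e2 = e2'[folded lin_def, folded tangent_proj_def]
  show ?thesis
  proof (rule that[OF \<delta>])
    fix A assume A: "A \<in> sets (borel_vec (Suc d))" and AS: "A \<subseteq> lp_sphere (Suc d) p"
      and near: "\<And>x i. x \<in> A \<Longrightarrow> i < Suc d \<Longrightarrow> \<bar>x i - a i\<bar> < \<delta>"
    have E1: "1 / L \<le> lin x \<and> lin x \<le> L \<and> r / L \<le> lp_weight (Suc d) p x \<and> lp_weight (Suc d) p x \<le> L * r" if "x \<in> A" for x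
      using e1[of x] AS near[OF that] that by blast
    have E2: "euclid_dist (Suc d) (tangent_proj x) (tangent_proj y) \<le> L * euclid_dist (Suc d) x y \<and>
       euclid_dist (Suc d) x y \<le> L * euclid_dist (Suc d) (tangent_proj x) (tangent_proj y)" if "x \<in> A" "y \<in> A" for x y
      using e2[of x y] AS near[OF that(1)] near[OF that(2)] that by blast
    have L0: "L > 0" using L by simp
    have lin0: "lin x > 0" if "x \<in> A" for x
      using E1[OF that] L0 by (meson divide_pos_pos less_le_trans zero_less_one)
    define lam where "lam = emeasure (lborel_vec d) (chart_dom A)"
    define c where "c = hausdorff_measure d d (unit_cube d)"
    define I where "I = cone_weight (Suc d) p A"
    define H where "H = hausdorff_measure (Suc d) d A"
    have q: "p + real d > 0" using p by simp
    have cw: "I \<le> lam * ennreal (L powr (2 * p + real d) / (p + real d))"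
      "lam * ennreal (1 / (p + real d)) \<le> ennreal (L powr (2 * p + real d)) * I"
      using cone_weight_comparison[OF A AS, of L] L E1 by (simp_all add: lam_def I_def)
    have hm: "H \<le> ennreal (L ^ d) * hausdorff_measure d d (chart_dom A)"
      "hausdorff_measure d d (chart_dom A) \<le> ennreal (L ^ d) * H"
      using hausdorff_measure_chart[OF AS L0 lin0] E2 by (simp_all add: H_def)
    have Hd: "hausdorff_measure d d (chart_dom A) = c * lam"
      unfolding c_def lam_def by (rule hausdorff_measure_eq_lborel) (use A in simp)
    have one: "ennreal (p + real d) * ennreal (1 / (p + real d)) = 1"
      using q by (simp add: ennreal_mult[symmetric])
    have C1: "surface_const d p * (lam * ennreal (1 / (p + real d))) = c * lam"
    proof -
      have "surface_const d p * (lam * ennreal (1 / (p + real d))) = c * lam * (ennreal (p + real d) * ennreal (1 / (p + real d)))"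
        by (simp only: surface_const_def c_def mult_ac)
      then show ?thesis by (simp add: one)
    qed
    have LL: "ennreal (L ^ d) * ennreal (L powr (2 * p + real d)) = ennreal \<Lambda>"
      using L0 by (simp add: ennreal_mult[symmetric] L\<Lambda>)
    have "H \<le> ennreal (L ^ d) * (surface_const d p * (lam * ennreal (1 / (p + real d))))"
      using hm(1) by (simp add: Hd C1)
    also have "\<dots> \<le> ennreal (L ^ d) * (surface_const d p * (ennreal (L powr (2 * p + real d)) * I))"
      by (intro mult_left_mono cw(2)) auto
    also have "\<dots> = ennreal \<Lambda> * (surface_const d p * I)"
      unfolding LL[symmetric] by (simp only: mult_ac)
    finally have 1: "H \<le> ennreal \<Lambda> * (surface_const d p * I)" .
    have "surface_const d p * I \<le> surface_const d p * (lam * ennreal (L powr (2 * p + real d) / (p + real d)))"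
      by (intro mult_left_mono cw(1)) auto
    also have "ennreal (L powr (2 * p + real d) / (p + real d)) = ennreal (L powr (2 * p + real d)) * ennreal (1 / (p + real d))"
      using q by (simp add: ennreal_mult[symmetric])
    also have "surface_const d p * (lam * (ennreal (L powr (2 * p + real d)) * ennreal (1 / (p + real d)))) =
        ennreal (L powr (2 * p + real d)) * (surface_const d p * (lam * ennreal (1 / (p + real d))))"
      by (simp only: mult_ac)
    also have "\<dots> \<le> ennreal (L powr (2 * p + real d)) * (ennreal (L ^ d) * H)"
      unfolding C1 using hm(2) unfolding Hd by (rule mult_left_mono) simp
    also have "\<dots> = ennreal \<Lambda> * H" unfolding LL[symmetric] by (simp only: mult_ac)
    finally show "hausdorff_measure (Suc d) d A \<le> ennreal \<Lambda> * (surface_const d p * cone_weight (Suc d) p A) \<and>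
      surface_const d p * cone_weight (Suc d) p A \<le> ennreal \<Lambda> * hausdorff_measure (Suc d) d A"
      using 1 by (simp add: H_def I_def)
  qed
qed

text \<open>The cover is made disjoint. The assumed inequality concerns all measurable subsets of a
  member, hence also the disjoint pieces of \<open>A\<close>, over which it is summed.\<close>

lemma emeasure_le_on_countable_Union:
  assumes sets: "sets \<mu> = sets \<nu>" and cnt: "countable \<B>" and \<B>: "\<B> \<subseteq> sets \<mu>"
    and le: "\<And>B A. B \<in> \<B> \<Longrightarrow> A \<in> sets \<mu> \<Longrightarrow> A \<subseteq> B \<Longrightarrow> A \<subseteq> S \<Longrightarrow> emeasure \<mu> A \<le> k * emeasure \<nu> A"
    and A: "A \<in> sets \<mu>" "A \<subseteq> \<Union>\<B>" "A \<subseteq> S"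
  shows "emeasure \<mu> A \<le> k * emeasure \<nu> A"
proof (cases "\<B> = {}")
  case True
  then show ?thesis using A by simp
next
  case False
  define U where "U = from_nat_into \<B>"
  have U: "range U = \<B>" unfolding U_def by (rule range_from_nat_into[OF False cnt])
  define D where "D i = A \<inter> disjointed U i" for i
  have Us: "range U \<subseteq> sets \<mu>" using \<B> U by simp
  have dis: "range (disjointed U) \<subseteq> sets \<mu>" by (rule sets.range_disjointed_sets[OF Us])
  have Ds: "range D \<subseteq> sets \<mu>" using A dis by (auto simp: D_def)
  have Dd: "disjoint_family D"
    unfolding D_def by (rule disjoint_family_on_bisimulation[OF disjoint_family_disjointed[of U]]) auto
  have DA: "(\<Union>i. D i) = A"
    using A(2) UN_disjointed_eq[of U] U by (auto simp: D_def)
  have "emeasure \<mu> A = (\<Sum>i. emeasure \<mu> (D i))"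
    using suminf_emeasure[OF Ds Dd] DA by simp
  also have "\<dots> \<le> (\<Sum>i. k * emeasure \<nu> (D i))"
  proof (intro suminf_le)
    fix i
    have "D i \<subseteq> U i" using disjointed_subset[of U i] by (auto simp: D_def)
    then show "emeasure \<mu> (D i) \<le> k * emeasure \<nu> (D i)"
      using Ds A(3) U by (intro le[of "U i"]) (auto simp: D_def)
  qed auto
  also have "\<dots> = k * (\<Sum>i. emeasure \<nu> (D i))" by (rule ennreal_suminf_cmult)
  also have "(\<Sum>i. emeasure \<nu> (D i)) = emeasure \<nu> A"
    using suminf_emeasure[of D \<nu>] Ds Dd DA sets by simp
  finally show ?thesis .
qed

lemma ennreal_le_if_le_mult:
  fixes x y :: ennreal
  assumes "\<And>\<Lambda>::real. \<Lambda> > 1 \<Longrightarrow> x \<le> ennreal \<Lambda> * y"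
  shows "x \<le> y"
proof (cases y rule: ennreal_cases)
  case (real r)
  show ?thesis
  proof (rule ennreal_le_epsilon)
    fix e :: real assume e: "e > 0"
    \<comment> \<open>The denominator \<open>r + 1\<close> covers the case
      \<open>r = 0\<close>.\<close>
    define \<Lambda> where "\<Lambda> = 1 + e / (r + 1)"
    have \<Lambda>: "\<Lambda> > 1" using e real by (simp add: \<Lambda>_def)
    have "x \<le> ennreal (\<Lambda> * r)" using assms[OF \<Lambda>] real \<Lambda> by (simp add: ennreal_mult)
    also have "\<Lambda> * r \<le> r + e"
    proof -
      have "e / (r + 1) * r \<le> e" using e real by (simp add: divide_le_eq mult_left_mono)
      then show ?thesis by (simp add: \<Lambda>_def distrib_right)
    qed
    then have "ennreal (\<Lambda> * r) \<le> y + ennreal e" using real e by (simp add: ennreal_plus[symmetric] del: ennreal_plus)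
    finally show "x \<le> y + ennreal e" .
  qed
qed simp

section \<open>Null sets: spheres and their coordinate sections\<close>

lemma emeasure_lp_sphere_null:
  assumes p: "p > 0" and n: "n \<ge> 1"
  shows "emeasure (lborel_vec n) (lp_sphere n p) = 0"
proof -
  let ?l = "emeasure (lborel_vec n)"
  have fin: "?l (lp_ball n p) < top"
    using emeasure_lp_ball_pos_finite(2)[OF p, of n] by (simp add: less_top)
  \<comment> \<open>The sphere and the ball of radius \<open>s\<close> are disjoint parts of the
    unit ball; as \<open>s\<close> tends to 1, no volume is left for the sphere.\<close>
  have le: "?l (lp_sphere n p) + ennreal (s ^ n) * ?l (lp_ball n p) \<le> ?l (lp_ball n p)" if s: "0 < s" "s < 1" for s
  proof -
    define T where "T = {x \<in> space (borel_vec n). lp_norm n p x \<le> s}"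
    have T: "T \<in> sets (borel_vec n)" unfolding T_def by measurable
    have "(\<integral>\<^sup>+x. indicator T (scale_vec n s x) \<partial>lborel_vec n) = ennreal ((1 / s) ^ n) * (\<integral>\<^sup>+x. indicator T x \<partial>lborel_vec n)"
      using T s by (intro nn_integral_scale_vec) auto
    moreover have "(\<integral>\<^sup>+x. indicator T (scale_vec n s x) \<partial>lborel_vec n) = (\<integral>\<^sup>+x. indicator (lp_ball n p) x \<partial>lborel_vec n)"
    proof (rule nn_integral_cong)
      fix x assume "x \<in> space (lborel_vec n)"
      then have "scale_vec n s x \<in> T \<longleftrightarrow> x \<in> lp_ball n p"
        using s p by (simp add: T_def lp_norm_scale_vec) (simp add: lp_ball_def space_PiM)
      then show "indicator T (scale_vec n s x) = (indicator (lp_ball n p) x :: ennreal)" by (simp add: indicator_def)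
    qed
    ultimately have "?l (lp_ball n p) = ennreal ((1 / s) ^ n) * ?l T"
      using T by (simp add: nn_integral_indicator sets_lborel_vec)
    then have "ennreal (s ^ n) * ?l (lp_ball n p) = ennreal (s ^ n * (1 / s) ^ n) * ?l T"
      using s by (simp add: ennreal_mult mult.assoc)
    also have "s ^ n * (1 / s) ^ n = 1" using s by (simp add: power_mult_distrib[symmetric])
    finally have e: "ennreal (s ^ n) * ?l (lp_ball n p) = ?l T" by simp
    have "?l (lp_sphere n p) + ennreal (s ^ n) * ?l (lp_ball n p) = ?l (lp_sphere n p \<union> T)"
    proof -
      have "x \<notin> T" if "x \<in> lp_sphere n p" for x
        using that s unfolding T_def lp_sphere_def by simp
      then have disj: "lp_sphere n p \<inter> T = {}" by blast
      have "T \<in> sets (lborel_vec n)" "lp_sphere n p \<in> sets (lborel_vec n)"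
        using T lp_sphere_sets[of n p] by (simp_all only: sets_lborel_vec)
      then show ?thesis unfolding e using disj by (intro plus_emeasure)
    qed
    also have "\<dots> \<le> ?l (lp_ball n p)"
    proof (rule emeasure_mono)
      show "lp_sphere n p \<union> T \<subseteq> lp_ball n p"
      proof
        fix x assume "x \<in> lp_sphere n p \<union> T"
        then have "x \<in> real_vec n \<and> (lp_norm n p x = 1 \<or> lp_norm n p x \<le> s)"
          unfolding T_def lp_sphere_def space_PiM space_borel by blast
        then have "x \<in> real_vec n" "lp_norm n p x \<le> 1" using s by linarith+
        then show "x \<in> lp_ball n p" unfolding lp_ball_def by blast
      qed
      show "lp_ball n p \<in> sets (lborel_vec n)" using lp_ball_sets[of n p] by (simp only: sets_lborel_vec)
    qed
    finally show ?thesis .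
  qed
  obtain b where b: "?l (lp_ball n p) = ennreal b" "b \<ge> 0" using fin by (cases "?l (lp_ball n p)" rule: ennreal_cases) auto
  have "?l (lp_sphere n p) \<le> ?l (lp_ball n p)"
  proof (rule emeasure_mono)
    show "lp_sphere n p \<subseteq> lp_ball n p" unfolding lp_sphere_def lp_ball_def by (intro Collect_mono) simp
    show "lp_ball n p \<in> sets (lborel_vec n)" using lp_ball_sets[of n p] by (simp only: sets_lborel_vec)
  qed
  then obtain z where z: "?l (lp_sphere n p) = ennreal z" "z \<ge> 0"
    using b by (cases "?l (lp_sphere n p)" rule: ennreal_cases) (auto simp: top_unique)
  have "z + s ^ n * b \<le> b" if "0 < s" "s < 1" for s
    using le[OF that] that b z by (simp add: ennreal_mult[symmetric] ennreal_plus[symmetric] del: ennreal_plus)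
  then have "\<forall>\<^sub>F s in at_left (1::real). z + s ^ n * b \<le> b"
    by (intro eventually_at_leftI[of 0]) auto
  moreover have "((\<lambda>s::real. z + s ^ n * b) \<longlongrightarrow> z + 1 ^ n * b) (at_left 1)"
    by (intro tendsto_intros)
  ultimately have "z + 1 ^ n * b \<le> b"
    by (intro tendsto_upperbound[of _ _ "at_left (1::real)"]) auto
  then show ?thesis using z by simp
qed

text \<open>Inserting a zero coordinate maps the sphere of one dimension less isometrically onto the
  section. In that smaller space \<open>d\<close> is the full dimension, so the Hausdorff measure is
  a multiple of Lebesgue measure, for which spheres are null.\<close>

lemma hausdorff_measure_sphere_hyperplane:
  assumes p: "p > 0" and d: "d \<ge> 1" and m: "m < Suc d"
  shows "hausdorff_measure (Suc d) d {x \<in> lp_sphere (Suc d) p. x m = 0} = 0"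
proof -
  let ?A = "{x \<in> lp_sphere (Suc d) p. x m = 0}"
  define ins where "ins u = (\<lambda>i\<in>{..<Suc d}. if i < m then u i else if i = m then 0 else u (i - 1))" for u :: "nat \<Rightarrow> real"
  have split: "(\<Sum>i<Suc d. h (ins u i)) = h 0 + (\<Sum>i<d. h (u i))" for h :: "real \<Rightarrow> real" and u
  proof -
    have "(\<Sum>i<Suc d. h (ins u i)) = h (ins u m) + (\<Sum>i\<in>{..<Suc d} - {m}. h (ins u i))"
      using m by (intro sum.remove) auto
    also have "(\<Sum>i\<in>{..<Suc d} - {m}. h (ins u i)) = (\<Sum>i<d. h (u i))"
      by (rule sum.reindex_bij_witness[where i="\<lambda>i. if i < m then i else Suc i" and j="\<lambda>i. if i < m then i else i - 1"])
         (use m in \<open>auto simp: ins_def split: if_splits\<close>)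
    finally show ?thesis using m by (simp add: ins_def)
  qed
  have sph: "ins u \<in> lp_sphere (Suc d) p" if "u \<in> lp_sphere d p" for u
    using that split[of "\<lambda>t. \<bar>t\<bar> powr p" u] by (auto simp: lp_sphere_def lp_norm_def) (auto simp: ins_def)
  have "?A \<subseteq> ins ` lp_sphere d p"
  proof
    fix x assume x: "x \<in> ?A"
    define u where "u = (\<lambda>i\<in>{..<d}. if i < m then x i else x (Suc i))"
    have "x = ins u"
    proof
      fix i show "x i = ins u i"
      proof (cases "i < Suc d")
        case True
        then show ?thesis using x m by (cases i) (auto simp: ins_def u_def)
      next
        case False
        then show ?thesis using x by (auto simp: ins_def lp_sphere_def PiE_def extensional_def)
      qed
    qed
    moreover have "u \<in> lp_sphere d p"
      using x split[of "\<lambda>t. \<bar>t\<bar> powr p" u] unfolding \<open>x = ins u\<close>[symmetric] by (auto simp: lp_sphere_def lp_norm_def u_def)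
    ultimately show "x \<in> ins ` lp_sphere d p" by blast
  qed
  then have "hausdorff_measure (Suc d) d ?A \<le> hausdorff_measure (Suc d) d (ins ` lp_sphere d p)"
    by (rule hausdorff_measure_mono)
  also have "\<dots> \<le> ennreal (1 ^ d) * hausdorff_measure d d (lp_sphere d p)"
  proof (rule hausdorff_measure_Lipschitz_image)
    show "ins ` lp_sphere d p \<subseteq> real_vec (Suc d)" using sph by (auto simp: lp_sphere_def)
    fix u v :: "nat \<Rightarrow> real"
    have "(\<Sum>i<Suc d. (ins u i - ins v i)\<^sup>2) = (\<Sum>i<Suc d. (ins (\<lambda>i. u i - v i) i)\<^sup>2)"
      by (intro sum.cong) (auto simp: ins_def)
    also have "\<dots> = (\<Sum>i<d. (u i - v i)\<^sup>2)" using split[of "\<lambda>t. t\<^sup>2" "\<lambda>i. u i - v i"] by simp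
    finally show "euclid_dist (Suc d) (ins u) (ins v) \<le> 1 * euclid_dist d u v"
      by (simp add: euclid_dist_def L2_set_def)
  qed simp
  also have "hausdorff_measure d d (lp_sphere d p) = 0"
    by (subst hausdorff_measure_eq_lborel) (auto simp: emeasure_lp_sphere_null[OF p d])
  finally show ?thesis by simp
qed

text \<open>\<open>cone_weight\<close> as a genuine measure, to make null sets and countable
  partitions available.\<close>

definition cone_weight_measure :: "nat \<Rightarrow> real \<Rightarrow> (nat \<Rightarrow> real) measure" where
  "cone_weight_measure n p = distr (density (lborel_vec n) (\<lambda>x. ennreal (lp_weight n p x) * indicator (lp_ball n p) x)) (borel_vec n) (lp_proj n p)"

lemma emeasure_cone_weight_measure:
  assumes [measurable]: "A \<in> sets (borel_vec n)"
  shows "emeasure (cone_weight_measure n p) A = cone_weight n p A"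
proof -
  have v: "lp_proj n p -` A \<inter> space (borel_vec n) \<in> sets (lborel_vec n)"
    using measurable_sets[OF lp_proj_measurable[of n p], of A] by (simp add: sets_lborel_vec)
  have "emeasure (cone_weight_measure n p) A =
      emeasure (density (lborel_vec n) (\<lambda>x. ennreal (lp_weight n p x) * indicator (lp_ball n p) x)) (lp_proj n p -` A \<inter> space (borel_vec n))"
    unfolding cone_weight_measure_def by (subst emeasure_distr) auto
  also have "\<dots> = (\<integral>\<^sup>+x. ennreal (lp_weight n p x) * indicator (lp_ball n p) x * indicator (lp_proj n p -` A \<inter> space (borel_vec n)) x \<partial>lborel_vec n)"
    by (rule emeasure_density) (use v in auto)
  also have "\<dots> = cone_weight n p A"
    unfolding cone_weight_def by (intro nn_integral_cong) (auto simp: indicator_def)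
  finally show ?thesis .
qed

text \<open>Radial projection preserves whether a coordinate vanishes, so only a Lebesgue null
  hyperplane contributes.\<close>

lemma cone_weight_hyperplane:
  assumes p: "p > 0" and m: "m < n"
  shows "cone_weight n p {x \<in> lp_sphere n p. x m = 0} = 0"
proof -
  define I where "I = {..<n} - {m}"
  have I: "finite I" "m \<notin> I" "{..<n} = insert m I" using m by (auto simp: I_def)
  have [measurable]: "(\<lambda>x. x m) \<in> borel_measurable (borel_vec n)" using m by simp
  have [measurable]: "{x \<in> space (borel_vec n). x m = 0} \<in> sets (borel_vec n)" by measurable
  have "emeasure (lborel_vec n) {x \<in> space (borel_vec n). x m = 0} = (\<integral>\<^sup>+x. indicator {x \<in> space (borel_vec n). x m = 0} x \<partial>lborel_vec n)"
    by (simp add: nn_integral_indicator sets_lborel_vec)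
  also have "\<dots> = (\<integral>\<^sup>+x. (\<integral>\<^sup>+y. indicator {x \<in> space (borel_vec n). x m = 0} (x(m := y)) \<partial>lborel) \<partial>PiM I (\<lambda>_. lborel))"
    unfolding I(3) by (rule lborel_PiM.product_nn_integral_insert) (use I in \<open>simp_all flip: I(3)\<close>)
  also have "\<dots> \<le> (\<integral>\<^sup>+x. (\<integral>\<^sup>+y. indicator {0} y \<partial>(lborel :: real measure)) \<partial>PiM I (\<lambda>_. lborel :: real measure))"
    by (intro nn_integral_mono) (auto simp: indicator_def)
  also have "\<dots> = 0" by simp
  finally have "{x \<in> space (borel_vec n). x m = 0} \<in> null_sets (lborel_vec n)" by (simp add: null_sets_def sets_lborel_vec)
  then have ae: "AE x in lborel_vec n. x \<notin> {x \<in> space (borel_vec n). x m = 0}" by (rule AE_not_in)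
  have "cone_weight n p {x \<in> lp_sphere n p. x m = 0} = (\<integral>\<^sup>+x. 0 \<partial>lborel_vec n)"
    unfolding cone_weight_def
  proof (intro nn_integral_cong_AE, use ae AE_space in eventually_elim)
    fix x assume x: "x \<notin> {x \<in> space (borel_vec n). x m = 0}" "x \<in> space (lborel_vec n)"
    have "lp_proj n p x \<notin> {x \<in> lp_sphere n p. x m = 0}"
    proof
      assume *: "lp_proj n p x \<in> {x \<in> lp_sphere n p. x m = 0}"
      then have "lp_norm n p x > 0" using lp_proj_in_sphere(1)[OF p, of n x] x by simp
      with * m x show False by (simp add: lp_proj_def scale_vec_apply)
    qed
    then show "indicator {x \<in> lp_sphere n p. x m = 0} (lp_proj n p x) * ennreal (lp_weight n p x) * indicator (lp_ball n p) x = 0" by simp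
  qed
  then show ?thesis by simp
qed

lemma lp_sphere_hyperplane_sets [measurable]:
  assumes "m < n"
  shows "{x \<in> lp_sphere n p. x m = 0} \<in> sets (borel_vec n)"
proof -
  have [measurable]: "(\<lambda>x. x m) \<in> borel_measurable (borel_vec n)" using assms by simp
  have "{x \<in> lp_sphere n p. x m = 0} = {x \<in> space (borel_vec n). x m = 0} \<inter> lp_sphere n p"
    by (auto simp: lp_sphere_def space_PiM)
  then show ?thesis by simp
qed

theorem hausdorff_measure_sphere:
  assumes p: "p \<ge> 1" and d: "d \<ge> 1"
    and A: "A \<in> sets (borel_vec (Suc d))" "A \<subseteq> lp_sphere (Suc d) p"
  shows "hausdorff_measure (Suc d) d A = surface_const d p * cone_weight (Suc d) p A"
proof -
  let ?n = "Suc d"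
  let ?S = "lp_sphere ?n p"
  have p0: "p > 0" using p by simp
  define \<mu> where "\<mu> = hausdorff_borel ?n d"
  define \<nu> where "\<nu> = scale_measure (surface_const d p) (cone_weight_measure ?n p)"
  have sets: "sets \<mu> = sets (borel_vec ?n)" "sets \<nu> = sets (borel_vec ?n)"
    by (auto simp: \<mu>_def \<nu>_def cone_weight_measure_def)
  have \<mu>: "emeasure \<mu> B = hausdorff_measure ?n d B" if "B \<in> sets (borel_vec ?n)" for B
    using that by (simp add: \<mu>_def emeasure_hausdorff_borel)
  have \<nu>: "emeasure \<nu> B = surface_const d p * cone_weight ?n p B" if "B \<in> sets (borel_vec ?n)" for B
    using that by (simp add: \<nu>_def emeasure_cone_weight_measure)
  define N where "N = (\<Union>m<?n. {x \<in> ?S. x m = 0})"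
  have N\<mu>: "N \<in> null_sets \<mu>"
    unfolding N_def
  proof (intro null_sets.finite_UN)
    fix m assume "m \<in> {..<?n}"
    then show "{x \<in> ?S. x m = 0} \<in> null_sets \<mu>"
      using hausdorff_measure_sphere_hyperplane[OF p0 d, of m] by (simp add: null_sets_def sets \<mu>)
  qed simp
  have N\<nu>: "N \<in> null_sets \<nu>"
    unfolding N_def
  proof (intro null_sets.finite_UN)
    fix m assume "m \<in> {..<?n}"
    then show "{x \<in> ?S. x m = 0} \<in> null_sets \<nu>"
      using cone_weight_hyperplane[OF p0, of m ?n] by (simp add: null_sets_def sets \<nu>)
  qed simp
  define G where "G = {x \<in> ?S. \<forall>i<?n. x i \<noteq> 0}"
  have main: "emeasure \<mu> B \<le> ennreal \<Lambda> * emeasure \<nu> B \<and> emeasure \<nu> B \<le> ennreal \<Lambda> * emeasure \<mu> B"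
    if \<Lambda>: "\<Lambda> > 1" and B: "B \<in> sets (borel_vec ?n)" "B \<subseteq> G" for B \<Lambda>
  proof -
    define box where "box v = {x \<in> space (borel_vec ?n). \<forall>i<?n. fst (v i) < x i \<and> x i < snd (v i)}" for v :: "nat \<Rightarrow> real \<times> real"
    \<comment> \<open>Quantifying over all Borel subsets of the sphere in \<open>U\<close> lets the
      property pass to the pieces of a disjoint refinement.\<close>
    define good where "good U \<longleftrightarrow> (\<forall>B. B \<in> sets (borel_vec ?n) \<longrightarrow> B \<subseteq> U \<longrightarrow> B \<subseteq> ?S \<longrightarrow>
       emeasure \<mu> B \<le> ennreal \<Lambda> * emeasure \<nu> B \<and> emeasure \<nu> B \<le> ennreal \<Lambda> * emeasure \<mu> B)" for U
    \<comment> \<open>Rational endpoints leave countably many boxes, although the admissible size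
      depends on the point.\<close>
    define V where "V = Pi\<^sub>E {..<?n} (\<lambda>_. \<rat> \<times> \<rat> :: (real \<times> real) set)"
    have V: "countable V" unfolding V_def by (intro countable_PiE) (auto simp: countable_rat)
    define \<B> where "\<B> = {U \<in> box ` V. good U}"
    have cnt: "countable \<B>" unfolding \<B>_def by (rule countable_subset[OF _ countable_image[OF V, of box]]) blast
    have box_sets: "box v \<in> sets (borel_vec ?n)" for v
    proof -
      have "box v = space (borel_vec ?n) \<inter> (\<Inter>i\<in>{..<?n}. {x \<in> space (borel_vec ?n). fst (v i) < x i \<and> x i < snd (v i)})"
        by (auto simp: box_def)
      also have "\<dots> \<in> sets (borel_vec ?n)"
      proof (intro sets.Int sets.top sets.finite_INT)
        fix i assume "i \<in> {..<?n}"
        then have [measurable]: "(\<lambda>x. x i) \<in> borel_measurable (borel_vec ?n)" by simp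
        show "{x \<in> space (borel_vec ?n). fst (v i) < x i \<and> x i < snd (v i)} \<in> sets (borel_vec ?n)" by measurable
      qed auto
      finally show ?thesis .
    qed
    have \<B>_sets: "\<B> \<subseteq> sets (borel_vec ?n)" using box_sets by (auto simp: \<B>_def)
    have cover: "G \<subseteq> \<Union>\<B>"
    proof
      fix a assume a: "a \<in> G"
      then have aS: "a \<in> ?S" and nz: "\<And>i. i < ?n \<Longrightarrow> a i \<noteq> 0" by (auto simp: G_def)
      obtain \<delta> where \<delta>: "\<delta> > 0" and loc:
        "\<And>A. A \<in> sets (borel_vec ?n) \<Longrightarrow> A \<subseteq> ?S \<Longrightarrow> (\<And>x i. x \<in> A \<Longrightarrow> i < ?n \<Longrightarrow> \<bar>x i - a i\<bar> < \<delta>) \<Longrightarrow>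
          hausdorff_measure ?n d A \<le> ennreal \<Lambda> * (surface_const d p * cone_weight ?n p A) \<and>
          surface_const d p * cone_weight ?n p A \<le> ennreal \<Lambda> * hausdorff_measure ?n d A"
        by (rule hausdorff_cone_weight_local[OF p d \<Lambda> aS nz]) blast+
      have "\<exists>q. q \<in> \<rat> \<times> \<rat> \<and> a i - \<delta> < fst q \<and> fst q < a i \<and> a i < snd q \<and> snd q < a i + \<delta>" for i
      proof -
        obtain q1 where "q1 \<in> \<rat>" "a i - \<delta> < q1" "q1 < a i" using Rats_dense_in_real[of "a i - \<delta>" "a i"] \<delta> by auto
        moreover obtain q2 where "q2 \<in> \<rat>" "a i < q2" "q2 < a i + \<delta>" using Rats_dense_in_real[of "a i" "a i + \<delta>"] \<delta> by auto
        ultimately show ?thesis by (intro exI[of _ "(q1, q2)"]) auto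
      qed
      then obtain q where q: "\<And>i. q i \<in> \<rat> \<times> \<rat>" "\<And>i. a i - \<delta> < fst (q i)" "\<And>i. fst (q i) < a i" "\<And>i. a i < snd (q i)" "\<And>i. snd (q i) < a i + \<delta>"
        by metis
      define v where "v = restrict q {..<?n}"
      have "v \<in> V" using q(1) by (auto simp: v_def V_def)
      moreover have "good (box v)"
        unfolding good_def
      proof (intro allI impI)
        fix B assume B: "B \<in> sets (borel_vec ?n)" "B \<subseteq> box v" "B \<subseteq> ?S"
        have "\<bar>x i - a i\<bar> < \<delta>" if "x \<in> B" "i < ?n" for x i
        proof -
          have "fst (q i) < x i" "x i < snd (q i)" using that B(2) by (auto simp: box_def v_def)
          then show ?thesis using q(2)[of i] q(5)[of i] by linarith
        qed
        then show "emeasure \<mu> B \<le> ennreal \<Lambda> * emeasure \<nu> B \<and> emeasure \<nu> B \<le> ennreal \<Lambda> * emeasure \<mu> B"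
          using loc[OF B(1,3)] by (simp add: \<mu>[OF B(1)] \<nu>[OF B(1)])
      qed
      moreover have "a \<in> box v" using aS q by (auto simp: box_def v_def lp_sphere_def space_PiM)
      ultimately show "a \<in> \<Union>\<B>" by (auto simp: \<B>_def)
    qed
    have BS: "B \<subseteq> ?S" using B by (auto simp: G_def)
    have "emeasure \<mu> B \<le> ennreal \<Lambda> * emeasure \<nu> B"
    proof (rule emeasure_le_on_countable_Union[OF _ cnt, where S="?S"])
      fix U D assume "U \<in> \<B>" "D \<in> sets \<mu>" "D \<subseteq> U" "D \<subseteq> ?S"
      then show "emeasure \<mu> D \<le> ennreal \<Lambda> * emeasure \<nu> D" by (auto simp: \<B>_def good_def sets)
    qed (use B BS \<B>_sets cover in \<open>auto simp: sets\<close>)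
    moreover have "emeasure \<nu> B \<le> ennreal \<Lambda> * emeasure \<mu> B"
    proof (rule emeasure_le_on_countable_Union[OF _ cnt, where S="?S"])
      fix U D assume "U \<in> \<B>" "D \<in> sets \<nu>" "D \<subseteq> U" "D \<subseteq> ?S"
      then show "emeasure \<nu> D \<le> ennreal \<Lambda> * emeasure \<mu> D" by (auto simp: \<B>_def good_def sets)
    qed (use B BS \<B>_sets cover in \<open>auto simp: sets\<close>)
    ultimately show ?thesis ..
  qed
  have AN: "A - N \<in> sets (borel_vec ?n)" "A - N \<subseteq> G"
    using A N\<mu> by (auto simp: sets null_sets_def G_def N_def)
  have "emeasure \<mu> (A - N) = emeasure \<nu> (A - N)"
    by (rule antisym; rule ennreal_le_if_le_mult) (use main[OF _ AN] in blast)+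
  then have "emeasure \<mu> A = emeasure \<nu> A"
    using emeasure_Diff_null_set[OF N\<mu>, of A] emeasure_Diff_null_set[OF N\<nu>, of A] A by (simp add: sets)
  then show ?thesis using A by (simp add: \<mu> \<nu>)
qed

text \<open>\<open>surface_const\<close> cancels in the normalization. As with the cone measure,
  \<open>pr\<close> excludes the zero default; moreover it shows that the normalizing factor is
  neither 0 nor infinite.\<close>

lemma emeasure_surface_measure:
  assumes p: "p \<ge> 1" and d: "d \<ge> 1"
    and pr: "prob_space (surface_measure (Suc d) p)" and A: "A \<in> sets (borel_vec (Suc d))"
  shows "emeasure (surface_measure (Suc d) p) A = cone_weight (Suc d) p (A \<inter> lp_sphere (Suc d) p) / cone_weight (Suc d) p (lp_sphere (Suc d) p)"
    "cone_weight (Suc d) p (lp_sphere (Suc d) p) \<noteq> 0" "cone_weight (Suc d) p (lp_sphere (Suc d) p) \<noteq> top"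
proof -
  let ?n = "Suc d"
  let ?S = "lp_sphere ?n p" and ?I = "cone_weight ?n p"
  define f where "f A = hausdorff_measure ?n (?n - 1) (A \<inter> ?S) / hausdorff_measure ?n (?n - 1) ?S" for A
  let ?ok = "measure_space (space (borel_vec ?n)) (sets (borel_vec ?n)) f"
  have em: "emeasure (surface_measure ?n p) A = (if A \<in> sets (borel_vec ?n) \<and> ?ok then f A else 0)" for A
    unfolding surface_measure_def f_def[abs_def] by (rule emeasure_measure_of_borel_vec)
  have f: "f B = (surface_const d p * ?I (B \<inter> ?S)) / (surface_const d p * ?I ?S)" if "B \<in> sets (borel_vec ?n)" for B
    using hausdorff_measure_sphere[OF p d, of "B \<inter> ?S"] hausdorff_measure_sphere[OF p d, of ?S] that
    by (simp add: f_def)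
  have "space (surface_measure ?n p) = space (borel_vec ?n)"
    by (simp add: surface_measure_def space_measure_of_conv)
  then have "emeasure (surface_measure ?n p) (space (borel_vec ?n)) = 1"
    using prob_space.emeasure_space_1[OF pr] by simp
  then have ok: ?ok and f1: "f (space (borel_vec ?n)) = 1" by (auto simp: em split: if_splits)
  have "space (borel_vec ?n) \<inter> ?S = ?S" by (auto simp: lp_sphere_def space_PiM)
  then have q: "(surface_const d p * ?I ?S) / (surface_const d p * ?I ?S) = 1"
    using f1 f[of "space (borel_vec ?n)"] by simp
  \<comment> \<open>In \<open>ennreal\<close> both \<open>0 / 0\<close> and \<open>top / top\<close>
    are 0, so a quotient equal to 1 excludes them.\<close>
  then have nz: "surface_const d p * ?I ?S \<noteq> 0" "surface_const d p * ?I ?S \<noteq> top"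
    by (auto simp: divide_ennreal_def)
  then show I0: "?I ?S \<noteq> 0" by auto
  have C0: "surface_const d p \<noteq> 0" using nz by auto
  show It: "?I ?S \<noteq> top" using nz C0 by (auto simp: ennreal_mult_top)
  have "?I (A \<inter> ?S) \<le> ?I ?S"
    unfolding cone_weight_def by (intro nn_integral_mono mult_right_mono) (auto simp: indicator_def)
  then obtain x where x: "?I (A \<inter> ?S) = ennreal x" "x \<ge> 0" using It by (cases "?I (A \<inter> ?S)" rule: ennreal_cases) (auto simp: top_unique)
  obtain y where y: "?I ?S = ennreal y" "y \<ge> 0" using It by (cases "?I ?S" rule: ennreal_cases) auto
  obtain c where c: "surface_const d p = ennreal c" "c \<ge> 0"
    using surface_const_finite[of d p] by (cases "surface_const d p" rule: ennreal_cases) auto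
  have pos: "y > 0" "c > 0" using I0 C0 y c by (auto simp: less_le)
  have "emeasure (surface_measure ?n p) A = (ennreal c * ennreal x) / (ennreal c * ennreal y)"
    using A ok by (simp add: em f x y c)
  also have "\<dots> = ennreal x / ennreal y"
    using pos x by (simp add: ennreal_mult[symmetric] divide_ennreal)
  finally show "emeasure (surface_measure ?n p) A = ?I (A \<inter> ?S) / ?I ?S" by (simp add: x y)
qed

section \<open>The limit theorem\<close>

text \<open>Away from the origin the projection lies on the sphere, and it belongs to
  \<open>G\<close> exactly when \<open>x\<close> does.\<close>

lemma cone_weight_scale_invariant:
  assumes n: "n \<ge> 1" and p: "p > 0" and G: "scale_invariant n G"
  shows "cone_weight n p (G \<inter> lp_sphere n p) =
    (\<integral>\<^sup>+x. indicator G x * ennreal (lp_weight n p x) * indicator (lp_ball n p) x \<partial>lborel_vec n)"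
  unfolding cone_weight_def
proof (intro nn_integral_cong_AE, use AE_not_in[OF zero_vec_null[OF n]] AE_space in eventually_elim)
  fix x assume x: "x \<notin> {\<lambda>i\<in>{..<n}. 0}" "x \<in> space (lborel_vec n)"
  then have sp: "x \<in> space (borel_vec n)" by simp
  have "lp_norm n p x \<noteq> 0" using lp_norm_eq_0[OF _ sp, of p] x by auto
  then have N: "lp_norm n p x > 0" using lp_norm_nonneg[of n p x] by linarith
  have "lp_proj n p x \<in> lp_sphere n p"
    using N p by (simp add: lp_sphere_def lp_proj_def lp_norm_scale_vec)
  moreover have "lp_proj n p x \<in> G \<longleftrightarrow> x \<in> G"
    unfolding lp_proj_def using N by (intro scale_invariantD[OF G _ sp]) simp
  ultimately show "indicator (G \<inter> lp_sphere n p) (lp_proj n p x) * ennreal (lp_weight n p x) * indicator (lp_ball n p) x =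
      indicator G x * ennreal (lp_weight n p x) * indicator (lp_ball n p) x"
    by (simp add: indicator_def)
qed

text \<open>The density of the surface measure with respect to the cone measure is proportional to the
  weight, whose homogeneity permits replacing the cone measure by the \<open>p\<close>-Gaussian one.\<close>

lemma emeasure_surface_measure_cone:
  assumes n: "n \<ge> 2" and p: "p \<ge> 1" and pr: "prob_space (surface_measure n p)" and G: "scale_invariant n G"
  shows "emeasure (surface_measure n p) G =
      (\<integral>\<^sup>+x. indicator G x * ennreal (lp_weight n p x) \<partial>p_gaussian_vec n p) / (\<integral>\<^sup>+x. ennreal (lp_weight n p x) \<partial>p_gaussian_vec n p)"
proof -
  obtain d where d: "n = Suc d" "d \<ge> 1" using n by (cases n) auto
  have p0: "p > 0" and n1: "n \<ge> 1" using p n by auto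
  have Gs: "G \<in> sets (borel_vec n)" using G by (simp add: scale_invariant_def)
  have \<alpha>: "p - 1 \<ge> 0" using p by simp
  obtain K where K: "K > 0" and hom:
    "\<And>F :: (nat \<Rightarrow> real) \<Rightarrow> ennreal. F \<in> borel_measurable (borel_vec n) \<Longrightarrow>
      (\<And>s x. s > 0 \<Longrightarrow> x \<in> space (borel_vec n) \<Longrightarrow> F (scale_vec n s x) = ennreal (s powr (p - 1)) * F x) \<Longrightarrow>
      (\<integral>\<^sup>+x. F x \<partial>p_gaussian_vec n p) = ennreal K * (\<integral>\<^sup>+x. F x * indicator (lp_ball n p) x \<partial>lborel_vec n)"
    by (rule nn_integral_p_gaussian_vec_homogeneous[OF p0 \<alpha>, of n]) blast
  have int: "(\<integral>\<^sup>+x. indicator H x * ennreal (lp_weight n p x) \<partial>p_gaussian_vec n p) = ennreal K * cone_weight n p (H \<inter> lp_sphere n p)"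
    if H: "scale_invariant n H" for H
  proof -
    have Hs [measurable]: "H \<in> sets (borel_vec n)" using H by (simp add: scale_invariant_def)
    have "(\<integral>\<^sup>+x. indicator H x * ennreal (lp_weight n p x) \<partial>p_gaussian_vec n p) =
        ennreal K * (\<integral>\<^sup>+x. indicator H x * ennreal (lp_weight n p x) * indicator (lp_ball n p) x \<partial>lborel_vec n)"
    proof (rule hom)
      fix s :: real and x assume sx: "s > 0" "x \<in> space (borel_vec n)"
      have "indicator H (scale_vec n s x) = (indicator H x :: ennreal)"
        using scale_invariantD[OF H sx] by (simp add: indicator_def)
      then show "indicator H (scale_vec n s x) * ennreal (lp_weight n p (scale_vec n s x)) =
          ennreal (s powr (p - 1)) * (indicator H x * ennreal (lp_weight n p x))"
        using sx by (simp add: lp_weight_scale_vec ennreal_mult mult_ac)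
    qed measurable
    then show ?thesis by (simp add: cone_weight_scale_invariant[OF n1 p0 H])
  qed
  have "(\<integral>\<^sup>+x. ennreal (lp_weight n p x) \<partial>p_gaussian_vec n p) = (\<integral>\<^sup>+x. indicator (space (borel_vec n)) x * ennreal (lp_weight n p x) \<partial>p_gaussian_vec n p)"
    by (intro nn_integral_cong) simp
  also have "\<dots> = ennreal K * cone_weight n p (lp_sphere n p)"
  proof -
    have "space (borel_vec n) \<inter> lp_sphere n p = lp_sphere n p" by (auto simp: lp_sphere_def space_PiM)
    then show ?thesis using int[OF scale_invariant_space] by simp
  qed
  finally have den: "(\<integral>\<^sup>+x. ennreal (lp_weight n p x) \<partial>p_gaussian_vec n p) = ennreal K * cone_weight n p (lp_sphere n p)" .
  note s = emeasure_surface_measure[OF p d(2) pr[unfolded d(1)] Gs[unfolded d(1)], folded d(1)]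
  have "cone_weight n p (G \<inter> lp_sphere n p) \<le> cone_weight n p (lp_sphere n p)"
    unfolding cone_weight_def by (intro nn_integral_mono mult_right_mono) (auto simp: indicator_def)
  then obtain x where x: "cone_weight n p (G \<inter> lp_sphere n p) = ennreal x" "x \<ge> 0"
    using s(3) by (cases "cone_weight n p (G \<inter> lp_sphere n p)" rule: ennreal_cases) (auto simp: top_unique)
  obtain y where y: "cone_weight n p (lp_sphere n p) = ennreal y" "y \<ge> 0"
    using s(3) by (cases "cone_weight n p (lp_sphere n p)" rule: ennreal_cases) auto
  have "y > 0" using y s(2) by (auto simp: less_le)
  then show ?thesis
    unfolding s(1) int[OF G] den x y using K x by (simp add: ennreal_mult[symmetric] divide_ennreal)
qed

text \<open>Transfers statements about a vector to the infinite sequence, where the moment estimates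
  for sums are available.\<close>

lemma p_gaussian_vec_eq_distr:
  assumes p: "p > 0"
  shows "p_gaussian_vec n p = distr (p_gaussian_seq p) (borel_vec n) (\<lambda>\<omega>. restrict \<omega> {..<n})"
proof -
  interpret prob_space "p_gaussian p" by (rule prob_space_p_gaussian[OF p])
  interpret product_prob_space "\<lambda>_. p_gaussian p" "UNIV :: nat set" by standard
  have "p_gaussian_vec n p = distr (p_gaussian_seq p) (p_gaussian_vec n p) (\<lambda>\<omega>. restrict \<omega> {..<n})"
    by (rule distr_PiM_restrict_finite[symmetric]) auto
  also have "\<dots> = distr (p_gaussian_seq p) (borel_vec n) (\<lambda>\<omega>. restrict \<omega> {..<n})"
    by (intro distr_cong) auto
  finally show ?thesis .
qed

lemma restrict_measurable_seq [measurable]: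
  "(\<lambda>\<omega>. restrict \<omega> {..<n}) \<in> measurable (p_gaussian_seq p) (borel_vec n)"
  by (intro measurable_restrict) simp

lemma expectation_abs_powr_pos:
  assumes p: "p > 0" and a: "a > -1"
  shows "(\<integral>x. \<bar>x\<bar> powr a \<partial>p_gaussian p) > 0"
proof -
  have "(a + 1) / p > 0" using p a by simp
  then have "Gamma (1 + (a + 1) / p) > 0" by (intro Gamma_real_pos) linarith
  then have pos: "p_gaussian_const p * (2 / (a + 1) * p powr ((a + 1) / p) * Gamma (1 + (a + 1) / p)) > 0"
    using p a p_gaussian_const_pos[OF p] by simp
  have "(\<integral>x. \<bar>x\<bar> powr a \<partial>p_gaussian p) = enn2real (\<integral>\<^sup>+x. ennreal (\<bar>x\<bar> powr a) \<partial>p_gaussian p)"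
    by (rule integral_eq_nn_integral) auto
  then show ?thesis
    unfolding nn_integral_p_gaussian_abs_powr[OF p a] using pos by (simp only: enn2real_ennreal less_imp_le)
qed

text \<open>For \<open>V = lp_weight n p \<omega> / sqrt n\<close> the difference
  \<open>V\<^sup>2 - q\<^sup>2\<close> is a centred independent sum divided by \<open>n\<close>.
  Dividing by \<open>V + q \<ge> q\<close> passes from squares to \<open>V\<close> itself.\<close>

lemma lp_weight_concentration:
  assumes p: "p \<ge> 1"
  obtains q D where "q > 0"
    "\<And>n. n \<ge> 1 \<Longrightarrow> integrable (p_gaussian_seq p) (\<lambda>\<omega>. lp_weight n p \<omega> / sqrt n)"
    "\<And>n. n \<ge> 1 \<Longrightarrow> (\<integral>\<omega>. \<bar>lp_weight n p \<omega> / sqrt n - q\<bar> \<partial>p_gaussian_seq p) \<le> D / sqrt n"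
proof -
  have p0: "p > 0" using p by simp
  interpret P: prob_space "p_gaussian_seq p" by (rule prob_space_p_gaussian_vec[OF p0])
  interpret G: prob_space "p_gaussian p" by (rule prob_space_p_gaussian[OF p0])
  define a where "a = 2 * p - 2"
  have a0: "a \<ge> 0" using p by (simp add: a_def)
  define v where "v = (\<integral>x. \<bar>x\<bar> powr a \<partial>p_gaussian p)"
  have v: "v > 0" unfolding v_def using a0 by (intro expectation_abs_powr_pos[OF p0]) simp
  define q where "q = sqrt v"
  have q: "q > 0" "q\<^sup>2 = v" using v by (auto simp: q_def)
  have int_a: "integrable (p_gaussian p) (\<lambda>x. \<bar>x\<bar> powr a)"
    using a0 by (intro integrable_p_gaussian_abs_powr[OF p0]) simp
  have sq: "integrable (p_gaussian p) (\<lambda>x. (\<bar>x\<bar> powr a - v)\<^sup>2)"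
    by (rule integrable_p_gaussian_power2[OF p0]) (use integrable_p_gaussian_abs_powr_squared[OF p0 a0] in auto)
  have mean: "(\<integral>x. \<bar>x\<bar> powr a - v \<partial>p_gaussian p) = 0"
    using int_a G.prob_space by (simp add: v_def)
  define s2 where "s2 = (\<integral>x. (\<bar>x\<bar> powr a - v)\<^sup>2 \<partial>p_gaussian p)"
  define D where "D = (s2 + 1) / (2 * q)"
  have main: "integrable (p_gaussian_seq p) (\<lambda>\<omega>. lp_weight n p \<omega> / sqrt n) \<and>
      (\<integral>\<omega>. \<bar>lp_weight n p \<omega> / sqrt n - q\<bar> \<partial>p_gaussian_seq p) \<le> D / sqrt n" if n: "n \<ge> 1" for n
  proof -
    define T where "T \<omega> = (\<Sum>i<n. \<bar>\<omega> i\<bar> powr a - v)" for \<omega> :: "nat \<Rightarrow> real"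
    have T_sq: "integrable (p_gaussian_seq p) (\<lambda>\<omega>. (T \<omega>)\<^sup>2)" "(\<integral>\<omega>. (T \<omega>)\<^sup>2 \<partial>p_gaussian_seq p) = n * s2"
      unfolding T_def s2_def by (rule second_moment_sum_coords[OF p0 _ sq mean]; simp)+
    define V where "V \<omega> = lp_weight n p \<omega> / sqrt n" for \<omega> :: "nat \<Rightarrow> real"
    have [measurable]: "V \<in> borel_measurable (p_gaussian_seq p)"
      unfolding V_def lp_weight_def by measurable
    have sn: "sqrt (real n) > 0" using n by simp
    have bound: "\<bar>V \<omega> - q\<bar> \<le> ((T \<omega>)\<^sup>2 / n + 1) / (2 * q * sqrt n)" for \<omega>
    proof -
      have V0: "V \<omega> \<ge> 0" by (simp add: V_def)
      have "(V \<omega>)\<^sup>2 = (\<Sum>i<n. \<bar>\<omega> i\<bar> powr a) / n"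
        by (simp add: V_def lp_weight_def power_divide sum_nonneg a_def)
      then have V2: "(V \<omega>)\<^sup>2 - q\<^sup>2 = T \<omega> / n"
        using n by (simp add: T_def q(2) sum_subtractf diff_divide_distrib)
      have "q * \<bar>V \<omega> - q\<bar> \<le> (V \<omega> + q) * \<bar>V \<omega> - q\<bar>" using V0 by (intro mult_right_mono) auto
      also have "\<dots> = \<bar>(V \<omega> + q) * (V \<omega> - q)\<bar>" using V0 q(1) by (simp add: abs_mult)
      also have "(V \<omega> + q) * (V \<omega> - q) = T \<omega> / n" unfolding V2[symmetric] by (simp add: power2_eq_square algebra_simps)
      also have "\<bar>T \<omega> / n\<bar> = \<bar>T \<omega> / sqrt n\<bar> / sqrt n" by (simp add: abs_mult)
      \<comment> \<open>\<open>\<bar>u\<bar> \<le> (u\<^sup>2 + 1) / 2\<close> trades the first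
        absolute moment for the second moment of \<open>T\<close>, which is known exactly; this is
        the origin of \<open>D\<close>.\<close>
      also have "\<dots> \<le> ((T \<omega> / sqrt n)\<^sup>2 + 1) / 2 / sqrt n"
      proof (intro divide_right_mono)
        have "\<bar>u\<bar> \<le> (u\<^sup>2 + 1) / 2" for u :: real
          using zero_le_power2[of "\<bar>u\<bar> - 1"] by (simp add: power2_diff)
        then show "\<bar>T \<omega> / sqrt n\<bar> \<le> ((T \<omega> / sqrt n)\<^sup>2 + 1) / 2" .
      qed simp
      finally have "q * \<bar>V \<omega> - q\<bar> \<le> ((T \<omega>)\<^sup>2 / n + 1) / 2 / sqrt n" by (simp add: power_divide)
      then have "\<bar>V \<omega> - q\<bar> * q \<le> ((T \<omega>)\<^sup>2 / n + 1) / 2 / sqrt n" by (simp only: mult.commute[of q])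
      then have "\<bar>V \<omega> - q\<bar> \<le> ((T \<omega>)\<^sup>2 / n + 1) / 2 / sqrt n / q" by (simp only: pos_le_divide_eq[OF q(1)])
      then show ?thesis by (simp add: mult_ac)
    qed
    have ib: "integrable (p_gaussian_seq p) (\<lambda>\<omega>. ((T \<omega>)\<^sup>2 / n + 1) / (2 * q * sqrt n))" using T_sq(1) by simp
    have id: "integrable (p_gaussian_seq p) (\<lambda>\<omega>. V \<omega> - q)"
    proof (rule Bochner_Integration.integrable_bound[OF ib])
      show "AE \<omega> in p_gaussian_seq p. norm (V \<omega> - q) \<le> norm (((T \<omega>)\<^sup>2 / n + 1) / (2 * q * sqrt n))"
        unfolding real_norm_def by (rule AE_I2) (rule order_trans[OF bound abs_ge_self])
    qed simp
    then have "integrable (p_gaussian_seq p) (\<lambda>\<omega>. (V \<omega> - q) + q)" by (intro Bochner_Integration.integrable_add) auto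
    then have iV: "integrable (p_gaussian_seq p) V" by simp
    have "(\<integral>\<omega>. \<bar>V \<omega> - q\<bar> \<partial>p_gaussian_seq p) \<le> (\<integral>\<omega>. ((T \<omega>)\<^sup>2 / n + 1) / (2 * q * sqrt n) \<partial>p_gaussian_seq p)"
      by (rule integral_mono) (use id ib bound in auto)
    also have "\<dots> = (s2 + 1) / (2 * q * sqrt n)"
      using T_sq n P.prob_space by simp
    finally show ?thesis using iV by (simp add: D_def V_def[abs_def])
  qed
  show ?thesis
    by (rule that[OF q(1)]) (use main in blast)+
qed

lemma lp_weight_restrict: "lp_weight n p (restrict x {..<n}) = lp_weight n p x"
  by (simp add: lp_weight_def)

text \<open>The surface probability is a quotient whose numerator and denominator lie within the L^1
  deviation of the weight from \<open>q * P.prob A\<close> and from \<open>q\<close>. The bound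
  \<open>e n\<close> does not involve \<open>G\<close>. The condition that the surface measure is a
  probability measure is supplied later by the law of the random vector.\<close>

lemma surface_measure_asymptotics:
  assumes p: "p \<ge> 1"
  obtains e :: "nat \<Rightarrow> real" where "e \<longlonglongrightarrow> 0"
    "\<forall>\<^sub>F n in sequentially. prob_space (surface_measure n p) \<longrightarrow> (\<forall>G. scale_invariant n G \<longrightarrow>
       \<bar>measure (surface_measure n p) G - measure (p_gaussian_vec n p) G\<bar> \<le> e n)"
proof -
  have p0: "p > 0" using p by simp
  interpret P: prob_space "p_gaussian_seq p" by (rule prob_space_p_gaussian_vec[OF p0])
  obtain q D where q: "q > 0"
    and iV: "\<And>n. n \<ge> 1 \<Longrightarrow> integrable (p_gaussian_seq p) (\<lambda>\<omega>. lp_weight n p \<omega> / sqrt n)"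
    and dV: "\<And>n. n \<ge> 1 \<Longrightarrow> (\<integral>\<omega>. \<bar>lp_weight n p \<omega> / sqrt n - q\<bar> \<partial>p_gaussian_seq p) \<le> D / sqrt n"
    by (rule lp_weight_concentration[OF p]) blast
  \<comment> \<open>Numerator and denominator together deviate by at most
    \<open>2 * D / sqrt n\<close>, and for large \<open>n\<close> the denominator is at least
    \<open>q / 2\<close>.\<close>
  define e where "e n = 4 * D / q / sqrt (real n)" for n
  have "e \<longlonglongrightarrow> 0" unfolding e_def by real_asymp
  moreover have "\<forall>\<^sub>F n in sequentially. prob_space (surface_measure n p) \<longrightarrow> (\<forall>G. scale_invariant n G \<longrightarrow>
       \<bar>measure (surface_measure n p) G - measure (p_gaussian_vec n p) G\<bar> \<le> e n)"
    using eventually_ge_at_top[of 2] eventually_divide_le(1)[of "q / 2" D, OF half_gt_zero[OF q]]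
  proof eventually_elim
    fix n :: nat assume n: "n \<ge> 2" and Dn: "D / sqrt n \<le> q / 2"
    show "prob_space (surface_measure n p) \<longrightarrow> (\<forall>G. scale_invariant n G \<longrightarrow>
       \<bar>measure (surface_measure n p) G - measure (p_gaussian_vec n p) G\<bar> \<le> e n)"
    proof (intro impI allI)
      fix G assume pr: "prob_space (surface_measure n p)" and G: "scale_invariant n G"
      have n1: "n \<ge> 1" using n by simp
      have Gs [measurable]: "G \<in> sets (borel_vec n)" using G by (simp add: scale_invariant_def)
      define V where "V \<omega> = lp_weight n p \<omega> / sqrt n" for \<omega> :: "nat \<Rightarrow> real"
      define A where "A = {\<omega> \<in> space (p_gaussian_seq p). restrict \<omega> {..<n} \<in> G}"
      have A: "A \<in> P.events" unfolding A_def by measurable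
      have V0: "V \<omega> \<ge> 0" for \<omega> by (simp add: V_def)
      have iV': "integrable (p_gaussian_seq p) V" using iV[OF n1] by (simp add: V_def[abs_def])
      have iA: "integrable (p_gaussian_seq p) (\<lambda>\<omega>. indicator A \<omega> * V \<omega>)"
        by (rule integrable_real_mult_indicator[OF A iV', unfolded mult.commute[of _ "indicator A _"]])
      have sn: "sqrt (real n) > 0" using n by simp
      have W: "lp_weight n p \<omega> = sqrt n * V \<omega>" for \<omega> using sn by (simp add: V_def)
      have num: "(\<integral>\<^sup>+x. indicator G x * ennreal (lp_weight n p x) \<partial>p_gaussian_vec n p) = ennreal (sqrt n * (\<integral>\<omega>. indicator A \<omega> * V \<omega> \<partial>p_gaussian_seq p))"
      proof -
        have "(\<integral>\<^sup>+x. indicator G x * ennreal (lp_weight n p x) \<partial>p_gaussian_vec n p) =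
            (\<integral>\<^sup>+\<omega>. indicator G (restrict \<omega> {..<n}) * ennreal (lp_weight n p (restrict \<omega> {..<n})) \<partial>p_gaussian_seq p)"
          unfolding p_gaussian_vec_eq_distr[OF p0, of n] by (rule nn_integral_distr) measurable
        also have "\<dots> = (\<integral>\<^sup>+\<omega>. ennreal (sqrt n * (indicator A \<omega> * V \<omega>)) \<partial>p_gaussian_seq p)"
          by (rule nn_integral_cong) (simp add: lp_weight_restrict A_def W indicator_def)
        also have "\<dots> = ennreal (\<integral>\<omega>. sqrt n * (indicator A \<omega> * V \<omega>) \<partial>p_gaussian_seq p)"
          using iA V0 by (intro nn_integral_eq_integral) auto
        finally show ?thesis by simp
      qed
      have den: "(\<integral>\<^sup>+x. ennreal (lp_weight n p x) \<partial>p_gaussian_vec n p) = ennreal (sqrt n * (\<integral>\<omega>. V \<omega> \<partial>p_gaussian_seq p))"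
      proof -
        have "(\<integral>\<^sup>+x. ennreal (lp_weight n p x) \<partial>p_gaussian_vec n p) = (\<integral>\<^sup>+\<omega>. ennreal (lp_weight n p (restrict \<omega> {..<n})) \<partial>p_gaussian_seq p)"
          unfolding p_gaussian_vec_eq_distr[OF p0, of n] by (rule nn_integral_distr) measurable
        also have "\<dots> = (\<integral>\<^sup>+\<omega>. ennreal (sqrt n * V \<omega>) \<partial>p_gaussian_seq p)" by (simp add: lp_weight_restrict W)
        also have "\<dots> = ennreal (\<integral>\<omega>. sqrt n * V \<omega> \<partial>p_gaussian_seq p)"
          using iV' V0 by (intro nn_integral_eq_integral) auto
        finally show ?thesis by simp
      qed
      define a where "a = (\<integral>\<omega>. indicator A \<omega> * V \<omega> \<partial>p_gaussian_seq p)"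
      define b where "b = (\<integral>\<omega>. V \<omega> \<partial>p_gaussian_seq p)"
      define \<delta> where "\<delta> = (\<integral>\<omega>. \<bar>V \<omega> - q\<bar> \<partial>p_gaussian_seq p)"
      have id: "integrable (p_gaussian_seq p) (\<lambda>\<omega>. V \<omega> - q)" using iV' by simp
      have \<delta>: "\<delta> \<le> D / sqrt n" using dV[OF n1] by (simp add: \<delta>_def V_def)
      have bq: "\<bar>b - q\<bar> \<le> \<delta>"
      proof -
        have "b - q = (\<integral>\<omega>. V \<omega> - q \<partial>p_gaussian_seq p)" using iV' P.prob_space by (simp add: b_def)
        then show ?thesis unfolding \<delta>_def using integral_abs_bound[of "p_gaussian_seq p" "\<lambda>\<omega>. V \<omega> - q"] by simp
      qed
      have iI: "integrable (p_gaussian_seq p) (\<lambda>\<omega>. indicator A \<omega> * q)"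
        using A by (intro integrable_mult_left) (simp add: P.emeasure_eq_measure)
      have aq: "\<bar>a - q * P.prob A\<bar> \<le> \<delta>"
      proof -
        have "(\<integral>\<omega>. indicator A \<omega> * q \<partial>p_gaussian_seq p) = P.prob A * q" using A by simp
        then have "a - q * P.prob A = (\<integral>\<omega>. indicator A \<omega> * V \<omega> - indicator A \<omega> * q \<partial>p_gaussian_seq p)"
          unfolding a_def using iA iI by (subst Bochner_Integration.integral_diff) (auto simp: mult.commute)
        also have "\<bar>\<dots>\<bar> \<le> (\<integral>\<omega>. \<bar>indicator A \<omega> * V \<omega> - indicator A \<omega> * q\<bar> \<partial>p_gaussian_seq p)" by (rule integral_abs_bound)
        also have "\<dots> \<le> \<delta>"
          unfolding \<delta>_def by (rule integral_mono) (use iA iI id in \<open>auto simp: indicator_def\<close>)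
        finally show ?thesis .
      qed
      have b: "b \<ge> q / 2" "b > 0" using bq \<delta> Dn q by linarith+
      have a0: "a \<ge> 0" unfolding a_def using V0 by (intro Bochner_Integration.integral_nonneg) simp
      have "emeasure (surface_measure n p) G = ennreal (a / b)"
        unfolding emeasure_surface_measure_cone[OF n p pr G] num den a_def[symmetric] b_def[symmetric]
        using sn a0 b by (simp add: divide_ennreal)
      then have mS: "measure (surface_measure n p) G = a / b" using a0 b by (simp add: measure_def)
      have mG: "measure (p_gaussian_vec n p) G = P.prob A"
        unfolding p_gaussian_vec_eq_distr[OF p0, of n]
        by (subst measure_distr) (auto simp: A_def intro!: arg_cong[where f=P.prob])
      have P01: "0 \<le> P.prob A" "P.prob A \<le> 1" by auto
      have "a / b - P.prob A = ((a - q * P.prob A) - (b - q) * P.prob A) / b"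
        using b by (simp add: field_simps)
      then have "\<bar>a / b - P.prob A\<bar> = \<bar>(a - q * P.prob A) - (b - q) * P.prob A\<bar> / b" using b by simp
      also have "\<dots> \<le> (\<delta> + \<delta>) / (q / 2)"
      proof (intro frac_le)
        have "\<bar>(b - q) * P.prob A\<bar> \<le> \<delta> * 1" unfolding abs_mult using bq P01 by (intro mult_mono) auto
        then show "\<bar>(a - q * P.prob A) - (b - q) * P.prob A\<bar> \<le> \<delta> + \<delta>" using aq by linarith
      qed (use bq b q in auto)
      also have "\<dots> = 4 / q * \<delta>" by simp
      also have "\<dots> \<le> 4 / q * (D / sqrt n)" using \<delta> q by (intro mult_left_mono) auto
      finally show "\<bar>measure (surface_measure n p) G - measure (p_gaussian_vec n p) G\<bar> \<le> e n"
        by (simp add: mS mG e_def)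
    qed
  qed
  ultimately show ?thesis by (rule that)
qed

section \<open>Scale invariance of the ratio and comparison of the laws\<close>

lemma maclaurin_mean_scale_vec:
  assumes "s > 0" "p > 0" "k \<ge> 1"
  shows "maclaurin_mean n k p (scale_vec n s x) = s * maclaurin_mean n k p x"
proof -
  let ?C = "{I. I \<subseteq> {..<n} \<and> card I = k}"
  have "(\<Sum>I\<in>?C. \<Prod>i\<in>I. \<bar>scale_vec n s x i\<bar> powr p) = (\<Sum>I\<in>?C. s powr (k * p) * (\<Prod>i\<in>I. \<bar>x i\<bar> powr p))"
  proof (rule sum.cong[OF refl])
    fix I assume I: "I \<in> ?C"
    then have "(\<Prod>i\<in>I. \<bar>scale_vec n s x i\<bar> powr p) = (\<Prod>i\<in>I. s powr p * \<bar>x i\<bar> powr p)"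
      using assms by (intro prod.cong) (auto simp: scale_vec_apply abs_mult powr_mult)
    also have "\<dots> = (s powr p) ^ k * (\<Prod>i\<in>I. \<bar>x i\<bar> powr p)" using I by (simp add: prod.distrib)
    also have "(s powr p) ^ k = s powr (k * p)" using assms by (simp add: powr_powr[symmetric] powr_realpow[symmetric] mult.commute)
    finally show "(\<Prod>i\<in>I. \<bar>scale_vec n s x i\<bar> powr p) = s powr (k * p) * (\<Prod>i\<in>I. \<bar>x i\<bar> powr p)" .
  qed
  also have "\<dots> = s powr (k * p) * (\<Sum>I\<in>?C. \<Prod>i\<in>I. \<bar>x i\<bar> powr p)" by (simp add: sum_distrib_left)
  finally have "maclaurin_mean n k p (scale_vec n s x) =
      (s powr (k * p) * ((\<Sum>I\<in>?C. \<Prod>i\<in>I. \<bar>x i\<bar> powr p) / real (n choose k))) powr (1 / (real k * p))"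
    by (simp add: maclaurin_mean_def)
  also have "\<dots> = (s powr (k * p)) powr (1 / (real k * p)) * maclaurin_mean n k p x"
    unfolding maclaurin_mean_def by (rule powr_mult)
  also have "(s powr (k * p)) powr (1 / (real k * p)) = s" using assms by (simp add: powr_powr)
  finally show ?thesis .
qed

lemma scale_invariant_ratio_fluctuation:
  assumes p: "p > 0" and k: "1 \<le> k" "1 \<le> n"
  shows "scale_invariant n {x \<in> space (borel_vec n). ratio_fluctuation k p n x \<le> t}"
  unfolding scale_invariant_def
proof (intro conjI allI impI)
  have [measurable]: "ratio_fluctuation k p n \<in> borel_measurable (borel_vec n)"
    by (rule ratio_fluctuation_measurable) simp
  show "{x \<in> space (borel_vec n). ratio_fluctuation k p n x \<le> t} \<in> sets (borel_vec n)" by measurable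
  fix s :: real and x assume sx: "s > 0" "x \<in> space (borel_vec n)"
  have "maclaurin_ratio n k n p (scale_vec n s x) = maclaurin_ratio n k n p x"
    using sx p k by (simp add: maclaurin_ratio_def maclaurin_mean_scale_vec)
  then show "scale_vec n s x \<in> {x \<in> space (borel_vec n). ratio_fluctuation k p n x \<le> t} \<longleftrightarrow>
     x \<in> {x \<in> space (borel_vec n). ratio_fluctuation k p n x \<le> t}"
    using sx by (simp add: ratio_fluctuation_def)
qed

lemma ratio_fluctuation_restrict: "ratio_fluctuation k p n (restrict x {..<n}) = ratio_fluctuation k p n x"
proof -
  have "maclaurin_mean n m p (restrict x {..<n}) = maclaurin_mean n m p x" for m
    unfolding maclaurin_mean_def
    by (intro arg_cong2[where f="(powr)"] arg_cong2[where f="(/)"] sum.cong prod.cong refl) auto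
  then show ?thesis by (simp add: ratio_fluctuation_def maclaurin_ratio_def)
qed

theorem theorem1:
  fixes k :: nat and p :: real
    and M :: "nat \<Rightarrow> 'a measure"
    and X :: "nat \<Rightarrow> 'a \<Rightarrow> nat \<Rightarrow> real"
  assumes "k \<ge> 1" and "p \<ge> 1"
    and "\<And>n. n \<ge> k \<Longrightarrow> prob_space (M n)"
    and "\<And>n. n \<ge> k \<Longrightarrow> X n \<in> measurable (M n) (borel_vec n)"
    and "\<And>n. n \<ge> k \<Longrightarrow>
           (\<exists>\<rho>. real_distribution \<rho> \<and> (AE r in \<rho>. r > 0) \<and>
                distr (M n) (borel_vec n) (X n) = radial_distribution n p \<rho>)
           \<or> distr (M n) (borel_vec n) (X n) = surface_measure n p"
  shows "weak_conv_m
           (\<lambda>n. distr (M n) borel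
              (\<lambda>\<omega>. sqrt (real n) * (exp (- log_mean p) * maclaurin_ratio n k n p (X n \<omega>) - 1)))
           (density lborel (normal_density 0 (sqrt (limit_variance p))))"
proof -
  have p0: "p > 0" using assms(2) by simp
  interpret P: prob_space "p_gaussian_seq p" by (rule prob_space_p_gaussian_vec[OF p0])
  let ?\<mu> = "density lborel (normal_density 0 (sqrt (limit_variance p)))"
  obtain e :: "nat \<Rightarrow> real" where e: "e \<longlonglongrightarrow> 0" and
    surf: "\<forall>\<^sub>F n in sequentially. prob_space (surface_measure n p) \<longrightarrow> (\<forall>G. scale_invariant n G \<longrightarrow>
       \<bar>measure (surface_measure n p) G - measure (p_gaussian_vec n p) G\<bar> \<le> e n)"
    by (rule surface_measure_asymptotics[OF assms(2)])
  have "weak_conv_m (\<lambda>n. distr (M n) borel (\<lambda>\<omega>. ratio_fluctuation k p n (X n \<omega>))) ?\<mu>"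
    unfolding weak_conv_m_def weak_conv_def
  proof (intro allI impI)
    fix t assume t: "isCont (cdf ?\<mu>) t"
    let ?F = "\<lambda>n. cdf (distr (M n) borel (\<lambda>\<omega>. ratio_fluctuation k p n (X n \<omega>))) t"
    let ?H = "\<lambda>n. cdf (distr (p_gaussian_seq p) borel (ratio_fluctuation k p n)) t"
    have H: "?H \<longlonglongrightarrow> cdf ?\<mu> t"
      using ratio_fluctuation_CLT[OF assms(1,2)] t unfolding weak_conv_m_def weak_conv_def by blast
    \<comment> \<open>Both distribution functions at \<open>t\<close> are probabilities of one
      scale-invariant set. The absolute value also serves the radial case, in which they agree
      exactly and the bound has only to be nonnegative.\<close>
    have "\<forall>\<^sub>F n in sequentially. norm (?F n - ?H n) \<le> \<bar>e n\<bar>"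
      using surf eventually_ge_at_top[of k]
    proof eventually_elim
      fix n assume n: "n \<ge> k" and s: "prob_space (surface_measure n p) \<longrightarrow> (\<forall>G. scale_invariant n G \<longrightarrow>
       \<bar>measure (surface_measure n p) G - measure (p_gaussian_vec n p) G\<bar> \<le> e n)"
      have n1: "n \<ge> 1" using n assms(1) by simp
      interpret Mn: prob_space "M n" by (rule assms(3)[OF n])
      note X [measurable] = assms(4)[OF n]
      have rf [measurable]: "ratio_fluctuation k p n \<in> borel_measurable (borel_vec n)"
        by (rule ratio_fluctuation_measurable) simp
      have rfs: "ratio_fluctuation k p n \<in> borel_measurable (p_gaussian_seq p)"
        using ratio_fluctuation_measurable[of n UNIV k p]
        by (simp add: measurable_cong_sets[OF sets_p_gaussian_vec refl])
      define G where "G = {x \<in> space (borel_vec n). ratio_fluctuation k p n x \<le> t}"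
      have G: "scale_invariant n G"
        unfolding G_def by (rule scale_invariant_ratio_fluctuation[OF p0 assms(1) n1])
      have Gs: "G \<in> sets (borel_vec n)" using G by (simp add: scale_invariant_def)
      \<comment> \<open>Under either alternative this transfers mass 1 to the measure in question,
        excluding the zero default.\<close>
      have pr: "prob_space (distr (M n) (borel_vec n) (X n))" by (rule Mn.prob_space_distr[OF X])
      have F: "?F n = measure (distr (M n) (borel_vec n) (X n)) G"
      proof -
        have "?F n = Mn.prob ((\<lambda>\<omega>. ratio_fluctuation k p n (X n \<omega>)) -` {..t} \<inter> space (M n))"
          unfolding cdf_def2 by (rule measure_distr) auto
        also have "(\<lambda>\<omega>. ratio_fluctuation k p n (X n \<omega>)) -` {..t} \<inter> space (M n) = X n -` G \<inter> space (M n)"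
          using measurable_space[OF X] by (auto simp: G_def)
        also have "Mn.prob (X n -` G \<inter> space (M n)) = measure (distr (M n) (borel_vec n) (X n)) G"
          by (rule measure_distr[OF X Gs, symmetric])
        finally show ?thesis .
      qed
      have Hn: "?H n = measure (p_gaussian_vec n p) G"
      proof -
        have "?H n = P.prob (ratio_fluctuation k p n -` {..t} \<inter> space (p_gaussian_seq p))"
          unfolding cdf_def2 by (rule measure_distr[OF rfs]) auto
        also have "ratio_fluctuation k p n -` {..t} \<inter> space (p_gaussian_seq p) = (\<lambda>\<omega>. restrict \<omega> {..<n}) -` G \<inter> space (p_gaussian_seq p)"
          using measurable_space[OF restrict_measurable_seq[of n p]] by (auto simp: G_def ratio_fluctuation_restrict)
        also have "P.prob ((\<lambda>\<omega>. restrict \<omega> {..<n}) -` G \<inter> space (p_gaussian_seq p)) = measure (p_gaussian_vec n p) G"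
          unfolding p_gaussian_vec_eq_distr[OF p0, of n] by (rule measure_distr[OF restrict_measurable_seq Gs, symmetric])
        finally show ?thesis .
      qed
      from assms(5)[OF n] show "norm (?F n - ?H n) \<le> \<bar>e n\<bar>"
      proof
        assume "\<exists>\<rho>. real_distribution \<rho> \<and> (AE r in \<rho>. r > 0) \<and> distr (M n) (borel_vec n) (X n) = radial_distribution n p \<rho>"
        then obtain \<rho> where \<rho>: "real_distribution \<rho>" "AE r in \<rho>. r > 0" "distr (M n) (borel_vec n) (X n) = radial_distribution n p \<rho>" by blast
        have "measure (radial_distribution n p \<rho>) G = measure (p_gaussian_vec n p) G"
          using emeasure_radial_distribution_cone[OF n1 p0 G \<rho>(1,2) pr[unfolded \<rho>(3)]] by (simp add: measure_def)
        then show ?thesis unfolding F Hn \<rho>(3) by simp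
      next
        assume d: "distr (M n) (borel_vec n) (X n) = surface_measure n p"
        show ?thesis using s pr G unfolding F Hn d by auto
      qed
    qed
    then have "(\<lambda>n. ?F n - ?H n) \<longlonglongrightarrow> 0"
      by (rule Lim_null_comparison) (use tendsto_rabs[OF e] in simp)
    from tendsto_add[OF this H] show "?F \<longlonglongrightarrow> cdf ?\<mu> t" by simp
  qed
  then show ?thesis by (simp add: ratio_fluctuation_def)
qed

end
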